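(* Let $r\in(-1,1)$ and let $\mathcal W_1,\mathcal W_2$ be two standard Brownian motions on $[0,1]$ that are jointly Gaussian with constant correlation coefficient $r$. Put $\mathcal X^{i,i}=D(\mathcal W_i)$, $\mathcal X^{i,i}_n=D_n(\mathcal W_i)$ for $i\in\{1,2\}$, $\mathcal X^{1,2}=A(\mathcal W_1,\mathcal W_2)$, $\mathcal X^{1,2}_n=A_n(\mathcal W_1,\mathcal W_2)$, $\rho=F(\mathcal X^{1,2},\mathcal X^{1,1},\mathcal X^{2,2})$, $\rho_n=F(\mathcal X^{1,2}_n,\mathcal X^{1,1}_n,\mathcal X^{2,2}_n)$, $\mathcal U=(\mathcal X^{1,2},\mathcal X^{1,1},\mathcal X^{2,2})^{\mathrm T}$ and $\mathcal U_n=(\mathcal X^{1,2}_n,\mathcal X^{1,1}_n,\mathcal X^{2,2}_n)^{\mathrm T}$. Then the following hold. 1. There is a decomposition $n(\mathcal U_n-\mathcal U)=\boldsymbol\mu(\mathcal W_1,\mathcal W_2)+\mathcal Z_n$ such that, as $n\to\infty$, $(\mathcal Z_n,\mathcal W_1,\mathcal W_2)\to(\mathcal Z,\mathcal W_1,\mathcal W_2)$ in distribution, where, conditional on $(\mathcal W_1,\mathcal W_2)$, $\mathcal Z$ is normally distributed with zero mean. 2. There is a decomposition $n(\rho_n-\rho)=\mu(\mathcal W_1,\mathcal W_2)+\mathcal Y_n$ such that, as $n\to\infty$, $(\mathcal Y_n,\mathcal W_1,\mathcal W_2)\to(\mathcal Y,\mathcal W_1,\mathcal W_2)$ in distribution,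 where, conditional on $(\mathcal W_1,\mathcal W_2)$, $\mathcal Y$ is normally distributed with zero mean. 3. As $n\to\infty$, $$\frac{n(\rho_n-\rho)-\mu(\mathcal W_1,\mathcal W_2)}{\sigma^r(\mathcal W_1,\mathcal W_2)}\to\mathcal N(0,1)\quad\text{in distribution.}$$
   Context: "Jointly Gaussian with constant correlation coefficient $r$" means that $(\mathcal W_1,\mathcal W_2)$ is a centered Gaussian process with $\mathbf E[\mathcal W_1(s)\mathcal W_2(t)]=r\,(s\wedge t)$; equivalently (for $|r|<1$) $\mathcal W_1$ and $(\mathcal W_2-r\mathcal W_1)/\sqrt{1-r^2}$ are independent standard Brownian motions. $F(a,b,c)=a/\sqrt{bc}$, and $\nabla F$ denotes its gradient. For $f,g\in C([0,1])$ and $n\ge1$: $D(f)=\int_0^1 f(t)^2dt-\left(\int_0^1 f(t)dt\right)^2$; $D_n(f)=\frac1n\sum_{k=0}^{n-1}f(k/n)^2-\left(\frac1n\sum_{k=0}^{n-1}f(k/n)\right)^2$; $A(f,g)=\int_0^1 f(t)g(t)dt-\left(\int_0^1 f(t)dt\right)\left(\int_0^1 g(t)dt\right)$; $A_n(f,g)=\frac1n\sum_{k=0}^{n-1}f(k/n)g(k/n)-\frac1{n^2}\sum_{k=0}^{n-1}f(k/n)\sum_{k=0}^{n-1}g(k/n)$. With $\bar f=\int_0^1 f(t)dt$, $\bar g=\int_0^1 g(t)dt$: $\boldsymbol\mu(f,g)=\left(\tfrac12 f(1)\bar g+\tfrac12 g(1)\bar f-\tfrac12 f(1)g(1),\ f(1)\bar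 f-\tfrac12 f(1)^2,\ g(1)\bar g-\tfrac12 g(1)^2\right)^{\mathrm T}$; $\mu(f,g)=\nabla F(A(f,g),D(f),D(g))\cdot\boldsymbol\mu(f,g)$; $\sigma^r(f,g)=\frac1{\sqrt{12}}\cdot\frac{\sqrt{(D(f)D(g)-A(f,g)^2)(D(f)+D(g)-2rA(f,g))}}{D(f)D(g)}$. Convergence in distribution in parts 1 and 2 is that of random elements of $\mathbb R^3\times C([0,1])^2$ and $\mathbb R\times C([0,1])^2$ respectively (uniform topology on $C([0,1])$); the limits $\mathcal Z,\mathcal Y$ may live on an extended probability space. $\rho_n$ is considered for $n\ge2$, where it is almost surely well defined. *)

theory Defs
  imports "HOL-Probability.Probability"
begin

section \<open>The space of continuous functions on the unit interval\<close>

text \<open>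
  \<open>C([0,1])\<close> with the uniform topology is the library type of bounded continuous
  functions (sup metric) on the metric space \<open>[0,1]\<close>; since \<open>[0,1]\<close> is compact,
  boundedness is no restriction.
\<close>

typedef unit_interval = "{0..1::real}"
  morphisms real_of_ui ui_of_real
  by (rule exI[of _ 0]) simp

instantiation unit_interval :: metric_space
begin

definition dist_unit_interval :: "unit_interval \<Rightarrow> unit_interval \<Rightarrow> real"
  where "dist_unit_interval x y = dist (real_of_ui x) (real_of_ui y)"

definition uniformity_unit_interval :: "(unit_interval \<times> unit_interval) filter"
  where "uniformity_unit_interval = (INF e\<in>{0 <..}. principal {(x, y). dist x y < e})"

definition open_unit_interval :: "unit_interval set \<Rightarrow> bool"
  where "open_unit_interval U \<longleftrightarrow>
    (\<forall>x\<in>U. eventually (\<lambda>(x', y). x' = x \<longrightarrow> y \<in> U) uniformity)"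

instance
proof
  fix x y z :: unit_interval
  show "dist x y = 0 \<longleftrightarrow> x = y"
    by (simp add: dist_unit_interval_def real_of_ui_inject)
  show "dist x y \<le> dist x z + dist y z"
    unfolding dist_unit_interval_def by (rule dist_triangle2)
qed (rule uniformity_unit_interval_def open_unit_interval_def)+

end

type_synonym C01 = "unit_interval \<Rightarrow>\<^sub>C real"

definition to_C01 :: "(real \<Rightarrow> real) \<Rightarrow> C01"
  where "to_C01 f = Bcontfun (\<lambda>t. f (real_of_ui t))"

lemma to_C01_apply:
  assumes "continuous_on {0..1} f"
  shows "apply_bcontfun (to_C01 f) t = f (real_of_ui t)"
proof -
  have mem: "real_of_ui s \<in> {0..1}" for s
    using real_of_ui by blast
  have "continuous_on UNIV real_of_ui"
    unfolding continuous_on_iff by (auto simp: dist_unit_interval_def)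
  then have "continuous_on UNIV (\<lambda>t. f (real_of_ui t))"
    by (rule continuous_on_compose2[OF assms]) (use mem in auto)
  moreover have "bounded (f ` {0..1})"
    using assms by (intro compact_imp_bounded compact_continuous_image) auto
  then have "bounded (range (\<lambda>t. f (real_of_ui t)))"
    by (rule bounded_subset) (use mem in auto)
  ultimately have "(\<lambda>t. f (real_of_ui t)) \<in> bcontfun"
    by (simp add: bcontfun_def)
  then show ?thesis
    by (simp add: to_C01_def Bcontfun_inverse)
qed


section \<open>Gaussian laws and correlated Brownian motions\<close>

text \<open>The law \<open>N(m, s\<^sup>2)\<close>, including the degenerate case \<open>s = 0\<close>.\<close>

definition normal_law :: "real \<Rightarrow> real \<Rightarrow> real measure"
  where "normal_law m s =
    (if s = 0 then return borel m else density lborel (normal_density m s))"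

text \<open>A law on a Euclidean space is (multivariate) normal with mean zero if all its
  one-dimensional projections are; the covariance matrix may be singular.\<close>

definition centered_normal :: "'e::euclidean_space measure \<Rightarrow> bool"
  where "centered_normal \<nu> \<longleftrightarrow> sets \<nu> = sets borel \<and>
    (\<forall>u. \<exists>s\<ge>0. distr \<nu> borel (\<lambda>x. x \<bullet> u) = normal_law 0 s)"

definition centered_gaussian_process ::
  "'a measure \<Rightarrow> 'i set \<Rightarrow> ('i \<Rightarrow> 'a \<Rightarrow> real) \<Rightarrow> bool"
  where "centered_gaussian_process M T X \<longleftrightarrow>
    (\<forall>i\<in>T. X i \<in> borel_measurable M) \<and>
    (\<forall>S c. finite S \<and> S \<subseteq> T \<longrightarrow>
      (\<exists>s\<ge>0. distr M borel (\<lambda>\<omega>. \<Sum>i\<in>S. c i * X i \<omega>) = normal_law 0 s))"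

text \<open>Processes are written as random functions: \<open>W \<omega> t\<close> is the value of the sample path
  \<open>W \<omega>\<close> at time \<open>t\<close>. Only times in \<open>[0,1]\<close> matter.\<close>

definition standard_brownian_motion ::
  "'a measure \<Rightarrow> ('a \<Rightarrow> real \<Rightarrow> real) \<Rightarrow> bool"
  where "standard_brownian_motion M W \<longleftrightarrow>
    (\<forall>t\<in>{0..1}. (\<lambda>\<omega>. W \<omega> t) \<in> borel_measurable M) \<and>
    (AE \<omega> in M. W \<omega> 0 = 0) \<and>
    (\<forall>\<omega>\<in>space M. continuous_on {0..1} (W \<omega>)) \<and>
    (\<forall>s t. 0 \<le> s \<and> s < t \<and> t \<le> 1 \<longrightarrow>
      distributed M lborel (\<lambda>\<omega>. W \<omega> t - W \<omega> s) (normal_density 0 (sqrt (t - s)))) \<and>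
    (\<forall>(m::nat) (t::nat \<Rightarrow> real). mono_on {..m} t \<and> t ` {..m} \<subseteq> {0..1} \<longrightarrow>
      prob_space.indep_vars M (\<lambda>_. borel) (\<lambda>k \<omega>. W \<omega> (t (Suc k)) - W \<omega> (t k)) {..<m})"

definition correlated_brownian_motions ::
  "'a measure \<Rightarrow> real \<Rightarrow> ('a \<Rightarrow> real \<Rightarrow> real) \<Rightarrow> ('a \<Rightarrow> real \<Rightarrow> real) \<Rightarrow> bool"
  where "correlated_brownian_motions M r W1 W2 \<longleftrightarrow>
    standard_brownian_motion M W1 \<and> standard_brownian_motion M W2 \<and>
    centered_gaussian_process M ({0..1} <+> {0..1})
      (\<lambda>i \<omega>. case i of Inl t \<Rightarrow> W1 \<omega> t | Inr t \<Rightarrow> W2 \<omega> t) \<and>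
    (\<forall>s\<in>{0..1}. \<forall>t\<in>{0..1}. (\<integral>\<omega>. W1 \<omega> s * W2 \<omega> t \<partial>M) = r * min s t)"


section \<open>Convergence in distribution and conditional normality\<close>

text \<open>Random elements of a metric space, possibly on different probability spaces.\<close>

definition converges_in_distribution ::
  "'a measure \<Rightarrow> (nat \<Rightarrow> 'a \<Rightarrow> 'b::metric_space) \<Rightarrow> 'c measure \<Rightarrow> ('c \<Rightarrow> 'b) \<Rightarrow> bool"
  where "converges_in_distribution M X M' X' \<longleftrightarrow>
    (\<forall>n. X n \<in> borel_measurable M) \<and> X' \<in> borel_measurable M' \<and>
    (\<forall>\<phi> :: 'b \<Rightarrow> real. continuous_on UNIV \<phi> \<and> bounded (range \<phi>) \<longrightarrow>
      (\<lambda>n. \<integral>\<omega>. \<phi> (X n \<omega>) \<partial>M) \<longlonglongrightarrow> (\<integral>\<omega>. \<phi> (X' \<omega>) \<partial>M'))"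

text \<open>A random variable \<open>X\<close> on \<open>M\<close> becomes \<open>X \<circ> \<pi>\<close> on the extension \<open>M'\<close>.\<close>

definition extends_prob_space ::
  "'c measure \<Rightarrow> 'a measure \<Rightarrow> ('c \<Rightarrow> 'a) \<Rightarrow> bool"
  where "extends_prob_space M' M \<pi> \<longleftrightarrow>
    prob_space M' \<and> \<pi> \<in> measurable M' M \<and> distr M' M \<pi> = M"

text \<open>The regular conditional distribution \<open>\<kappa> (X \<omega>)\<close> of \<open>Z\<close> given \<open>X\<close> is almost surely
  a centered normal law.\<close>

definition conditionally_centered_normal ::
  "'c measure \<Rightarrow> ('c \<Rightarrow> 'e::euclidean_space) \<Rightarrow> ('c \<Rightarrow> 'b::topological_space) \<Rightarrow> bool"
  where "conditionally_centered_normal M Z X \<longleftrightarrow>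
    Z \<in> borel_measurable M \<and> X \<in> borel_measurable M \<and>
    (\<exists>\<kappa> \<in> measurable borel (prob_algebra borel).
      (\<forall>A\<in>sets borel. \<forall>B\<in>sets borel.
        measure M {\<omega>\<in>space M. Z \<omega> \<in> A \<and> X \<omega> \<in> B} =
        (\<integral>\<omega>. indicator B (X \<omega>) * measure (\<kappa> (X \<omega>)) A \<partial>M)) \<and>
      (AE \<omega> in M. centered_normal (\<kappa> (X \<omega>))))"


section \<open>The functionals\<close>

definition D :: "(real \<Rightarrow> real) \<Rightarrow> real"
  where "D f = integral {0..1} (\<lambda>t. (f t)\<^sup>2) - (integral {0..1} f)\<^sup>2"

definition D_n :: "nat \<Rightarrow> (real \<Rightarrow> real) \<Rightarrow> real"
  where "D_n n f = 1 / real n * (\<Sum>k<n. (f (real k / real n))\<^sup>2)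
    - (1 / real n * (\<Sum>k<n. f (real k / real n)))\<^sup>2"

definition A :: "(real \<Rightarrow> real) \<Rightarrow> (real \<Rightarrow> real) \<Rightarrow> real"
  where "A f g = integral {0..1} (\<lambda>t. f t * g t) - integral {0..1} f * integral {0..1} g"

definition A_n :: "nat \<Rightarrow> (real \<Rightarrow> real) \<Rightarrow> (real \<Rightarrow> real) \<Rightarrow> real"
  where "A_n n f g = 1 / real n * (\<Sum>k<n. f (real k / real n) * g (real k / real n))
    - 1 / (real n)\<^sup>2 * (\<Sum>k<n. f (real k / real n)) * (\<Sum>k<n. g (real k / real n))"

definition F :: "real^3 \<Rightarrow> real"
  where "F v = v $ 1 / sqrt (v $ 2 * v $ 3)"

definition gradient :: "('e::euclidean_space \<Rightarrow> real) \<Rightarrow> 'e \<Rightarrow> 'e"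
  where "gradient h x = (THE v. GDERIV h x :> v)"

lemma gradient_eqI:
  assumes "GDERIV h x :> v"
  shows "gradient h x = v"
  unfolding gradient_def
proof (rule the_equality)
  show "GDERIV h x :> v" by fact
  fix w assume "GDERIV h x :> w"
  with assms have "(\<lambda>y. inner y w) = (\<lambda>y. inner y v)"
    unfolding gderiv_def by (rule has_derivative_unique[rotated])
  then have "(w - v) \<bullet> (w - v) = 0"
    by (auto simp: inner_diff_right inner_commute fun_eq_iff inner_diff_left)
  then show "w = v"
    by simp
qed

definition U :: "(real \<Rightarrow> real) \<Rightarrow> (real \<Rightarrow> real) \<Rightarrow> real^3"
  where "U f g = vector [A f g, D f, D g]"

definition U_n :: "nat \<Rightarrow> (real \<Rightarrow> real) \<Rightarrow> (real \<Rightarrow> real) \<Rightarrow> real^3"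
  where "U_n n f g = vector [A_n n f g, D_n n f, D_n n g]"

definition rho :: "(real \<Rightarrow> real) \<Rightarrow> (real \<Rightarrow> real) \<Rightarrow> real"
  where "rho f g = F (U f g)"

definition rho_n :: "nat \<Rightarrow> (real \<Rightarrow> real) \<Rightarrow> (real \<Rightarrow> real) \<Rightarrow> real"
  where "rho_n n f g = F (U_n n f g)"

definition mu_vec :: "(real \<Rightarrow> real) \<Rightarrow> (real \<Rightarrow> real) \<Rightarrow> real^3"
  where "mu_vec f g = (let f_bar = integral {0..1} f; g_bar = integral {0..1} g in
    vector [1/2 * f 1 * g_bar + 1/2 * g 1 * f_bar - 1/2 * f 1 * g 1,
            f 1 * f_bar - 1/2 * (f 1)\<^sup>2,
            g 1 * g_bar - 1/2 * (g 1)\<^sup>2])"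

definition mu :: "(real \<Rightarrow> real) \<Rightarrow> (real \<Rightarrow> real) \<Rightarrow> real"
  where "mu f g = gradient F (U f g) \<bullet> mu_vec f g"

definition sigma_r :: "real \<Rightarrow> (real \<Rightarrow> real) \<Rightarrow> (real \<Rightarrow> real) \<Rightarrow> real"
  where "sigma_r r f g = 1 / sqrt 12 *
    (sqrt ((D f * D g - (A f g)\<^sup>2) * (D f + D g - 2 * r * A f g)) / (D f * D g))"

end

theory Submission
  imports Defs "HOL-Real_Asymp.Real_Asymp"
begin

text \<open>
  Write \<open>f\<close>, \<open>g\<close> for the two paths, cut \<open>[0,1]\<close> into \<open>n\<close> cells, and call the values at the grid
  points \<open>k/n\<close> the skeleton. Left Riemann sums of \<open>f\<close> differ from the integral by a boundary term and
  by the integrals of the Brownian bridges that \<open>f\<close> performs inside the cells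
  (\<open>left_mean_error\<close>). For products \<open>f g\<close> there is, besides a boundary term and a term linear in the
  bridge integrals, a difference of two quadratic expressions in increments; each of them is close
  to its mean, and the means cancel (\<open>brownian_square_remainder\<close>). Altogether
  \<open>n (U_n - U)\<close> equals \<open>mu_vec f g\<close>, plus a leading term linear in the bridge integrals whose
  coefficients depend on the skeleton only, plus a term tending to zero in probability
  (\<open>A_n_decomposition\<close>, \<open>null_fluctuation\<close>).

  Bridge integrals and skeleton are jointly Gaussian and uncorrelated, hence independent. So the
  leading term is, conditionally on the skeleton, exactly Gaussian for every \<open>n\<close>; its covariance is
  an explicit function of the empirical variances and covariance of the skeleton
  (\<open>main_error_law\<close>). Let \<open>x\<close> be a vector of four independent standard normal variables that is
  independent of the paths. Then the leading term together with the skeleton has the law of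
  \<open>noise(empirical moments of the skeleton) x\<close> together with the skeleton, and this pair converges
  almost surely, because the empirical moments converge and Bernstein polynomials recover the path
  from the skeleton. Thus no central limit theorem enters: the convergence in distribution follows
  from an almost sure one by a Slutsky argument (\<open>converges_in_distribution_transfer\<close>).

  For the correlation coefficient the leading term is multiplied by the gradient of \<open>F\<close> at the
  empirical moments, and for the normalised version it is divided by the resulting conditional
  standard deviation as well (\<open>converges_to_transformed_noise\<close> covers the three cases). This needs
  \<open>D f D g > (A f g)\<^sup>2\<close> almost surely: otherwise a nontrivial linear combination of the paths would be
  constant, although its quadratic variation is positive (\<open>AE_nondegenerate\<close>).
\<close>

section \<open>Centred normal laws\<close>

text \<open>
  Reduces moments and characteristic functions of all centred normal laws, the degenerate one
  included, to those of the standard normal law.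
\<close>

lemma normal_law_eq_scaled_std_normal:
  assumes "s \<ge> 0"
  shows "normal_law 0 s = distr std_normal_distribution borel (\<lambda>x. s * x)"
proof (cases "s = 0")
  case True
  interpret prob_space std_normal_distribution
    by (rule prob_space_normal_density) simp
  show ?thesis
    using True by (simp add: normal_law_def distr_const)
next
  case False
  interpret prob_space std_normal_distribution
    by (rule prob_space_normal_density) simp
  have "distributed std_normal_distribution lborel (\<lambda>x. x) std_normal_density"
    unfolding distributed_def by (auto simp: distr_id2)
  then have "distributed std_normal_distribution lborel (\<lambda>x. 0 + s * x) (normal_density (0 + s * 0) (\<bar>s\<bar> * 1))"
    by (rule normal_density_affine) (use False in auto)
  then have "distr std_normal_distribution lborel (\<lambda>x. s * x) = density lborel (normal_density 0 s)"
    using assms by (simp add: distributed_def)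
  moreover have "distr std_normal_distribution lborel (\<lambda>x. s * x) = distr std_normal_distribution borel (\<lambda>x. s * x)"
    by (rule distr_cong) auto
  ultimately show ?thesis
    using False by (simp add: normal_law_def)
qed

lemma prob_space_std_normal: "prob_space std_normal_distribution"
  by (rule prob_space_normal_density) simp

lemma real_distribution_normal_law:
  assumes "s \<ge> 0" shows "real_distribution (normal_law 0 s)"
proof -
  interpret prob_space std_normal_distribution by (rule prob_space_std_normal)
  show ?thesis
    unfolding normal_law_eq_scaled_std_normal[OF assms] by (rule real_distribution_distr) auto
qed

lemma char_normal_law:
  assumes "s \<ge> 0" shows "char (normal_law 0 s) t = exp (- (s * t)\<^sup>2 / 2)"
proof -
  have "char (normal_law 0 s) t = char std_normal_distribution (s * t)"
    unfolding normal_law_eq_scaled_std_normal[OF assms] char_def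
    by (subst integral_distr) (auto simp: mult_ac)
  then show ?thesis
    by (simp add: char_std_normal_distribution)
qed

lemma char_distr:
  assumes "X \<in> borel_measurable M"
  shows "char (distr M borel X) t = (CLINT \<omega>|M. iexp (t * X \<omega>))"
  unfolding char_def by (subst integral_distr) (use assms in auto)

lemma (in prob_space) distr_eq_normal_lawI:
  assumes X: "X \<in> borel_measurable M" and s: "s \<ge> 0"
    and "\<And>t. (CLINT \<omega>|M. iexp (t * X \<omega>)) = exp (- (s * t)\<^sup>2 / 2)"
  shows "distr M borel X = normal_law 0 s"
  by (rule Levy_uniqueness)
     (use assms in \<open>auto simp: real_distribution_normal_law char_distr char_normal_law fun_eq_iff
        intro: real_distribution_distr\<close>)

lemma
  assumes X: "X \<in> borel_measurable M" and s: "s \<ge> 0" and law: "distr M borel X = normal_law 0 s"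
  shows integrable_normal_law_power: "integrable M (\<lambda>\<omega>. X \<omega> ^ k)"
    and normal_law_second_moment: "(\<integral>\<omega>. (X \<omega>)\<^sup>2 \<partial>M) = s\<^sup>2"
    and normal_law_fourth_moment: "(\<integral>\<omega>. X \<omega> ^ 4 \<partial>M) = 3 * s ^ 4"
    and iexp_normal_law: "(CLINT \<omega>|M. iexp (t * X \<omega>)) = exp (- (s * t)\<^sup>2 / 2)"
proof -
  have law': "distr M borel X = distr std_normal_distribution borel (\<lambda>x. s * x)"
    using law normal_law_eq_scaled_std_normal[OF s] by simp
  have "integrable (distr std_normal_distribution borel (\<lambda>x. s * x)) (\<lambda>x. x ^ k)"
    by (subst integrable_distr_eq) (auto simp: power_mult_distrib integrable_std_normal_distribution_moment)
  then show "integrable M (\<lambda>\<omega>. X \<omega> ^ k)"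
    unfolding law'[symmetric] by (subst (asm) integrable_distr_eq) (use X in auto)
  have eq: "(\<integral>\<omega>. X \<omega> ^ k \<partial>M) = s ^ k * (\<integral>x. x ^ k \<partial>std_normal_distribution)" for k
  proof -
    have "(\<integral>\<omega>. X \<omega> ^ k \<partial>M) = (\<integral>x. x ^ k \<partial>distr M borel X)"
      by (subst integral_distr) (use X in auto)
    also have "\<dots> = (\<integral>x. (s * x) ^ k \<partial>std_normal_distribution)"
      unfolding law' by (subst integral_distr) auto
    finally show ?thesis
      by (simp add: power_mult_distrib)
  qed
  show "(\<integral>\<omega>. (X \<omega>)\<^sup>2 \<partial>M) = s\<^sup>2"
    using eq[of 2] std_normal_distribution_even_moments[of 1] by simp
  show "(\<integral>\<omega>. X \<omega> ^ 4 \<partial>M) = 3 * s ^ 4"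
    using eq[of 4] std_normal_distribution_even_moments[of 2] by (simp add: fact_numeral)
  show "(CLINT \<omega>|M. iexp (t * X \<omega>)) = exp (- (s * t)\<^sup>2 / 2)"
    using char_normal_law[OF s, of t] unfolding law[symmetric] by (simp add: char_distr X)
qed

section \<open>Joint laws from characteristic functions\<close>

text \<open>
  Levy's uniqueness theorem for the laws of \<open>X\<close> and \<open>Y\<close> under the measures with densities \<open>v\<close> and \<open>w\<close>,
  both normalised to mass one; their total masses agree by the hypothesis at \<open>t = 0\<close>.
\<close>

lemma weighted_charfun_determines_weighted_law:
  fixes X :: "'a \<Rightarrow> real" and Y :: "'b \<Rightarrow> real" and v :: "'a \<Rightarrow> real" and w :: "'b \<Rightarrow> real"
  assumes M: "prob_space M" and N: "prob_space N"
    and [measurable]: "X \<in> borel_measurable M" "Y \<in> borel_measurable N"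
      "v \<in> borel_measurable M" "w \<in> borel_measurable N" "S \<in> sets borel"
    and v: "\<And>\<omega>. 0 \<le> v \<omega>" "\<And>\<omega>. v \<omega> \<le> C" and w: "\<And>\<omega>. 0 \<le> w \<omega>" "\<And>\<omega>. w \<omega> \<le> C"
    and eq: "\<And>t. (CLINT \<omega>|M. v \<omega> * iexp (t * X \<omega>)) = (CLINT \<omega>|N. w \<omega> * iexp (t * Y \<omega>))"
  shows "(\<integral>\<omega>. v \<omega> * indicator S (X \<omega>) \<partial>M) = (\<integral>\<omega>. w \<omega> * indicator S (Y \<omega>) \<partial>N)"
proof -
  interpret M: prob_space M by fact
  interpret N: prob_space N by fact
  have iv: "integrable M v"
    by (rule M.integrable_const_bound[of _ C]) (use v in auto)
  have iw: "integrable N w"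
    by (rule N.integrable_const_bound[of _ C]) (use w in auto)
  define c where "c = (\<integral>\<omega>. v \<omega> \<partial>M)"
  have "complex_of_real c = complex_of_real (\<integral>\<omega>. w \<omega> \<partial>N)"
    using eq[of 0] by (simp add: c_def)
  then have c': "c = (\<integral>\<omega>. w \<omega> \<partial>N)" by (simp only: of_real_eq_iff)
  have "c \<ge> 0" unfolding c_def by (intro integral_nonneg_AE) (use v in auto)
  show ?thesis
  proof (cases "c = 0")
    case True
    then have "AE \<omega> in M. v \<omega> = 0" "AE \<omega> in N. w \<omega> = 0"
      using integral_nonneg_eq_0_iff_AE[OF iv] integral_nonneg_eq_0_iff_AE[OF iw] v w c' c_def by auto
    then have "AE \<omega> in M. v \<omega> * indicator S (X \<omega>) = 0" "AE \<omega> in N. w \<omega> * indicator S (Y \<omega>) = 0"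
      by auto
    then show ?thesis by (simp add: integral_eq_zero_AE)
  next
    case False
    with \<open>c \<ge> 0\<close> have "c > 0" by simp
    have *: "real_distribution (distr (density K (\<lambda>\<omega>. ennreal (u \<omega> / c))) borel Z)
        \<and> (\<forall>t. char (distr (density K (\<lambda>\<omega>. ennreal (u \<omega> / c))) borel Z) t
              = (CLINT \<omega>|K. u \<omega> * iexp (t * Z \<omega>)) / c)
        \<and> measure (distr (density K (\<lambda>\<omega>. ennreal (u \<omega> / c))) borel Z) S
              = (\<integral>\<omega>. u \<omega> * indicator S (Z \<omega>) \<partial>K) / c"
      if "prob_space K" and [measurable]: "u \<in> borel_measurable K" "Z \<in> borel_measurable K" and "integrable K u"
        and u: "\<And>\<omega>. 0 \<le> u \<omega>" and "c = (\<integral>\<omega>. u \<omega> \<partial>K)" for K :: "'c measure" and u Z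
    proof -
      interpret K: prob_space K by fact
      have "emeasure (density K (\<lambda>\<omega>. ennreal (u \<omega> / c))) (space K) = (\<integral>\<^sup>+\<omega>. ennreal (u \<omega> / c) \<partial>K)"
        by (subst emeasure_density) (auto intro!: nn_integral_cong)
      also have "\<dots> = ennreal (\<integral>\<omega>. u \<omega> / c \<partial>K)"
        by (rule nn_integral_eq_integral) (use that \<open>c > 0\<close> in auto)
      also have "\<dots> = 1" using that \<open>c > 0\<close> by simp
      finally interpret Q: prob_space "density K (\<lambda>\<omega>. ennreal (u \<omega> / c))"
        by (intro prob_spaceI) simp
      interpret R: prob_space "distr (density K (\<lambda>\<omega>. ennreal (u \<omega> / c))) borel Z"
        by (rule Q.prob_space_distr) simp
      have 1: "real_distribution (distr (density K (\<lambda>\<omega>. ennreal (u \<omega> / c))) borel Z)"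
        by (rule Q.real_distribution_distr) simp
      have 2: "char (distr (density K (\<lambda>\<omega>. ennreal (u \<omega> / c))) borel Z) t
              = (CLINT \<omega>|K. u \<omega> * iexp (t * Z \<omega>)) / c" for t
      proof -
        have "char (distr (density K (\<lambda>\<omega>. ennreal (u \<omega> / c))) borel Z) t
          = (CLINT \<omega>|K. (u \<omega> / c) *\<^sub>R iexp (t * Z \<omega>))"
          using u \<open>c > 0\<close> by (subst char_distr) (auto simp: integral_density)
        also have "\<dots> = (CLINT \<omega>|K. (1 / c) *\<^sub>R (u \<omega> * iexp (t * Z \<omega>)))"
          by (simp add: scaleR_conv_of_real)
        finally show ?thesis by (simp add: scaleR_conv_of_real field_simps)
      qed
      have "measure (distr (density K (\<lambda>\<omega>. ennreal (u \<omega> / c))) borel Z) S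
          = (\<integral>x. indicator S x \<partial>distr (density K (\<lambda>\<omega>. ennreal (u \<omega> / c))) borel Z)"
        by simp
      also have "\<dots> = (\<integral>\<omega>. (u \<omega> / c) *\<^sub>R indicator S (Z \<omega>) \<partial>K)"
        using u \<open>c > 0\<close> by (subst integral_distr) (auto simp: integral_density)
      finally have 3: "measure (distr (density K (\<lambda>\<omega>. ennreal (u \<omega> / c))) borel Z) S
              = (\<integral>\<omega>. u \<omega> * indicator S (Z \<omega>) \<partial>K) / c"
        by simp
      show ?thesis using 1 2 3 by blast
    qed
    note a = *[OF M _ _ iv v(1) c_def, of X] and b = *[OF N _ _ iw w(1) c', of Y]
    have "distr (density M (\<lambda>\<omega>. ennreal (v \<omega> / c))) borel X = distr (density N (\<lambda>\<omega>. ennreal (w \<omega> / c))) borel Y"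
      by (rule Levy_uniqueness) (use a b eq in \<open>auto simp: fun_eq_iff\<close>)
    then show ?thesis using a b \<open>c > 0\<close> by auto
  qed
qed

text \<open>
  Nonnegative weights \<open>1 + cos\<close> are combinations of exponentials; this is what makes identities between
  characteristic functions usable as identities between weighted measures.
\<close>

lemma cos_times_iexp:
  fixes x y \<theta> :: real
  shows "complex_of_real (1 + cos (\<theta> + x)) * iexp y
     = iexp y + iexp \<theta> / 2 * iexp (x + y) + iexp (-\<theta>) / 2 * iexp (- x + y)"
proof -
  have 1: "complex_of_real (cos (\<theta> + x)) = (iexp \<theta> * iexp x + iexp (-\<theta>) * iexp (-x)) / 2"
    by (simp add: cos_exp_eq cos_of_real[symmetric] distrib_left distrib_right exp_add[symmetric] del: cos_of_real)
  have 2: "iexp (x + y) = iexp x * iexp y" "iexp (- x + y) = iexp (- x) * iexp y"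
    by (simp_all add: exp_add[symmetric] algebra_simps)
  show ?thesis
    unfolding 2 of_real_add[of 1] of_real_1 1 by (simp add: algebra_simps add_divide_distrib)
qed

text \<open>
  Coordinates are turned from exponentials into indicators one at a time. When coordinate \<open>i\<close> is
  treated, the indicators obtained so far and the exponential in the remaining coordinates act as a
  weight to which the one-dimensional uniqueness theorem applies. Weights have to be nonnegative, so
  the exponential is replaced by \<open>1 + cos(\<theta> + _)\<close> and recovered from \<open>\<theta> = 0\<close> and \<open>\<theta> = -\<pi>/2\<close>. Once all
  coordinates are treated, the laws agree on cylinder sets.
\<close>

theorem charfun_determines_law:
  fixes X :: "'a \<Rightarrow> 'i::countable \<Rightarrow> real" and Y :: "'b \<Rightarrow> 'i \<Rightarrow> real"
  assumes M: "prob_space M" and N: "prob_space N"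
    and X: "\<And>i. (\<lambda>\<omega>. X \<omega> i) \<in> borel_measurable M" and Y: "\<And>i. (\<lambda>\<omega>. Y \<omega> i) \<in> borel_measurable N"
    and eq: "\<And>J u. finite J \<Longrightarrow>
      (CLINT \<omega>|M. iexp (\<Sum>j\<in>J. u j * X \<omega> j)) = (CLINT \<omega>|N. iexp (\<Sum>j\<in>J. u j * Y \<omega> j))"
  shows "distr M borel X = distr N borel Y"
proof -
  interpret M: prob_space M by fact
  interpret N: prob_space N by fact
  note X[measurable] Y[measurable]
  have cyl: "(CLINT \<omega>|M. (\<Prod>j\<in>J. indicat_real (S j) (X \<omega> j)) * iexp (\<Sum>k\<in>K. u k * X \<omega> k))
      = (CLINT \<omega>|N. (\<Prod>j\<in>J. indicat_real (S j) (Y \<omega> j)) * iexp (\<Sum>k\<in>K. u k * Y \<omega> k))"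
    if "finite J" "finite K" and S: "\<And>j. S j \<in> sets borel" for J K u and S :: "'i \<Rightarrow> real set"
    using that(1,2)
  proof (induction J arbitrary: K u)
    case empty
    then show ?case using eq[of K u] by simp
  next
    case (insert i J)
    note S[measurable]
    define P where "P Z = (\<Prod>j\<in>J. indicat_real (S j) (Z j))" for Z
    define T where "T Z = (\<Sum>k\<in>K. u k * Z k)" for Z :: "'i \<Rightarrow> real"
    have [measurable]: "(\<lambda>\<omega>. P (X \<omega>)) \<in> borel_measurable M" "(\<lambda>\<omega>. P (Y \<omega>)) \<in> borel_measurable N"
       "(\<lambda>\<omega>. T (X \<omega>)) \<in> borel_measurable M" "(\<lambda>\<omega>. T (Y \<omega>)) \<in> borel_measurable N"
      unfolding P_def T_def by measurable
    have P: "0 \<le> P Z" "P Z \<le> 1" for Z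
      unfolding P_def by (auto intro!: prod_nonneg prod_le_1)
    have P': "\<bar>P Z\<bar> \<le> 1" for Z using P[of Z] by simp
    \<comment> \<open>the induction hypothesis, for a combination involving also the coordinate \<open>i\<close>\<close>
    have IH: "(CLINT \<omega>|M. P (X \<omega>) * iexp (b * T (X \<omega>) + t * X \<omega> i))
            = (CLINT \<omega>|N. P (Y \<omega>) * iexp (b * T (Y \<omega>) + t * Y \<omega> i))" for b t
    proof -
      have eqn: "b * T Z + t * Z i = (\<Sum>k\<in>insert i K. ((if k \<in> K then b * u k else 0) + (if k = i then t else 0)) * Z k)" for Z
      proof -
        have "(\<Sum>k\<in>insert i K. (if k \<in> K then b * u k else 0) * Z k) = b * T Z"
          unfolding T_def sum_distrib_left
          by (rule sum.mono_neutral_cong_right) (use \<open>finite K\<close> in auto)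
        moreover have "(\<Sum>k\<in>insert i K. (if k = i then t else 0) * Z k) = (\<Sum>k\<in>{i}. t * Z k)"
          by (rule sum.mono_neutral_cong_right) (use \<open>finite K\<close> in auto)
        ultimately show ?thesis by (simp add: distrib_right sum.distrib)
      qed
      have "finite (insert i K)" using insert.prems by simp
      from insert.IH[OF this, of "\<lambda>k. (if k \<in> K then b * u k else 0) + (if k = i then t else 0)"]
      show ?thesis
        unfolding P_def eqn .
    qed
    have cos0: "0 \<le> 1 + cos z" and cos2: "1 + cos z \<le> 2" for z :: real
      using cos_ge_minus_one[of z] cos_le_one[of z] by linarith+
    \<comment> \<open>the weights \<open>1 + cos\<close> are nonnegative, and they are combinations of exponentials\<close>
    have W: "(\<integral>\<omega>. P (X \<omega>) * (1 + cos (\<theta> + b * T (X \<omega>))) * indicator (S i) (X \<omega> i) \<partial>M)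
           = (\<integral>\<omega>. P (Y \<omega>) * (1 + cos (\<theta> + b * T (Y \<omega>))) * indicator (S i) (Y \<omega> i) \<partial>N)" for \<theta> b
    proof (rule weighted_charfun_determines_weighted_law[OF M N, where C = 2])
      show "(CLINT \<omega>|M. complex_of_real (P (X \<omega>) * (1 + cos (\<theta> + b * T (X \<omega>)))) * iexp (t * X \<omega> i))
          = (CLINT \<omega>|N. complex_of_real (P (Y \<omega>) * (1 + cos (\<theta> + b * T (Y \<omega>)))) * iexp (t * Y \<omega> i))" for t
      proof -
        have *: "complex_of_real (P Z * (1 + cos (\<theta> + b * T Z))) * iexp (t * Z i) =
            P Z * iexp (0 * T Z + t * Z i) + iexp \<theta> / 2 * (P Z * iexp (b * T Z + t * Z i))
             + iexp (-\<theta>) / 2 * (P Z * iexp ((-b) * T Z + t * Z i))" for Z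
          using arg_cong[OF cos_times_iexp[of \<theta> "b * T Z" "t * Z i"], of "\<lambda>z. complex_of_real (P Z) * z"]
          by (simp add: algebra_simps)
        have iM: "integrable M (\<lambda>\<omega>. P (X \<omega>) * iexp (b * T (X \<omega>) + t * X \<omega> i))" for b
          by (rule M.integrable_const_bound[of _ 1]) (use P' in \<open>auto simp: norm_mult simp del: of_real_add of_real_mult\<close>)
        have iN: "integrable N (\<lambda>\<omega>. P (Y \<omega>) * iexp (b * T (Y \<omega>) + t * Y \<omega> i))" for b
          by (rule N.integrable_const_bound[of _ 1]) (use P' in \<open>auto simp: norm_mult simp del: of_real_add of_real_mult\<close>)
        show ?thesis
          unfolding * using iM[of 0] iM[of b] iM[of "-b"] iN[of 0] iN[of b] iN[of "-b"] IH[of 0 t] IH[of b t] IH[of "-b" t]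
          by (simp del: of_real_add of_real_mult of_real_minus mult_zero_left add_0 mult_minus_left)
      qed
      show "0 \<le> P (X \<omega>) * (1 + cos (\<theta> + b * T (X \<omega>)))" "0 \<le> P (Y \<omega>') * (1 + cos (\<theta> + b * T (Y \<omega>')))" for \<omega> \<omega>'
        using P cos0 by (auto intro!: mult_nonneg_nonneg)
      show "P (X \<omega>) * (1 + cos (\<theta> + b * T (X \<omega>))) \<le> 2" "P (Y \<omega>') * (1 + cos (\<theta> + b * T (Y \<omega>'))) \<le> 2" for \<omega> \<omega>'
        using P cos0 cos2 mult_mono[of "P (X \<omega>)" 1 "1 + cos (\<theta> + b * T (X \<omega>))" 2]
          mult_mono[of "P (Y \<omega>')" 1 "1 + cos (\<theta> + b * T (Y \<omega>'))" 2]
        by auto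
    qed measurable
    have intM: "integrable M (\<lambda>\<omega>. P (X \<omega>) * cos (\<theta> + b * T (X \<omega>)) * indicator (S i) (X \<omega> i))"
         "integrable M (\<lambda>\<omega>. P (X \<omega>) * indicator (S i) (X \<omega> i))" for \<theta> b
      using P' by (auto intro!: M.integrable_const_bound[of _ 1] AE_I2 mult_le_one simp: abs_mult)
    have intN: "integrable N (\<lambda>\<omega>. P (Y \<omega>) * cos (\<theta> + b * T (Y \<omega>)) * indicator (S i) (Y \<omega> i))"
         "integrable N (\<lambda>\<omega>. P (Y \<omega>) * indicator (S i) (Y \<omega> i))" for \<theta> b
      using P' by (auto intro!: N.integrable_const_bound[of _ 1] AE_I2 mult_le_one simp: abs_mult)
    \<comment> \<open>the choice \<open>\<theta> = b = 0\<close> makes the weight constant\<close>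
    have base: "(\<integral>\<omega>. P (X \<omega>) * indicator (S i) (X \<omega> i) \<partial>M) = (\<integral>\<omega>. P (Y \<omega>) * indicator (S i) (Y \<omega> i) \<partial>N)"
      using W[of 0 0] by (simp add: mult.commute[of _ 2] mult.assoc)
    have cosW: "(\<integral>\<omega>. P (X \<omega>) * cos (\<theta> + T (X \<omega>)) * indicator (S i) (X \<omega> i) \<partial>M)
           = (\<integral>\<omega>. P (Y \<omega>) * cos (\<theta> + T (Y \<omega>)) * indicator (S i) (Y \<omega> i) \<partial>N)" for \<theta>
      using W[of \<theta> 1] base intM(1)[of \<theta> 1] intM(2) intN(1)[of \<theta> 1] intN(2)
      by (simp add: distrib_left distrib_right)
    have split: "(\<Prod>j\<in>insert i J. indicat_real (S j) (Z j)) * iexp (T Z)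
      = complex_of_real (P Z * cos (0 + T Z) * indicator (S i) (Z i))
       + \<i> * complex_of_real (P Z * cos (- pi / 2 + T Z) * indicator (S i) (Z i))" for Z
    proof -
      have "cos (- pi / 2 + T Z) = sin (T Z)" using cos_diff[of "T Z" "pi / 2"] by simp
      then show ?thesis
        using insert.hyps by (simp add: P_def exp_Euler algebra_simps cos_of_real sin_of_real)
    qed
    have fin: "(CLINT \<omega>|K. complex_of_real (f \<omega>) + \<i> * complex_of_real (g \<omega>))
        = complex_of_real (\<integral>\<omega>. f \<omega> \<partial>K) + \<i> * complex_of_real (\<integral>\<omega>. g \<omega> \<partial>K)"
      if "integrable K f" "integrable K g" for K :: "'c measure" and f g
      using that by simp
    show ?case
      unfolding T_def[symmetric] split
      using intM(1)[of 0 1] intM(1)[of "- pi / 2" 1] intN(1)[of 0 1] intN(1)[of "- pi / 2" 1]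
        cosW[of 0] cosW[of "- pi / 2"]
      by (simp add: fin del: of_real_mult add_0 add_0_left)
  qed
  have [measurable]: "X \<in> borel_measurable M" "Y \<in> borel_measurable N"
    by (auto intro!: measurable_coordinatewise_then_product)
  interpret MX: prob_space "distr M borel X" by (rule M.prob_space_distr) simp
  interpret NY: prob_space "distr N borel Y" by (rule N.prob_space_distr) simp
  show ?thesis
  proof (rule measure_eqI_PiM_infinite[where I = UNIV and M = "\<lambda>_. borel"])
    show "finite_measure (distr M borel X)" by unfold_locales
    show "sets (distr M borel X) = sets (PiM UNIV (\<lambda>_. borel))" "sets (distr N borel Y) = sets (PiM UNIV (\<lambda>_. borel))"
      by (simp_all add: sets_PiM_equal_borel)
    fix S :: "'i \<Rightarrow> real set" and J :: "'i set"
    assume J: "finite J" "J \<subseteq> UNIV" and S: "\<And>i. i \<in> J \<Longrightarrow> S i \<in> sets borel"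
    define S' where "S' i = (if i \<in> J then S i else UNIV)" for i
    have S': "S' i \<in> sets borel" for i using S by (simp add: S'_def)
    note S'[measurable]
    define Q where "Q = prod_emb UNIV (\<lambda>_. borel) J (Pi\<^sub>E J S)"
    have Q: "Q = {Z. \<forall>j\<in>J. Z j \<in> S j}"
      unfolding Q_def prod_emb_def by (auto simp: PiE_def restrict_def Pi_def extensional_def)
    have "Q \<in> sets (PiM UNIV (\<lambda>_. borel))"
      unfolding Q_def using J S by (intro sets_PiM_I) auto
    then have [measurable]: "Q \<in> sets borel" by (simp add: sets_PiM_equal_borel)
    have ind: "indicat_real Q Z = (\<Prod>j\<in>J. indicat_real (S' j) (Z j))" for Z
      using J by (auto simp: Q S'_def indicator_def)
    have "complex_of_real (measure (distr M borel X) Q) = complex_of_real (\<integral>\<omega>. indicat_real Q (X \<omega>) \<partial>M)"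
      by (subst integral_distr[symmetric, of X M borel]) auto
    also have "\<dots> = complex_of_real (\<integral>\<omega>. indicat_real Q (Y \<omega>) \<partial>N)"
      unfolding ind using cyl[OF J(1) finite.emptyI S', of "\<lambda>i. i"] by (simp del: of_real_prod)
    also have "\<dots> = complex_of_real (measure (distr N borel Y) Q)"
      by (subst integral_distr[symmetric, of Y N borel]) auto
    finally show "emeasure (distr M borel X) (prod_emb UNIV (\<lambda>_. borel) J (Pi\<^sub>E J S)) = emeasure (distr N borel Y) (prod_emb UNIV (\<lambda>_. borel) J (Pi\<^sub>E J S))"
      unfolding Q_def[symmetric] by (simp add: MX.emeasure_eq_measure NY.emeasure_eq_measure)
  qed
qed

corollary charfun_determines_law_vec:
  fixes X :: "'a \<Rightarrow> real^'n" and Y :: "'b \<Rightarrow> real^'n"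
  assumes "prob_space M" "prob_space N"
    and X: "X \<in> borel_measurable M" and Y: "Y \<in> borel_measurable N"
    and eq: "\<And>u. (CLINT \<omega>|M. iexp (u \<bullet> X \<omega>)) = (CLINT \<omega>|N. iexp (u \<bullet> Y \<omega>))"
  shows "distr M borel X = distr N borel Y"
proof -
  have [measurable]: "(\<lambda>v. v $ i) \<in> borel_measurable borel" for i :: 'n
    by (intro borel_measurable_continuous_onI continuous_intros)
  note X[measurable] Y[measurable]
  have *: "distr M borel (\<lambda>\<omega>. ($) (X \<omega>)) = distr N borel (\<lambda>\<omega>. ($) (Y \<omega>))"
  proof (rule charfun_determines_law[OF assms(1,2)])
    show "(CLINT \<omega>|M. iexp (\<Sum>j\<in>J. u j * X \<omega> $ j)) = (CLINT \<omega>|N. iexp (\<Sum>j\<in>J. u j * Y \<omega> $ j))" for J u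
    proof -
      have "(\<Sum>j\<in>J. u j * v $ j) = (\<chi> i. if i \<in> J then u i else 0) \<bullet> v" for v
        by (simp add: inner_vec_def if_distrib[of "\<lambda>x. x * _"] sum.If_cases)
      then show ?thesis using eq by simp
    qed
  qed measurable
  have [measurable]: "(\<lambda>f. \<chi> i. f i) \<in> measurable (borel :: ('n \<Rightarrow> real) measure) borel"
    by (intro borel_measurable_continuous_onI continuous_intros continuous_on_product_coordinates)
  have [measurable]: "(\<lambda>\<omega>. ($) (X \<omega>)) \<in> borel_measurable M" "(\<lambda>\<omega>. ($) (Y \<omega>)) \<in> borel_measurable N"
    by (auto intro!: measurable_coordinatewise_then_product)
  have "distr (distr M borel (\<lambda>\<omega>. ($) (X \<omega>))) borel (\<lambda>f. \<chi> i. f i)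
      = distr (distr N borel (\<lambda>\<omega>. ($) (Y \<omega>))) borel (\<lambda>f. \<chi> i. f i)"
    by (simp only: *)
  then show ?thesis
    by (simp add: distr_distr comp_def)
qed

section \<open>Gaussian spaces and quadratic variation\<close>

text \<open>
  A linear space of random variables, each of them centred normal, such as the span of a centred
  Gaussian process. Closure under linear combinations makes every finite family of members jointly
  Gaussian.
\<close>

locale gaussian_space = prob_space M for M :: "'a measure" +
  fixes H :: "('a \<Rightarrow> real) set"
  assumes zero_mem: "(\<lambda>_. 0) \<in> H"
    and lin_mem: "X \<in> H \<Longrightarrow> Y \<in> H \<Longrightarrow> (\<lambda>\<omega>. a * X \<omega> + b * Y \<omega>) \<in> H"
    and measurable_mem: "X \<in> H \<Longrightarrow> X \<in> borel_measurable M"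
    and normal_mem: "X \<in> H \<Longrightarrow> \<exists>s\<ge>0. distr M borel X = normal_law 0 s"
begin

lemma add_mem: "X \<in> H \<Longrightarrow> Y \<in> H \<Longrightarrow> (\<lambda>\<omega>. X \<omega> + Y \<omega>) \<in> H"
  using lin_mem[of X Y 1 1] by simp

lemma diff_mem: "X \<in> H \<Longrightarrow> Y \<in> H \<Longrightarrow> (\<lambda>\<omega>. X \<omega> - Y \<omega>) \<in> H"
  using lin_mem[of X Y 1 "-1"] by simp

lemma sum_mem:
  assumes "\<And>i. i \<in> I \<Longrightarrow> X i \<in> H"
  shows "(\<lambda>\<omega>. \<Sum>i\<in>I. a i * X i \<omega>) \<in> H"
  using assms
proof (induction I rule: infinite_finite_induct)
  case (insert i I)
  then show ?case using lin_mem[of "X i" "\<lambda>\<omega>. \<Sum>i\<in>I. a i * X i \<omega>" "a i" 1] by simp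
qed (simp_all add: zero_mem)

lemma integrable_power_mem: "X \<in> H \<Longrightarrow> integrable M (\<lambda>\<omega>. X \<omega> ^ k)"
  using normal_mem[of X] integrable_normal_law_power[OF measurable_mem] by blast

lemma integrable_mult_mem:
  assumes "X \<in> H" "Y \<in> H"
  shows "integrable M (\<lambda>\<omega>. X \<omega> * Y \<omega>)"
proof -
  have "integrable M (\<lambda>\<omega>. ((X \<omega> + Y \<omega>)\<^sup>2 - (X \<omega> - Y \<omega>)\<^sup>2) / 4)"
    using integrable_power_mem[OF add_mem[OF assms], of 2] integrable_power_mem[OF diff_mem[OF assms], of 2]
    by (auto intro!: Bochner_Integration.integrable_diff)
  then show ?thesis by (simp add: power2_eq_square algebra_simps)
qed

lemma fourth_moment_mem:
  assumes "X \<in> H" shows "(\<integral>\<omega>. X \<omega> ^ 4 \<partial>M) = 3 * (\<integral>\<omega>. (X \<omega>)\<^sup>2 \<partial>M)\<^sup>2"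
proof -
  obtain s where "s \<ge> 0" "distr M borel X = normal_law 0 s" using normal_mem[OF assms] by blast
  note n = normal_law_second_moment[OF measurable_mem[OF assms] this] normal_law_fourth_moment[OF measurable_mem[OF assms] this]
  show ?thesis unfolding n by (simp flip: power_mult)
qed

lemma expectation_iexp_mem:
  assumes "X \<in> H" shows "(CLINT \<omega>|M. iexp (X \<omega>)) = exp (- (\<integral>\<omega>. (X \<omega>)\<^sup>2 \<partial>M) / 2)"
proof -
  obtain s where "s \<ge> 0" "distr M borel X = normal_law 0 s" using normal_mem[OF assms] by blast
  note n = normal_law_second_moment[OF measurable_mem[OF assms] this] iexp_normal_law[OF measurable_mem[OF assms] this]
  show ?thesis unfolding n(1) using n(2)[of 1] by simp
qed

lemma expectation_square_lin:
  assumes "X \<in> H" "Y \<in> H"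
  shows "(\<integral>\<omega>. (a * X \<omega> + b * Y \<omega>)\<^sup>2 \<partial>M)
    = a\<^sup>2 * (\<integral>\<omega>. (X \<omega>)\<^sup>2 \<partial>M) + 2 * a * b * (\<integral>\<omega>. X \<omega> * Y \<omega> \<partial>M) + b\<^sup>2 * (\<integral>\<omega>. (Y \<omega>)\<^sup>2 \<partial>M)"
proof -
  have "(a * X \<omega> + b * Y \<omega>)\<^sup>2 = a\<^sup>2 * (X \<omega>)\<^sup>2 + 2 * a * b * (X \<omega> * Y \<omega>) + b\<^sup>2 * (Y \<omega>)\<^sup>2" for \<omega>
    by (simp add: power2_eq_square algebra_simps)
  then show ?thesis
    using integrable_mult_mem[OF assms] integrable_power_mem[OF assms(1), of 2] integrable_power_mem[OF assms(2), of 2]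
    by simp
qed

text \<open>
  A special case of Isserlis' formula. By polarisation \<open>12 X\<^sup>2 Y\<^sup>2\<close> is a combination of fourth powers of
  members of the space, and a fourth moment is three times the squared variance.
\<close>

lemma uncorrelated_squares:
  assumes "X \<in> H" "Y \<in> H" and unc: "(\<integral>\<omega>. X \<omega> * Y \<omega> \<partial>M) = 0"
  shows "integrable M (\<lambda>\<omega>. (X \<omega>)\<^sup>2 * (Y \<omega>)\<^sup>2)"
    and "(\<integral>\<omega>. (X \<omega>)\<^sup>2 * (Y \<omega>)\<^sup>2 \<partial>M) = (\<integral>\<omega>. (X \<omega>)\<^sup>2 \<partial>M) * (\<integral>\<omega>. (Y \<omega>)\<^sup>2 \<partial>M)"
proof -
  have eq: "(X \<omega>)\<^sup>2 * (Y \<omega>)\<^sup>2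
     = ((X \<omega> + Y \<omega>) ^ 4 + (X \<omega> - Y \<omega>) ^ 4 - 2 * X \<omega> ^ 4 - 2 * Y \<omega> ^ 4) / 12" for \<omega>
    by (simp add: power2_eq_square power4_eq_xxxx algebra_simps)
  note mem = add_mem[OF assms(1,2)] diff_mem[OF assms(1,2)] assms(1,2)
  note int = mem[THEN integrable_power_mem, of 4]
  show "integrable M (\<lambda>\<omega>. (X \<omega>)\<^sup>2 * (Y \<omega>)\<^sup>2)"
    unfolding eq using int by (auto intro!: Bochner_Integration.integrable_diff)
  have s: "(\<integral>\<omega>. (X \<omega> + Y \<omega>)\<^sup>2 \<partial>M) = (\<integral>\<omega>. (X \<omega>)\<^sup>2 \<partial>M) + (\<integral>\<omega>. (Y \<omega>)\<^sup>2 \<partial>M)"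
     "(\<integral>\<omega>. (X \<omega> - Y \<omega>)\<^sup>2 \<partial>M) = (\<integral>\<omega>. (X \<omega>)\<^sup>2 \<partial>M) + (\<integral>\<omega>. (Y \<omega>)\<^sup>2 \<partial>M)"
    using expectation_square_lin[OF assms(1,2), of 1 1] expectation_square_lin[OF assms(1,2), of 1 "-1"] unc by auto
  show "(\<integral>\<omega>. (X \<omega>)\<^sup>2 * (Y \<omega>)\<^sup>2 \<partial>M) = (\<integral>\<omega>. (X \<omega>)\<^sup>2 \<partial>M) * (\<integral>\<omega>. (Y \<omega>)\<^sup>2 \<partial>M)"
    unfolding eq using int mem[THEN fourth_moment_mem]
    by (simp add: s) (simp add: power2_eq_square algebra_simps)
qed

lemma expectation_square_sum:
  assumes "finite I" "\<And>i. i \<in> I \<Longrightarrow> X i \<in> H"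
    and "\<And>i j. i \<in> I \<Longrightarrow> j \<in> I \<Longrightarrow> i \<noteq> j \<Longrightarrow> (\<integral>\<omega>. X i \<omega> * X j \<omega> \<partial>M) = 0"
  shows "(\<integral>\<omega>. (\<Sum>i\<in>I. X i \<omega>)\<^sup>2 \<partial>M) = (\<Sum>i\<in>I. \<integral>\<omega>. (X i \<omega>)\<^sup>2 \<partial>M)"
proof -
  have "(\<integral>\<omega>. (\<Sum>i\<in>I. X i \<omega>)\<^sup>2 \<partial>M) = (\<integral>\<omega>. (\<Sum>i\<in>I. \<Sum>j\<in>I. X i \<omega> * X j \<omega>) \<partial>M)"
    by (simp add: power2_eq_square sum_product)
  also have "\<dots> = (\<Sum>i\<in>I. \<Sum>j\<in>I. \<integral>\<omega>. X i \<omega> * X j \<omega> \<partial>M)"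
    using assms integrable_mult_mem by (simp add: Bochner_Integration.integrable_sum)
  also have "\<dots> = (\<Sum>i\<in>I. \<Sum>j\<in>I. if j = i then \<integral>\<omega>. (X i \<omega>)\<^sup>2 \<partial>M else 0)"
    using assms by (intro sum.cong) (auto simp: power2_eq_square)
  finally show ?thesis using assms(1) by simp
qed

text \<open>
  Uncorrelated members have uncorrelated squares, each of variance \<open>2 v\<^sup>2\<close>; the mean deviation is at
  most the standard deviation.
\<close>

lemma sum_of_squares_concentration:
  fixes n :: nat and v :: real
  assumes X: "\<And>i. i < n \<Longrightarrow> X i \<in> H"
    and unc: "\<And>i j. i < j \<Longrightarrow> j < n \<Longrightarrow> (\<integral>\<omega>. X i \<omega> * X j \<omega> \<partial>M) = 0"
    and v: "\<And>i. i < n \<Longrightarrow> (\<integral>\<omega>. (X i \<omega>)\<^sup>2 \<partial>M) = v" and v0: "v \<ge> 0"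
  shows "integrable M (\<lambda>\<omega>. \<bar>(\<Sum>i<n. (X i \<omega>)\<^sup>2) - n * v\<bar>)"
    and "(\<integral>\<omega>. \<bar>(\<Sum>i<n. (X i \<omega>)\<^sup>2) - n * v\<bar> \<partial>M) \<le> sqrt (2 * n) * v"
proof -
  have unc': "(\<integral>\<omega>. X i \<omega> * X j \<omega> \<partial>M) = 0" if "i \<noteq> j" "i < n" "j < n" for i j
    using that unc[of i j] unc[of j i] by (cases i j rule: linorder_cases) (auto simp: mult.commute)
  \<comment> \<open>the squares are uncorrelated, so \<open>Y\<close> has second moment \<open>2 n v\<^sup>2\<close>\<close>
  define Y where "Y \<omega> = (\<Sum>i<n. (X i \<omega>)\<^sup>2) - n * v" for \<omega>
  have Y: "Y \<omega> = (\<Sum>i<n. (X i \<omega>)\<^sup>2 - v)" for \<omega> by (simp add: Y_def sum_subtractf)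
  have i2: "integrable M (\<lambda>\<omega>. (X i \<omega>)\<^sup>2)" if "i < n" for i
    using integrable_power_mem X that by blast
  have prod_int: "integrable M (\<lambda>\<omega>. (X i \<omega>)\<^sup>2 * (X j \<omega>)\<^sup>2)"
    and prod_val: "(\<integral>\<omega>. (X i \<omega>)\<^sup>2 * (X j \<omega>)\<^sup>2 \<partial>M) = (if i = j then 3 * v\<^sup>2 else v\<^sup>2)" if "i < n" "j < n" for i j
  proof -
    have a: "integrable M (\<lambda>\<omega>. (X i \<omega>)\<^sup>2 * (X j \<omega>)\<^sup>2) \<and> (\<integral>\<omega>. (X i \<omega>)\<^sup>2 * (X j \<omega>)\<^sup>2 \<partial>M) = (if i = j then 3 * v\<^sup>2 else v\<^sup>2)"
    proof (cases "i = j")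
      case True
      have "(X j \<omega>)\<^sup>2 * (X j \<omega>)\<^sup>2 = X j \<omega> ^ 4" for \<omega> by (simp add: power2_eq_square power4_eq_xxxx)
      then show ?thesis using True that integrable_power_mem[OF X[of j]] fourth_moment_mem[OF X[of j]] v[of j] by simp
    next
      case False
      then show ?thesis using uncorrelated_squares[OF X X unc', of i j] that v by (simp add: power2_eq_square)
    qed
    show "integrable M (\<lambda>\<omega>. (X i \<omega>)\<^sup>2 * (X j \<omega>)\<^sup>2)"
      "(\<integral>\<omega>. (X i \<omega>)\<^sup>2 * (X j \<omega>)\<^sup>2 \<partial>M) = (if i = j then 3 * v\<^sup>2 else v\<^sup>2)" using a by auto
  qed
  have exp: "((X i \<omega>)\<^sup>2 - v) * ((X j \<omega>)\<^sup>2 - v) = (X i \<omega>)\<^sup>2 * (X j \<omega>)\<^sup>2 - v * (X i \<omega>)\<^sup>2 - v * (X j \<omega>)\<^sup>2 + v\<^sup>2" for i j \<omega>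
    by (simp add: power2_eq_square algebra_simps)
  have ci: "integrable M (\<lambda>\<omega>. ((X i \<omega>)\<^sup>2 - v) * ((X j \<omega>)\<^sup>2 - v))" if "i < n" "j < n" for i j
    unfolding exp using prod_int i2 that by auto
  have cv: "(\<integral>\<omega>. ((X i \<omega>)\<^sup>2 - v) * ((X j \<omega>)\<^sup>2 - v) \<partial>M) = (if i = j then 2 * v\<^sup>2 else 0)" if "i < n" "j < n" for i j
    unfolding exp using prod_int prod_val i2 that v by (simp add: prob_space power2_eq_square)
  have Y2: "(Y \<omega>)\<^sup>2 = (\<Sum>i<n. \<Sum>j<n. ((X i \<omega>)\<^sup>2 - v) * ((X j \<omega>)\<^sup>2 - v))" for \<omega>
    unfolding Y power2_eq_square[of "\<Sum>i<n. _ i"] by (simp add: sum_product)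
  have iY: "integrable M Y" unfolding Y using i2 by auto
  have iY2: "integrable M (\<lambda>\<omega>. (Y \<omega>)\<^sup>2)" unfolding Y2 using ci by (intro Bochner_Integration.integrable_sum) auto
  have EY2: "(\<integral>\<omega>. (Y \<omega>)\<^sup>2 \<partial>M) = 2 * n * v\<^sup>2"
  proof -
    have "(\<integral>\<omega>. (Y \<omega>)\<^sup>2 \<partial>M) = (\<Sum>i<n. \<integral>\<omega>. (\<Sum>j<n. ((X i \<omega>)\<^sup>2 - v) * ((X j \<omega>)\<^sup>2 - v)) \<partial>M)"
      unfolding Y2 by (rule Bochner_Integration.integral_sum) (use ci in \<open>auto intro!: Bochner_Integration.integrable_sum\<close>)
    also have "\<dots> = (\<Sum>i<n. \<Sum>j<n. \<integral>\<omega>. ((X i \<omega>)\<^sup>2 - v) * ((X j \<omega>)\<^sup>2 - v) \<partial>M)"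
      by (intro sum.cong refl Bochner_Integration.integral_sum) (use ci in auto)
    also have "\<dots> = (\<Sum>i<n. \<Sum>j<n. if i = j then 2 * v\<^sup>2 else 0)"
      by (intro sum.cong refl cv) auto
    finally show ?thesis by simp
  qed
  have "0 \<le> (\<integral>\<omega>. (\<bar>Y \<omega>\<bar> - expectation (\<lambda>\<omega>. \<bar>Y \<omega>\<bar>))\<^sup>2 \<partial>M)" by simp
  also have "\<dots> = expectation (\<lambda>\<omega>. \<bar>Y \<omega>\<bar>\<^sup>2) - (expectation (\<lambda>\<omega>. \<bar>Y \<omega>\<bar>))\<^sup>2"
    by (rule variance_eq) (use iY iY2 in auto)
  finally have "(expectation (\<lambda>\<omega>. \<bar>Y \<omega>\<bar>))\<^sup>2 \<le> (sqrt (2 * n) * v)\<^sup>2"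
    using EY2 by (simp add: power_mult_distrib)
  then have "expectation (\<lambda>\<omega>. \<bar>Y \<omega>\<bar>) \<le> sqrt (2 * n) * v"
    by (rule power2_le_imp_le) (use v0 in auto)
  then show "(\<integral>\<omega>. \<bar>(\<Sum>i<n. (X i \<omega>)\<^sup>2) - n * v\<bar> \<partial>M) \<le> sqrt (2 * n) * v"
    by (simp add: Y_def)
  show "integrable M (\<lambda>\<omega>. \<bar>(\<Sum>i<n. (X i \<omega>)\<^sup>2) - n * v\<bar>)"
    using integrable_abs[OF iY] by (simp add: Y_def)
qed

text \<open>
  Brownian motion with variance \<open>c\<close> per unit time. Inside a Gaussian space the covariance alone
  determines the law.
\<close>

definition brownian_in :: "real \<Rightarrow> ('a \<Rightarrow> real \<Rightarrow> real) \<Rightarrow> bool"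
  where "brownian_in c X \<longleftrightarrow> (\<forall>t\<in>{0..1}. (\<lambda>\<omega>. X \<omega> t) \<in> H) \<and>
    (\<forall>s\<in>{0..1}. \<forall>t\<in>{0..1}. (\<integral>\<omega>. X \<omega> s * X \<omega> t \<partial>M) = c * min s t)"

lemma expectation_diff_mult_diff:
  assumes "P \<in> H" "Q \<in> H" "R \<in> H" "S \<in> H"
  shows "(\<integral>\<omega>. (P \<omega> - Q \<omega>) * (R \<omega> - S \<omega>) \<partial>M)
    = (\<integral>\<omega>. P \<omega> * R \<omega> \<partial>M) - (\<integral>\<omega>. P \<omega> * S \<omega> \<partial>M) - (\<integral>\<omega>. Q \<omega> * R \<omega> \<partial>M) + (\<integral>\<omega>. Q \<omega> * S \<omega> \<partial>M)"
proof -
  have "(P \<omega> - Q \<omega>) * (R \<omega> - S \<omega>) = P \<omega> * R \<omega> - P \<omega> * S \<omega> - Q \<omega> * R \<omega> + Q \<omega> * S \<omega>" for \<omega>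
    by (simp add: algebra_simps)
  then show ?thesis using assms integrable_mult_mem by simp
qed

text \<open>
  The bound is uniform in \<open>u\<close>, which later allows averaging over \<open>u\<close>.
\<close>

lemma brownian_quadratic_variation:
  fixes n :: nat and u :: real
  assumes X: "brownian_in c X" and n: "n \<ge> 1" and u: "0 \<le> u" "u \<le> 1"
  shows "integrable M (\<lambda>\<omega>. \<bar>(\<Sum>k<n. (X \<omega> ((k + u) / n) - X \<omega> (k / n))\<^sup>2) - c * u\<bar>)"
    and "(\<integral>\<omega>. \<bar>(\<Sum>k<n. (X \<omega> ((k + u) / n) - X \<omega> (k / n))\<^sup>2) - c * u\<bar> \<partial>M) \<le> c * sqrt (2 / n)"
proof -
  have mem: "(\<lambda>\<omega>. X \<omega> t) \<in> H" if "t \<in> {0..1}" for t using X that by (auto simp: brownian_in_def)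
  have cov: "(\<integral>\<omega>. X \<omega> s * X \<omega> t \<partial>M) = c * min s t" if "t \<in> {0..1}" "s \<in> {0..1}" for s t
    using X that by (auto simp: brownian_in_def)
  have "(\<integral>\<omega>. X \<omega> 1 * X \<omega> 1 \<partial>M) = c" using cov[of 1 1] by simp
  moreover have "0 \<le> (\<integral>\<omega>. X \<omega> 1 * X \<omega> 1 \<partial>M)" by simp
  ultimately have c: "c \<ge> 0" by simp
  have in01: "(k + u) / n \<in> {0..1}" "k / n \<in> {0..1}" if "k < n" for k :: nat
  proof -
    have "real k + 1 \<le> n" using that by linarith
    then show "(k + u) / n \<in> {0..1}" "k / n \<in> {0..1}" using u that by (auto simp: divide_simps)
  qed
  have 1: "(\<lambda>\<omega>. X \<omega> ((k + u) / n) - X \<omega> (k / n)) \<in> H" if "k < n" for k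
    using diff_mem mem in01 that by blast
  have 2: "(\<integral>\<omega>. (X \<omega> ((k + u) / n) - X \<omega> (k / n)) * (X \<omega> ((l + u) / n) - X \<omega> (l / n)) \<partial>M) = 0"
    if "k < l" "l < n" for k l :: nat
  proof -
    have "k < n" using that by simp
    have "real k + 1 \<le> l" using that by linarith
    then have "(k + u) / n \<le> l / n" "k / n \<le> (k + u) / n" "l / n \<le> (l + u) / n"
      using u by (auto simp: divide_right_mono)
    then show ?thesis
      using in01[OF \<open>k < n\<close>] in01[OF \<open>l < n\<close>]
      by (subst expectation_diff_mult_diff) (auto simp: mem cov min_def simp del: atLeastAtMost_iff)
  qed
  have 3: "(\<integral>\<omega>. (X \<omega> ((k + u) / n) - X \<omega> (k / n))\<^sup>2 \<partial>M) = c * u / n" if "k < n" for k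
  proof -
    have "k / n \<le> (k + u) / n" using u by (auto simp: divide_right_mono)
    then show ?thesis
      unfolding power2_eq_square using in01[OF that]
      by (subst expectation_diff_mult_diff)
         (auto simp: mem cov min_def add_divide_distrib algebra_simps simp del: atLeastAtMost_iff)
  qed
  have 4: "0 \<le> c * u / n" using c u by simp
  have eq: "real n * (c * u / n) = c * u" using n by simp
  note S = sum_of_squares_concentration[where n = n and v = "c * u / n" and X = "\<lambda>k \<omega>. X \<omega> ((k + u) / n) - X \<omega> (k / n)", OF 1 2 3 4]
  show "integrable M (\<lambda>\<omega>. \<bar>(\<Sum>k<n. (X \<omega> ((k + u) / n) - X \<omega> (k / n))\<^sup>2) - c * u\<bar>)"
    using S(1) unfolding eq by simp
  have "(\<integral>\<omega>. \<bar>(\<Sum>k<n. (X \<omega> ((k + u) / n) - X \<omega> (k / n))\<^sup>2) - c * u\<bar> \<partial>M) \<le> sqrt (2 * n) * (c * u / n)"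
    using S(2) unfolding eq by simp
  also have "\<dots> \<le> sqrt (2 * n) * (c * 1 / n)"
    using c u by (intro mult_left_mono divide_right_mono) auto
  also have "\<dots> = c * sqrt (2 / n)"
    using n by (simp add: real_sqrt_mult real_sqrt_divide field_simps)
  finally show "(\<integral>\<omega>. \<bar>(\<Sum>k<n. (X \<omega> ((k + u) / n) - X \<omega> (k / n))\<^sup>2) - c * u\<bar> \<partial>M) \<le> c * sqrt (2 / n)" .
qed

end

section \<open>Riemann sums and their errors along a single path\<close>

lemma integral_sum_partition:
  fixes f :: "real \<Rightarrow> real" and p :: "nat \<Rightarrow> real"
  assumes mono: "\<And>i. i < m \<Longrightarrow> p i \<le> p (Suc i)" and int: "f integrable_on {p 0..p m}"
  shows "integral {p 0..p m} f = (\<Sum>i<m. integral {p i..p (Suc i)} f)"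
  using assms
proof (induction m)
  case (Suc m)
  have le: "p 0 \<le> p i" if "i \<le> Suc m" for i
    using that
  proof (induction i)
    case (Suc i)
    then show ?case using Suc.prems \<open>\<And>i. i < Suc m \<Longrightarrow> p i \<le> p (Suc i)\<close>[of i] by linarith
  qed simp
  have "integral {p 0..p m} f + integral {p m..p (Suc m)} f = integral {p 0..p (Suc m)} f"
    using Suc.prems le by (intro Henstock_Kurzweil_Integration.integral_combine) auto
  moreover have "f integrable_on {p 0..p m}"
    using Suc.prems by (intro integrable_subinterval_real[OF Suc.prems(2)]) auto
  ultimately show ?case using Suc by simp
qed simp

text \<open>
  All properties of integrals of random paths below (measurability, moments, characteristic functions)
  are obtained from these sums.
\<close>

lemma riemann_sum_tendsto:
  fixes f :: "real \<Rightarrow> real"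
  assumes cont: "continuous_on {a..b} f" and ab: "a \<le> b"
  shows "(\<lambda>m. (b - a) / real m * (\<Sum>j<m. f (a + (b - a) * (real j / real m)))) \<longlonglongrightarrow> integral {a..b} f"
proof (rule LIMSEQ_I)
  fix r :: real assume r: "0 < r"
  define e where "e = r / (2 * (b - a + 1))"
  have e: "e > 0" using r ab by (simp add: e_def)
  have "uniformly_continuous_on {a..b} f"
    using cont by (intro compact_uniformly_continuous) auto
  then obtain d where d: "d > 0" "\<And>x y. x \<in> {a..b} \<Longrightarrow> y \<in> {a..b} \<Longrightarrow> dist y x < d \<Longrightarrow> dist (f y) (f x) < e"
    using e unfolding uniformly_continuous_on_def by meson
  obtain N where N: "real N > (b - a) / d" using reals_Archimedean2 by blast
  show "\<exists>no. \<forall>m\<ge>no. norm ((b - a) / real m * (\<Sum>j<m. f (a + (b - a) * (real j / real m))) - integral {a..b} f) < r"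
  proof (intro exI allI impI)
    fix m assume m: "Suc N \<le> m"
    then have m0: "m > 0" by simp
    have hd: "(b - a) / m < d"
    proof -
      have "(b - a) / d < m" using N m by linarith
      then show ?thesis using d m0 by (simp add: divide_simps mult.commute)
    qed
    define p where "p j = a + (b - a) * (real j / real m)" for j
    have p0: "p 0 = a" and pm: "p m = b" using m0 by (auto simp: p_def)
    have step: "p (Suc j) - p j = (b - a) / m" for j
      by (simp add: p_def add_divide_distrib algebra_simps)
    have mono: "p j \<le> p (Suc j)" for j
      using step[of j] ab by (smt (verit) divide_nonneg_nonneg of_nat_0_le_iff)
    have rng: "a \<le> p j \<and> p j \<le> b" if "j \<le> m" for j
    proof -
      have "(b - a) * (real j / real m) \<le> (b - a) * 1"
        using that m0 ab by (intro mult_left_mono) auto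
      then show ?thesis using ab by (auto simp: p_def)
    qed
    have fint: "f integrable_on {a..b}" using cont by (rule integrable_continuous_real)
    have "integral {a..b} f = (\<Sum>j<m. integral {p j..p (Suc j)} f)"
      using integral_sum_partition[of m p f] mono fint p0 pm by auto
    then have "(b - a) / m * (\<Sum>j<m. f (p j)) - integral {a..b} f
        = (\<Sum>j<m. (b - a) / m * f (p j) - integral {p j..p (Suc j)} f)"
      by (simp add: sum_distrib_left sum_subtractf)
    also have "norm \<dots> \<le> (\<Sum>j<m. e * ((b - a) / m))"
    proof (rule sum_norm_le)
      fix j assume "j \<in> {..<m}"
      then have sub: "{p j..p (Suc j)} \<subseteq> {a..b}" using rng[of j] rng[of "Suc j"] by auto
      have fi: "f integrable_on {p j..p (Suc j)}" using fint sub by (rule integrable_subinterval_real)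
      have "(b - a) / m * f (p j) - integral {p j..p (Suc j)} f = integral {p j..p (Suc j)} (\<lambda>x. f (p j) - f x)"
        using mono[of j] step[of j] fi by (subst integral_diff) (auto simp: mult.commute)
      also have "norm \<dots> \<le> integral {p j..p (Suc j)} (\<lambda>x. e)"
      proof (rule integral_norm_bound_integral)
        show "(\<lambda>x. f (p j) - f x) integrable_on {p j..p (Suc j)}" using fi by (intro integrable_diff) auto
        fix x assume x: "x \<in> {p j..p (Suc j)}"
        then have "dist (p j) x < d" using hd step[of j] by (auto simp: dist_real_def)
        then have "dist (f (p j)) (f x) < e" using x sub mono[of j] by (intro d(2)) auto
        then show "norm (f (p j) - f x) \<le> e" by (simp add: dist_norm)
      qed auto
      also have "\<dots> = e * ((b - a) / m)" using mono[of j] step[of j] by (simp add: mult.commute)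
      finally show "norm ((b - a) / m * f (p j) - integral {p j..p (Suc j)} f) \<le> e * ((b - a) / m)" .
    qed
    also have "\<dots> = e * (b - a)" using m0 by simp
    also have "\<dots> \<le> r / 2"
      unfolding e_def using ab r by (simp add: divide_simps)
    also have "\<dots> < r" using r by simp
    finally show "norm ((b - a) / real m * (\<Sum>j<m. f (a + (b - a) * (real j / real m))) - integral {a..b} f) < r"
      by (simp add: p_def)
  qed
qed

definition left_mean :: "nat \<Rightarrow> (real \<Rightarrow> real) \<Rightarrow> real"
  where "left_mean n f = (\<Sum>k<n. f (real k / real n)) / real n"

text \<open>
  The integral over the \<open>k\<close>-th cell of the path minus its linear interpolation, that is, of the bridge
  that the path performs in this cell.
\<close>

definition bridge_integral :: "nat \<Rightarrow> (real \<Rightarrow> real) \<Rightarrow> nat \<Rightarrow> real"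
  where "bridge_integral n f k = integral {real k / real n..(real k + 1) / real n} f
    - (f (real k / real n) + f ((real k + 1) / real n)) / (2 * real n)"

text \<open>
  The part of the scaled error of the Riemann sums of \<open>f\<^sup>2\<close> that is neither a boundary term nor linear in
  the bridge integrals.
\<close>

definition square_remainder :: "nat \<Rightarrow> (real \<Rightarrow> real) \<Rightarrow> real"
  where "square_remainder n f = real n * (left_mean n (\<lambda>t. (f t)\<^sup>2) - integral {0..1} (\<lambda>t. (f t)\<^sup>2))
    + ((f 1)\<^sup>2 - (f 0)\<^sup>2) / 2 + 2 * real n * (\<Sum>k<n. f (real k / real n) * bridge_integral n f k)"

definition product_remainder :: "nat \<Rightarrow> (real \<Rightarrow> real) \<Rightarrow> (real \<Rightarrow> real) \<Rightarrow> real"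
  where "product_remainder n f g = real n * (left_mean n (\<lambda>t. f t * g t) - integral {0..1} (\<lambda>t. f t * g t))
    + (f 1 * g 1 - f 0 * g 0) / 2
    + real n * (\<Sum>k<n. f (real k / real n) * bridge_integral n g k + g (real k / real n) * bridge_integral n f k)"

lemma left_mean_tendsto:
  assumes "continuous_on {0..1} f"
  shows "(\<lambda>n. left_mean n f) \<longlonglongrightarrow> integral {0..1} f"
proof -
  have "left_mean n f = (1 - 0) / real n * (\<Sum>j<n. f (0 + (1 - 0) * (real j / real n)))" for n
    by (simp add: left_mean_def)
  then show ?thesis
    using riemann_sum_tendsto[OF assms zero_le_one] by presburger
qed

lemma block_subset: "k < n \<Longrightarrow> {real k / real n..(real k + 1) / real n} \<subseteq> {0..1}"
proof -
  assume "k < n"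
  then have "real k + 1 \<le> n" by linarith
  then show ?thesis by (auto simp: divide_simps)
qed

lemma block_mem: "k < n \<Longrightarrow> real k / real n \<in> {0..1}" "k < n \<Longrightarrow> (real k + 1) / real n \<in> {0..1}"
  using block_subset[of k n] by (auto simp: divide_right_mono)

lemma integral_sum_blocks:
  fixes f :: "real \<Rightarrow> real"
  assumes "continuous_on {0..1} f" "n \<ge> 1"
  shows "integral {0..1} f = (\<Sum>k<n. integral {real k / real n..(real k + 1) / real n} f)"
  using integral_sum_partition[of n "\<lambda>k. real k / real n" f] assms
  by (simp add: divide_right_mono add.commute integrable_continuous_real)

lemma block_integrable:
  fixes f :: "real \<Rightarrow> real"
  assumes "continuous_on {0..1} f" "k < n"
  shows "f integrable_on {real k / real n..(real k + 1) / real n}"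
  using continuous_on_subset[OF assms(1) block_subset[OF assms(2)]] by (rule integrable_continuous_real)

text \<open>
  Left sums differ from the trapezoidal rule by a boundary term only, and the error of the latter
  consists of the bridge integrals.
\<close>

lemma left_mean_error:
  assumes "continuous_on {0..1} f" "n \<ge> 1"
  shows "real n * (left_mean n f - integral {0..1} f) = - (f 1 - f 0) / 2 - real n * (\<Sum>k<n. bridge_integral n f k)"
proof -
  have "(\<Sum>k<n. f ((real k + 1) / n) - f (k / n)) = f 1 - f 0"
    using sum_lessThan_telescope[of "\<lambda>k. f (real k / n)" n] assms(2) by (simp add: add.commute)
  then have "(\<Sum>k<n. f (k / n) + f ((real k + 1) / n)) = 2 * (\<Sum>k<n. f (k / n)) + (f 1 - f 0)"
    by (simp add: sum.distrib sum_subtractf)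
  then have E: "(\<Sum>k<n. bridge_integral n f k) = integral {0..1} f - (2 * (\<Sum>k<n. f (k / n)) + (f 1 - f 0)) / (2 * n)"
    using integral_sum_blocks[OF assms]
    by (simp add: bridge_integral_def sum_subtractf sum_divide_distrib[symmetric])
  have "real n * (\<Sum>k<n. bridge_integral n f k) = real n * integral {0..1} f - (\<Sum>k<n. f (k / n)) - (f 1 - f 0) / 2"
    unfolding E using assms(2) by (simp add: field_simps)
  moreover have "real n * left_mean n f = (\<Sum>k<n. f (k / n))"
    using assms(2) by (simp add: left_mean_def)
  ultimately show ?thesis
    unfolding right_diff_distrib by linarith
qed

text \<open>
  Put \<open>f = f(k/n) + increment\<close> on the \<open>k\<close>-th cell: all terms linear in the increment cancel. For a
  Brownian path of variance \<open>c\<close> the two remaining quadratic expressions both have mean \<open>c/2\<close>.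
\<close>

lemma square_remainder_eq:
  assumes cont: "continuous_on {0..1} f" and n: "n \<ge> 1"
  shows "square_remainder n f = (\<Sum>k<n. (f ((real k + 1) / n) - f (real k / n))\<^sup>2) / 2
     - n * (\<Sum>k<n. integral {real k / n..(real k + 1) / n} (\<lambda>t. (f t - f (real k / n))\<^sup>2))"
proof -
  \<comment> \<open>the identity holds on each cell separately; boundary terms telescope afterwards\<close>
  have blk: "(f ((real k + 1) / n) - f (real k / n))\<^sup>2 / 2
        - n * integral {real k / n..(real k + 1) / n} (\<lambda>t. (f t - f (real k / n))\<^sup>2)
      = (f (real k / n))\<^sup>2 + ((f ((real k + 1) / n))\<^sup>2 - (f (real k / n))\<^sup>2) / 2
        - n * integral {real k / n..(real k + 1) / n} (\<lambda>t. (f t)\<^sup>2)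
        + 2 * n * (f (real k / n) * bridge_integral n f k)" if "k < n" for k
  proof -
    have c2: "continuous_on {0..1} (\<lambda>t. (f t)\<^sup>2)" using cont by (intro continuous_intros)
    have len: "(real k + 1) / n - k / n = 1 / n" by (simp add: diff_divide_distrib[symmetric])
    have le: "k / n \<le> (real k + 1) / n" by (simp add: divide_right_mono)
    have "integral {real k / n..(real k + 1) / n} (\<lambda>t. (f t - f (real k / n))\<^sup>2)
        = integral {real k / n..(real k + 1) / n} (\<lambda>t. (f t)\<^sup>2 - (2 * f (real k / n)) * f t + (f (real k / n))\<^sup>2)"
      by (intro integral_cong) (simp add: power2_eq_square algebra_simps)
    also have "\<dots> = integral {real k / n..(real k + 1) / n} (\<lambda>t. (f t)\<^sup>2)
        - (2 * f (real k / n)) * integral {real k / n..(real k + 1) / n} f + (f (real k / n))\<^sup>2 / n"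
      using block_integrable[OF cont that] block_integrable[OF c2 that] le len
      by (subst integral_add integral_diff, (auto intro!: integrable_diff integrable_on_mult_right)[2])+
         (simp add: mult.commute)
    finally have 1: "integral {real k / n..(real k + 1) / n} (\<lambda>t. (f t - f (real k / n))\<^sup>2) = \<dots>" .
    show ?thesis
      unfolding 1 bridge_integral_def using n by (simp add: field_simps power2_eq_square)
  qed
  have tel: "(\<Sum>k<n. (f ((real k + 1) / n))\<^sup>2 - (f (k / n))\<^sup>2) = (f 1)\<^sup>2 - (f 0)\<^sup>2"
    using sum_lessThan_telescope[of "\<lambda>k. (f (real k / n))\<^sup>2" n] n by (simp add: add.commute)
  have tel2: "(\<Sum>k<n. ((f ((real k + 1) / n))\<^sup>2 - (f (k / n))\<^sup>2) / 2) = ((f 1)\<^sup>2 - (f 0)\<^sup>2) / 2"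
    by (simp only: sum_divide_distrib[symmetric] tel)
  have i2: "integral {0..1} (\<lambda>t. (f t)\<^sup>2) = (\<Sum>k<n. integral {real k / n..(real k + 1) / n} (\<lambda>t. (f t)\<^sup>2))"
    by (rule integral_sum_blocks) (use cont n in \<open>auto intro!: continuous_intros\<close>)
  have "(\<Sum>k<n. (f ((real k + 1) / n) - f (real k / n))\<^sup>2) / 2
     - n * (\<Sum>k<n. integral {real k / n..(real k + 1) / n} (\<lambda>t. (f t - f (real k / n))\<^sup>2))
     = (\<Sum>k<n. (f ((real k + 1) / n) - f (real k / n))\<^sup>2 / 2
        - n * integral {real k / n..(real k + 1) / n} (\<lambda>t. (f t - f (real k / n))\<^sup>2))"
    by (simp add: sum_subtractf sum_divide_distrib sum_distrib_left)
  also have "\<dots> = (\<Sum>k<n. (f (real k / n))\<^sup>2 + ((f ((real k + 1) / n))\<^sup>2 - (f (real k / n))\<^sup>2) / 2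
        - n * integral {real k / n..(real k + 1) / n} (\<lambda>t. (f t)\<^sup>2)
        + 2 * n * (f (real k / n) * bridge_integral n f k))"
    by (intro sum.cong refl blk) auto
  also have "\<dots> = (\<Sum>k<n. (f (real k / n))\<^sup>2) + ((f 1)\<^sup>2 - (f 0)\<^sup>2) / 2 - n * integral {0..1} (\<lambda>t. (f t)\<^sup>2)
        + 2 * n * (\<Sum>k<n. f (real k / n) * bridge_integral n f k)"
    unfolding i2 sum_distrib_left tel2[symmetric] by (simp only: sum.distrib sum_subtractf)
  moreover have "real n * left_mean n (\<lambda>t. (f t)\<^sup>2) = (\<Sum>k<n. (f (real k / n))\<^sup>2)"
    using n by (simp add: left_mean_def)
  ultimately show ?thesis
    unfolding square_remainder_def right_diff_distrib by linarith
qed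

text \<open>
  The integral term of \<open>square_remainder_eq\<close> is the average over \<open>u\<close> in \<open>[0,1]\<close> of the sums of squared
  increments over \<open>[k/n, (k+u)/n]\<close>; here it is written as a limit of averages over \<open>u = j/m\<close>.
\<close>

lemma square_remainder_limit:
  assumes cont: "continuous_on {0..1} f" and n: "n \<ge> 1"
  shows "(\<lambda>m. (\<Sum>k<n. (f ((real k + 1) / n) - f (real k / n))\<^sup>2) / 2
     - (\<Sum>j<m. \<Sum>k<n. (f ((real k + real j / real m) / n) - f (real k / n))\<^sup>2) / real m) \<longlonglongrightarrow> square_remainder n f"
proof -
  have "(\<lambda>m. 1 / n / real m * (\<Sum>j<m. (f ((real k + real j / real m) / n) - f (real k / n))\<^sup>2))
      \<longlonglongrightarrow> integral {real k / n..(real k + 1) / n} (\<lambda>t. (f t - f (real k / n))\<^sup>2)" if "k < n" for k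
  proof -
    have len: "(real k + 1) / n - k / n = 1 / n" by (simp add: diff_divide_distrib[symmetric])
    have pt: "k / n + 1 / n * (j / m) = (real k + real j / real m) / n" for j m :: nat
      by (simp add: add_divide_distrib)
    have "continuous_on {real k / n..(real k + 1) / n} (\<lambda>t. (f t - f (real k / n))\<^sup>2)"
      by (intro continuous_intros continuous_on_subset[OF cont block_subset[OF that]])
    from riemann_sum_tendsto[OF this] show ?thesis
      unfolding len pt by (simp add: divide_right_mono)
  qed
  then have "(\<lambda>m. (\<Sum>k<n. (f ((real k + 1) / n) - f (real k / n))\<^sup>2) / 2
     - n * (\<Sum>k<n. 1 / n / real m * (\<Sum>j<m. (f ((real k + real j / real m) / n) - f (real k / n))\<^sup>2))) \<longlonglongrightarrow> square_remainder n f"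
    unfolding square_remainder_eq[OF assms] by (intro tendsto_intros) auto
  moreover have "n * (\<Sum>k<n. 1 / n / real m * (\<Sum>j<m. (f ((real k + real j / real m) / n) - f (real k / n))\<^sup>2))
      = (\<Sum>j<m. \<Sum>k<n. (f ((real k + real j / real m) / n) - f (real k / n))\<^sup>2) / real m" for m
    unfolding sum_distrib_left[symmetric] using n by (subst sum.swap) simp
  ultimately show ?thesis by simp
qed

lemma product_remainder_polarization:
  assumes f: "continuous_on {0..1} f" and g: "continuous_on {0..1} g"
  shows "product_remainder n f g
    = (square_remainder n (\<lambda>t. f t + g t) - square_remainder n (\<lambda>t. f t - g t)) / 4"
proof -
  have br: "bridge_integral n (\<lambda>t. f t + g t) k = bridge_integral n f k + bridge_integral n g k"
    "bridge_integral n (\<lambda>t. f t - g t) k = bridge_integral n f k - bridge_integral n g k" if "k < n" for k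
    using block_integrable[OF f that] block_integrable[OF g that]
    by (auto simp: bridge_integral_def integral_add integral_diff add_divide_distrib diff_divide_distrib)
  have "integral {0..1} (\<lambda>t. f t * g t) = integral {0..1} (\<lambda>t. ((f t + g t)\<^sup>2 - (f t - g t)\<^sup>2) / 4)"
    by (intro integral_cong) (simp add: power2_eq_square algebra_simps)
  also have "\<dots> = (integral {0..1} (\<lambda>t. (f t + g t)\<^sup>2) - integral {0..1} (\<lambda>t. (f t - g t)\<^sup>2)) / 4"
    using f g by (subst integral_diff[symmetric]) (auto intro!: integrable_continuous_real continuous_intros)
  finally have i: "integral {0..1} (\<lambda>t. f t * g t) = \<dots>" .
  have m: "left_mean n (\<lambda>t. f t * g t) = (left_mean n (\<lambda>t. (f t + g t)\<^sup>2) - left_mean n (\<lambda>t. (f t - g t)\<^sup>2)) / 4"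
    unfolding left_mean_def
    by (simp add: diff_divide_distrib[symmetric] sum_subtractf[symmetric] power2_eq_square algebra_simps
       sum_distrib_left[symmetric] sum_divide_distrib[symmetric])
  have s: "(\<Sum>k<n. f (real k / real n) * bridge_integral n g k + g (real k / real n) * bridge_integral n f k)
    = ((\<Sum>k<n. (f (k / n) + g (k / n)) * bridge_integral n (\<lambda>t. f t + g t) k)
      - (\<Sum>k<n. (f (k / n) - g (k / n)) * bridge_integral n (\<lambda>t. f t - g t) k)) / 2"
    unfolding sum_subtractf[symmetric] sum_divide_distrib
    by (intro sum.cong) (auto simp: br algebra_simps)
  show ?thesis
    unfolding product_remainder_def square_remainder_def i m s by (simp add: field_simps power2_eq_square)
qed

section \<open>Quadratic remainders of Brownian paths\<close>

context gaussian_space begin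

text \<open>
  The approximants in \<open>square_remainder_limit\<close> are combinations of sums of squared increments. Each sum
  is within \<open>c sqrt(2/n)\<close> of its mean in \<open>L\<^sup>1\<close>, and the means cancel up to the error \<open>c/(2m)\<close> of a Riemann
  sum of the function \<open>c u\<close>. Fatou's lemma carries the bound to the limit.
\<close>

lemma brownian_square_remainder:
  fixes n :: nat
  assumes X: "brownian_in c X" and cont: "\<And>\<omega>. \<omega> \<in> space M \<Longrightarrow> continuous_on {0..1} (X \<omega>)" and n: "n \<ge> 1"
  shows "(\<integral>\<^sup>+\<omega>. ennreal \<bar>square_remainder n (X \<omega>)\<bar> \<partial>M) \<le> ennreal (2 * c * sqrt (2 / n))"
proof -
  define V where "V u \<omega> = (\<Sum>k<n. (X \<omega> ((real k + u) / n) - X \<omega> (real k / n))\<^sup>2)" for u \<omega>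
  define T where "T m \<omega> = V 1 \<omega> / 2 - (\<Sum>j<m. V (real j / real m) \<omega>) / real m" for m :: nat and \<omega>
  have X1: "(\<integral>\<omega>. X \<omega> 1 * X \<omega> 1 \<partial>M) = c" using X by (auto simp: brownian_in_def)
  moreover have "0 \<le> (\<integral>\<omega>. X \<omega> 1 * X \<omega> 1 \<partial>M)" by simp
  ultimately have c: "c \<ge> 0" by simp
  have lim: "(\<lambda>m. T m \<omega>) \<longlonglongrightarrow> square_remainder n (X \<omega>)" if "\<omega> \<in> space M" for \<omega>
    using square_remainder_limit[OF cont[OF that] n] by (simp add: T_def V_def)
  have Vint: "integrable M (\<lambda>\<omega>. \<bar>V u \<omega> - c * u\<bar>)" "(\<integral>\<omega>. \<bar>V u \<omega> - c * u\<bar> \<partial>M) \<le> c * sqrt (2 / n)"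
    if "0 \<le> u" "u \<le> 1" for u
    using brownian_quadratic_variation[OF X n that] by (simp_all add: V_def)
  have bnd: "(\<integral>\<^sup>+\<omega>. ennreal \<bar>T m \<omega>\<bar> \<partial>M) \<le> ennreal (3 / 2 * (c * sqrt (2 / n)) + c / (2 * real m))" if m: "m \<ge> 1" for m
  proof -
    \<comment> \<open>\<open>c/2\<close> is the mean of the first term of \<open>T m\<close>, and \<open>c/2 - c/(2m)\<close> is the mean of the second\<close>
    define G where "G \<omega> = \<bar>V 1 \<omega> - c\<bar> / 2 + (\<Sum>j<m. \<bar>V (j / m) \<omega> - c * (j / m)\<bar>) / m + c / (2 * real m)" for \<omega>
    have sumj: "(\<Sum>j<m. real j) = real m * (real m - 1) / 2"
      by (induction m) (auto simp: field_simps)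
    then have sj: "(\<Sum>j<m. c * (real j / m)) / m = c / 2 - c / (2 * real m)"
      unfolding sum_distrib_left[symmetric] sum_divide_distrib[symmetric] sumj using m by (simp add: field_simps)
    have le: "\<bar>T m \<omega>\<bar> \<le> G \<omega>" for \<omega>
    proof -
      have "T m \<omega> = (V 1 \<omega> - c) / 2 - (\<Sum>j<m. V (j / m) \<omega> - c * (j / m)) / m + c / (2 * real m)"
        unfolding T_def sum_subtractf diff_divide_distrib sj by simp
      also have "\<bar>\<dots>\<bar> \<le> \<bar>(V 1 \<omega> - c) / 2\<bar> + \<bar>(\<Sum>j<m. V (j / m) \<omega> - c * (j / m)) / m\<bar> + \<bar>c / (2 * real m)\<bar>"
        by linarith
      also have "\<dots> \<le> G \<omega>"
        unfolding G_def using c m by (auto intro!: divide_right_mono sum_abs)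
      finally show ?thesis .
    qed
    have jm: "0 \<le> real j / m" "real j / m \<le> 1" if "j < m" for j using that by auto
    have i1: "integrable M (\<lambda>\<omega>. \<bar>V 1 \<omega> - c\<bar>)" "(\<integral>\<omega>. \<bar>V 1 \<omega> - c\<bar> \<partial>M) \<le> c * sqrt (2 / n)"
      using Vint[of 1] by auto
    have i2: "integrable M (\<lambda>\<omega>. \<Sum>j<m. \<bar>V (j / m) \<omega> - c * (j / m)\<bar>)"
      by (intro Bochner_Integration.integrable_sum Vint(1) jm) auto
    have "(\<integral>\<omega>. (\<Sum>j<m. \<bar>V (j / m) \<omega> - c * (j / m)\<bar>) \<partial>M) = (\<Sum>j<m. \<integral>\<omega>. \<bar>V (j / m) \<omega> - c * (j / m)\<bar> \<partial>M)"
      by (intro Bochner_Integration.integral_sum Vint(1) jm) auto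
    also have "\<dots> \<le> (\<Sum>j<m. c * sqrt (2 / n))"
      by (intro sum_mono Vint(2) jm) auto
    finally have i3: "(\<integral>\<omega>. (\<Sum>j<m. \<bar>V (j / m) \<omega> - c * (j / m)\<bar>) \<partial>M) / m \<le> c * sqrt (2 / n)"
      using m by (simp add: field_simps)
    have Gi: "integrable M G" unfolding G_def using i1 i2 by auto
    have "(\<integral>\<^sup>+\<omega>. ennreal \<bar>T m \<omega>\<bar> \<partial>M) \<le> (\<integral>\<^sup>+\<omega>. ennreal (G \<omega>) \<partial>M)"
      using le by (intro nn_integral_mono ennreal_leI) auto
    also have "\<dots> = ennreal (\<integral>\<omega>. G \<omega> \<partial>M)"
      using Gi le by (intro nn_integral_eq_integral) (auto intro: order_trans[OF abs_ge_zero])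
    also have "(\<integral>\<omega>. G \<omega> \<partial>M) = (\<integral>\<omega>. \<bar>V 1 \<omega> - c\<bar> \<partial>M) / 2
        + (\<integral>\<omega>. (\<Sum>j<m. \<bar>V (j / m) \<omega> - c * (j / m)\<bar>) \<partial>M) / m + c / (2 * real m)"
      unfolding G_def using i1 i2 by (simp add: prob_space)
    also have "ennreal \<dots> \<le> ennreal (3 / 2 * (c * sqrt (2 / n)) + c / (2 * real m))"
      by (intro ennreal_leI) (use i1(2) i3 in linarith)
    finally show ?thesis .
  qed
  have Tm[measurable]: "(\<lambda>\<omega>. T m \<omega>) \<in> borel_measurable M" for m
  proof -
    have pt: "(real k + u) / n \<in> {0..1}" if "k < n" "0 \<le> u" "u \<le> 1" for k u
    proof -
      have "real k + 1 \<le> n" using that by linarith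
      then show ?thesis using that by (auto simp: divide_simps)
    qed
    have m1: "(\<lambda>\<omega>. X \<omega> ((real k + u) / n)) \<in> borel_measurable M" if "k < n" "0 \<le> u" "u \<le> 1" for k u
      using X pt[OF that] by (auto simp: brownian_in_def intro: measurable_mem)
    from m1 m1[of _ 0] have "V u \<in> borel_measurable M" if "0 \<le> u" "u \<le> 1" for u
      unfolding V_def using that by (intro borel_measurable_sum borel_measurable_power borel_measurable_diff) auto
    then show ?thesis
      unfolding T_def by (intro borel_measurable_diff borel_measurable_divide borel_measurable_sum) auto
  qed
  have "(\<integral>\<^sup>+\<omega>. ennreal \<bar>square_remainder n (X \<omega>)\<bar> \<partial>M) = (\<integral>\<^sup>+\<omega>. liminf (\<lambda>m. ennreal \<bar>T m \<omega>\<bar>) \<partial>M)"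
  proof (rule nn_integral_cong)
    fix \<omega> assume "\<omega> \<in> space M"
    then have "(\<lambda>m. ennreal \<bar>T m \<omega>\<bar>) \<longlonglongrightarrow> ennreal \<bar>square_remainder n (X \<omega>)\<bar>"
      by (intro tendsto_intros lim)
    then show "ennreal \<bar>square_remainder n (X \<omega>)\<bar> = liminf (\<lambda>m. ennreal \<bar>T m \<omega>\<bar>)"
      by (intro lim_imp_Liminf[symmetric]) auto
  qed
  also have "\<dots> \<le> liminf (\<lambda>m. \<integral>\<^sup>+\<omega>. ennreal \<bar>T m \<omega>\<bar> \<partial>M)"
    by (rule nn_integral_liminf) measurable
  also have "\<dots> \<le> liminf (\<lambda>m::nat. ennreal (3 / 2 * (c * sqrt (2 / n)) + c / (2 * real m)))"
    by (intro Liminf_mono eventually_sequentiallyI[of 1]) (use bnd in auto)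
  also have "\<dots> = ennreal (3 / 2 * (c * sqrt (2 / n)) + 0)"
  proof (intro lim_imp_Liminf tendsto_intros)
    show "(\<lambda>m. c / (2 * real m)) \<longlonglongrightarrow> 0" by real_asymp
  qed auto
  also have "\<dots> \<le> ennreal (2 * c * sqrt (2 / n))"
    using c by (intro ennreal_leI) (auto intro!: mult_right_mono)
  finally show ?thesis .
qed

end

section \<open>Joint law of increments and bridge integrals\<close>

text \<open>
  The error of the trapezoidal rule on a grid as a combination of the increments. The weights are
  antisymmetric about the middle of the grid, so that they sum to zero; this is why bridge integrals
  are uncorrelated with the increment over their cell.
\<close>

lemma summation_by_parts_trapezoid:
  fixes a :: "nat \<Rightarrow> real"
  assumes m: "m \<ge> 1"
  shows "(\<Sum>j<m. a j) / m + (a m - a 0) / (2 * real m) - (a 0 + a m) / 2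
    = (\<Sum>i<m. (1/2 - (real i + 1/2) / m) * (a (Suc i) - a i))"
proof -
  have 1: "(\<Sum>i<m. real i * (a (Suc i) - a i)) = real m * a m - (\<Sum>i<m. a (Suc i))"
    by (induction m) (auto simp: algebra_simps)
  have 2: "(\<Sum>i<m. a (Suc i) - a i) = a m - a 0"
    by (rule sum_lessThan_telescope)
  have "(\<Sum>i<m. (1/2 - (real i + 1/2) / m) * (a (Suc i) - a i))
     = (\<Sum>i<m. (1/2 - 1 / (2 * real m)) * (a (Suc i) - a i) - (real i * (a (Suc i) - a i)) / m)"
    using m by (intro sum.cong refl) (simp add: field_simps)
  also have "\<dots> = (\<Sum>i<m. (1/2 - 1 / (2 * real m)) * (a (Suc i) - a i)) - (\<Sum>i<m. (real i * (a (Suc i) - a i)) / m)"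
    by (rule sum_subtractf)
  also have "\<dots> = (1/2 - 1 / (2 * real m)) * (a m - a 0) - (real m * a m - (\<Sum>i<m. a (Suc i))) / m"
    unfolding sum_distrib_left[symmetric] sum_divide_distrib[symmetric] 1 2 ..
  also have "(\<Sum>i<m. a (Suc i)) = (\<Sum>i<m. a i) + (a m - a 0)"
    using 2 by (simp add: sum_subtractf)
  finally have eq: "(\<Sum>i<m. (1/2 - (real i + 1/2) / m) * (a (Suc i) - a i))
    = (1/2 - 1 / (2 * real m)) * (a m - a 0) - (real m * a m - ((\<Sum>i<m. a i) + (a m - a 0))) / real m"
    by simp
  show ?thesis
    unfolding eq using m by (simp add: field_simps)
qed

text \<open>
  The second sum is the origin of the factor \<open>1/12\<close> in the limiting variance.
\<close>

lemma trapezoid_weights_sum: 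
  assumes m: "m \<ge> 1"
  shows "(\<Sum>i<m. 1/2 - (real i + 1/2) / real m) = 0"
    and "(\<Sum>i<m. (1/2 - (real i + 1/2) / real m)\<^sup>2) = real m / 12 - 1 / (12 * real m)"
proof -
  have s1: "(\<Sum>i<M. 2 * real i) = real M * (real M - 1)" for M
    by (induction M) (auto simp: algebra_simps)
  have s2: "(\<Sum>i<M. (c - 2 * real i)\<^sup>2) = M * c\<^sup>2 - 2 * c * M * (real M - 1) + 2 * (real M - 1) * M * (2 * real M - 1) / 3" for M c
  proof -
    have "3 * (\<Sum>i<M. (c - 2 * real i)\<^sup>2) = 3 * (M * c\<^sup>2 - 2 * c * M * (real M - 1)) + 2 * (real M - 1) * M * (2 * real M - 1)"
      by (induction M) (auto simp: algebra_simps power2_eq_square)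
    then show ?thesis by simp
  qed
  have "1/2 - (real i + 1/2) / m = ((real m - 1) - 2 * real i) / (2 * real m)" for i
    using m by (simp add: field_simps)
  then have e: "(\<Sum>i<m. 1/2 - (real i + 1/2) / m) = (\<Sum>i<m. (real m - 1) - 2 * real i) / (2 * real m)"
     "(\<Sum>i<m. (1/2 - (real i + 1/2) / m)\<^sup>2) = (\<Sum>i<m. ((real m - 1) - 2 * real i)\<^sup>2) / (2 * real m)\<^sup>2"
    by (simp_all add: sum_divide_distrib power_divide)
  show "(\<Sum>i<m. 1/2 - (real i + 1/2) / m) = 0"
    unfolding e(1) unfolding sum_subtractf s1 by (simp add: algebra_simps)
  show "(\<Sum>i<m. (1/2 - (real i + 1/2) / real m)\<^sup>2) = real m / 12 - 1 / (12 * real m)"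
    unfolding e(2) s2 using m by (simp add: field_simps power2_eq_square)
qed

locale brownian_pair = gaussian_space +
  fixes r :: real and X Y :: "'a \<Rightarrow> real \<Rightarrow> real"
  assumes r: "-1 < r" "r < 1"
    and X_mem: "t \<in> {0..1} \<Longrightarrow> (\<lambda>\<omega>. X \<omega> t) \<in> H"
    and Y_mem: "t \<in> {0..1} \<Longrightarrow> (\<lambda>\<omega>. Y \<omega> t) \<in> H"
    and covX: "s \<in> {0..1} \<Longrightarrow> t \<in> {0..1} \<Longrightarrow> (\<integral>\<omega>. X \<omega> s * X \<omega> t \<partial>M) = min s t"
    and covY: "s \<in> {0..1} \<Longrightarrow> t \<in> {0..1} \<Longrightarrow> (\<integral>\<omega>. Y \<omega> s * Y \<omega> t \<partial>M) = min s t"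
    and covXY: "s \<in> {0..1} \<Longrightarrow> t \<in> {0..1} \<Longrightarrow> (\<integral>\<omega>. X \<omega> s * Y \<omega> t \<partial>M) = r * min s t"
    and contX: "\<omega> \<in> space M \<Longrightarrow> continuous_on {0..1} (X \<omega>)"
    and contY: "\<omega> \<in> space M \<Longrightarrow> continuous_on {0..1} (Y \<omega>)"
begin

lemma covYX: "s \<in> {0..1} \<Longrightarrow> t \<in> {0..1} \<Longrightarrow> (\<integral>\<omega>. Y \<omega> s * X \<omega> t \<partial>M) = r * min s t"
  using covXY[of t s] by (simp add: mult.commute min.commute)

text \<open>
  The variance of \<open>a X + b Y\<close> at time one.
\<close>

definition Q :: "real \<Rightarrow> real \<Rightarrow> real" where "Q a b = a\<^sup>2 + b\<^sup>2 + 2 * r * a * b"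

abbreviation dX :: "real \<Rightarrow> real \<Rightarrow> 'a \<Rightarrow> real" where "dX s t \<omega> \<equiv> X \<omega> t - X \<omega> s"
abbreviation dY :: "real \<Rightarrow> real \<Rightarrow> 'a \<Rightarrow> real" where "dY s t \<omega> \<equiv> Y \<omega> t - Y \<omega> s"

lemma increments_mem:
  assumes "s \<in> {0..1}" "t \<in> {0..1}"
  shows "(\<lambda>\<omega>. a * dX s t \<omega> + b * dY s t \<omega>) \<in> H"
  using assms by (intro lin_mem diff_mem X_mem Y_mem)

lemma increments_variance:
  assumes "s \<in> {0..1}" "t \<in> {0..1}" "s \<le> t"
  shows "(\<integral>\<omega>. (a * dX s t \<omega> + b * dY s t \<omega>)\<^sup>2 \<partial>M) = (t - s) * Q a b"
proof -
  have v: "(\<integral>\<omega>. (dX s t \<omega>)\<^sup>2 \<partial>M) = t - s" "(\<integral>\<omega>. (dY s t \<omega>)\<^sup>2 \<partial>M) = t - s" "(\<integral>\<omega>. dX s t \<omega> * dY s t \<omega> \<partial>M) = r * (t - s)"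
    unfolding power2_eq_square using assms
    by (subst expectation_diff_mult_diff;
      auto simp: X_mem Y_mem covX covY covXY min_def algebra_simps simp del: atLeastAtMost_iff)+
  have "(\<integral>\<omega>. (a * dX s t \<omega> + b * dY s t \<omega>)\<^sup>2 \<partial>M)
    = a\<^sup>2 * (\<integral>\<omega>. (dX s t \<omega>)\<^sup>2 \<partial>M) + 2 * a * b * (\<integral>\<omega>. dX s t \<omega> * dY s t \<omega> \<partial>M) + b\<^sup>2 * (\<integral>\<omega>. (dY s t \<omega>)\<^sup>2 \<partial>M)"
    using assms by (intro expectation_square_lin diff_mem X_mem Y_mem)
  then show ?thesis
    unfolding v Q_def by (simp add: algebra_simps)
qed

lemma increments_uncorrelated:
  assumes "s \<in> {0..1}" "t \<in> {0..1}" "s' \<in> {0..1}" "t' \<in> {0..1}" "s \<le> t" "t \<le> s'" "s' \<le> t'"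
  shows "(\<integral>\<omega>. (a * dX s t \<omega> + b * dY s t \<omega>) * (a' * dX s' t' \<omega> + b' * dY s' t' \<omega>) \<partial>M) = 0"
proof -
  have z: "(\<integral>\<omega>. dX s t \<omega> * dX s' t' \<omega> \<partial>M) = 0" "(\<integral>\<omega>. dY s t \<omega> * dY s' t' \<omega> \<partial>M) = 0"
     "(\<integral>\<omega>. dX s t \<omega> * dY s' t' \<omega> \<partial>M) = 0" "(\<integral>\<omega>. dY s t \<omega> * dX s' t' \<omega> \<partial>M) = 0"
    using assms
    by (subst expectation_diff_mult_diff;
      auto simp: X_mem Y_mem covX covY covXY covYX min_def algebra_simps simp del: atLeastAtMost_iff)+
  have i: "integrable M (\<lambda>\<omega>. dX s t \<omega> * dX s' t' \<omega>)" "integrable M (\<lambda>\<omega>. dY s t \<omega> * dY s' t' \<omega>)"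
     "integrable M (\<lambda>\<omega>. dX s t \<omega> * dY s' t' \<omega>)" "integrable M (\<lambda>\<omega>. dY s t \<omega> * dX s' t' \<omega>)"
    using assms by (auto intro!: integrable_mult_mem diff_mem X_mem Y_mem simp del: atLeastAtMost_iff)
  have e: "(a * dX s t \<omega> + b * dY s t \<omega>) * (a' * dX s' t' \<omega> + b' * dY s' t' \<omega>)
    = a * a' * (dX s t \<omega> * dX s' t' \<omega>) + a * b' * (dX s t \<omega> * dY s' t' \<omega>)
      + b * a' * (dY s t \<omega> * dX s' t' \<omega>) + b * b' * (dY s t \<omega> * dY s' t' \<omega>)" for \<omega>
    by (simp add: algebra_simps)
  show ?thesis
    unfolding e using i by (simp add: z)
qed

text \<open>
  Replacing each integral by its trapezoidal rule on \<open>m\<close> subcells gives a combination of increments over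
  subcells, a member of the Gaussian space with an explicit variance. Mixed terms between \<open>(p, q)\<close> and
  \<open>(u, v)\<close> vanish because the trapezoidal weights sum to zero. Then \<open>m\<close> tends to infinity.
\<close>

lemma increments_bridges_charfun:
  fixes n :: nat and p q u v :: "nat \<Rightarrow> real"
  assumes n: "n \<ge> 1"
  shows "(CLINT \<omega>|M. iexp (\<Sum>k<n. p k * dX (k / n) ((real k + 1) / n) \<omega> + q k * dY (k / n) ((real k + 1) / n) \<omega>
       + u k * bridge_integral n (X \<omega>) k + v k * bridge_integral n (Y \<omega>) k))
    = exp (- (\<Sum>k<n. Q (p k) (q k) / n + Q (u k) (v k) / (12 * real n ^ 3)) / 2)"
proof -
  define \<kappa> where "\<kappa> m i = 1/2 - (real i + 1/2) / real m" for m i :: nat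
  define t where "t m k i = (real k + real i / real m) / n" for m k i :: nat
  define \<alpha> where "\<alpha> m k i = p k + u k * \<kappa> m i / n" for m k i
  define \<beta> where "\<beta> m k i = q k + v k * \<kappa> m i / n" for m k i
  define Z where "Z m \<omega> = (\<Sum>(k,i)\<in>{..<n}\<times>{..<m}. \<alpha> m k i * dX (t m k i) (t m k (Suc i)) \<omega> + \<beta> m k i * dY (t m k i) (t m k (Suc i)) \<omega>)" for m \<omega>
  define Zlim where "Zlim \<omega> = (\<Sum>k<n. p k * dX (k / n) ((real k + 1) / n) \<omega> + q k * dY (k / n) ((real k + 1) / n) \<omega>
       + u k * bridge_integral n (X \<omega>) k + v k * bridge_integral n (Y \<omega>) k)" for \<omega>
  have t01: "t m k i \<in> {0..1}" if "k < n" "i \<le> m" for m k i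
  proof -
    have "real k + 1 \<le> n" "real i / real m \<le> 1" using that by (auto simp: divide_le_eq)
    then have "real k + real i / m \<le> n" by linarith
    then show ?thesis using n by (auto simp: t_def divide_simps)
  qed
  have tmono: "t m k (Suc i) - t m k i = 1 / (n * m)" if "m \<ge> 1" for m k i
    using n that by (simp add: t_def field_simps)
  have tle: "t m k i \<le> t m k (Suc i)" for m k i
    by (simp add: t_def divide_right_mono)
  \<comment> \<open>subcells are ordered lexicographically\<close>
  have ord: "t m k (Suc i) \<le> t m l j" if "k < l \<or> (k = l \<and> i < j)" "i < m" "j < m" for m k i l j
  proof -
    have "real (Suc i) / m \<le> 1" using that by (auto simp: divide_le_eq)
    have "real k + real (Suc i) / m \<le> real l + real j / m"
      using that(1)
    proof (elim disjE conjE)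
      assume "k < l"
      then have "real k + 1 \<le> l" by linarith
      moreover have "0 \<le> real j / m" by simp
      ultimately show ?thesis using \<open>real (Suc i) / m \<le> 1\<close> by linarith
    next
      assume "k = l" "i < j"
      then show ?thesis by (auto intro!: divide_right_mono)
    qed
    then show ?thesis unfolding t_def by (intro divide_right_mono) auto
  qed
  have Zmem: "Z m \<in> H" for m
  proof -
    have "(\<lambda>\<omega>. \<Sum>x\<in>{..<n}\<times>{..<m}. 1 * (case x of (k,i) \<Rightarrow> \<alpha> m k i * dX (t m k i) (t m k (Suc i)) \<omega> + \<beta> m k i * dY (t m k i) (t m k (Suc i)) \<omega>)) \<in> H"
    proof (rule sum_mem)
      fix x assume "x \<in> {..<n}\<times>{..<m}"
      then show "(\<lambda>\<omega>. case x of (k,i) \<Rightarrow> \<alpha> m k i * dX (t m k i) (t m k (Suc i)) \<omega> + \<beta> m k i * dY (t m k i) (t m k (Suc i)) \<omega>) \<in> H"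
        using increments_mem t01 by (auto simp del: atLeastAtMost_iff)
    qed
    then show ?thesis by (simp add: Z_def[abs_def])
  qed
  have Zvar: "(\<integral>\<omega>. (Z m \<omega>)\<^sup>2 \<partial>M) = (\<Sum>k<n. Q (p k) (q k) / n + (1 - 1 / (real m)\<^sup>2) * (Q (u k) (v k) / (12 * real n ^ 3)))"
    if m: "m \<ge> 1" for m
  proof -
    have "(\<integral>\<omega>. (Z m \<omega>)\<^sup>2 \<partial>M) = (\<Sum>x\<in>{..<n}\<times>{..<m}. \<integral>\<omega>. (case x of (k,i) \<Rightarrow>
        \<alpha> m k i * dX (t m k i) (t m k (Suc i)) \<omega> + \<beta> m k i * dY (t m k i) (t m k (Suc i)) \<omega>)\<^sup>2 \<partial>M)"
      unfolding Z_def
    proof (rule expectation_square_sum)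
      fix x y assume "x \<in> {..<n}\<times>{..<m}" "y \<in> {..<n}\<times>{..<m}" "x \<noteq> y"
      then obtain k i l j where xy: "x = (k,i)" "y = (l,j)" "k < n" "i < m" "l < n" "j < m" by auto
      have unc: "(\<integral>\<omega>. (\<alpha> m k i * dX (t m k i) (t m k (Suc i)) \<omega> + \<beta> m k i * dY (t m k i) (t m k (Suc i)) \<omega>)
          * (\<alpha> m l j * dX (t m l j) (t m l (Suc j)) \<omega> + \<beta> m l j * dY (t m l j) (t m l (Suc j)) \<omega>) \<partial>M) = 0"
        if "k < l \<or> (k = l \<and> i < j)" "k < n" "i < m" "l < n" "j < m" for k i l j
        using that ord[OF that(1,3,5)] by (intro increments_uncorrelated t01 tle) auto
      show "(\<integral>\<omega>. (case x of (k,i) \<Rightarrow> \<alpha> m k i * dX (t m k i) (t m k (Suc i)) \<omega> + \<beta> m k i * dY (t m k i) (t m k (Suc i)) \<omega>)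
          * (case y of (k,i) \<Rightarrow> \<alpha> m k i * dX (t m k i) (t m k (Suc i)) \<omega> + \<beta> m k i * dY (t m k i) (t m k (Suc i)) \<omega>) \<partial>M) = 0"
      proof (cases "k < l \<or> (k = l \<and> i < j)")
        case True
        then show ?thesis using unc[of k l i j] xy by simp
      next
        case False
        then have "l < k \<or> (l = k \<and> j < i)" using xy \<open>x \<noteq> y\<close> by auto
        then show ?thesis using unc[of l k j i] xy by (simp add: mult.commute)
      qed
    next
      fix x assume "x \<in> {..<n}\<times>{..<m}"
      then show "(\<lambda>\<omega>. case x of (k,i) \<Rightarrow> \<alpha> m k i * dX (t m k i) (t m k (Suc i)) \<omega> + \<beta> m k i * dY (t m k i) (t m k (Suc i)) \<omega>) \<in> H"
        using increments_mem t01 by (auto simp del: atLeastAtMost_iff)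
    qed auto
    also have "\<dots> = (\<Sum>(k,i)\<in>{..<n}\<times>{..<m}. Q (\<alpha> m k i) (\<beta> m k i) / (n * m))"
      using tle by (intro sum.cong refl) (auto simp: increments_variance t01 tmono m simp del: atLeastAtMost_iff)
    also have "\<dots> = (\<Sum>k<n. \<Sum>i<m. Q (\<alpha> m k i) (\<beta> m k i) / (n * m))"
      by (simp add: sum.cartesian_product)
    also have "\<dots> = (\<Sum>k<n. Q (p k) (q k) / n + (1 - 1 / (real m)\<^sup>2) * (Q (u k) (v k) / (12 * real n ^ 3)))"
    proof (rule sum.cong[OF refl])
      fix k
      have "Q (\<alpha> m k i) (\<beta> m k i) = Q (p k) (q k) + \<kappa> m i * ((2 * p k * u k + 2 * q k * v k + 2 * r * (p k * v k + q k * u k)) / n)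
          + (\<kappa> m i)\<^sup>2 * (Q (u k) (v k) / (real n)\<^sup>2)" for i
        using n by (simp add: Q_def \<alpha>_def \<beta>_def field_simps power2_eq_square)
      then have "(\<Sum>i<m. Q (\<alpha> m k i) (\<beta> m k i)) = m * Q (p k) (q k) + (\<Sum>i<m. \<kappa> m i) * ((2 * p k * u k + 2 * q k * v k + 2 * r * (p k * v k + q k * u k)) / n)
          + (\<Sum>i<m. (\<kappa> m i)\<^sup>2) * (Q (u k) (v k) / (real n)\<^sup>2)"
        by (simp only: sum.distrib sum_distrib_right sum_constant card_lessThan)
      also have "\<dots> = m * Q (p k) (q k) + (real m / 12 - 1 / (12 * real m)) * (Q (u k) (v k) / (real n)\<^sup>2)"
        unfolding \<kappa>_def trapezoid_weights_sum[OF m] by simp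
      finally have "(\<Sum>i<m. Q (\<alpha> m k i) (\<beta> m k i)) = \<dots>" .
      then have "(\<Sum>i<m. Q (\<alpha> m k i) (\<beta> m k i) / (n * m)) = (m * Q (p k) (q k) + (real m / 12 - 1 / (12 * real m)) * (Q (u k) (v k) / (real n)\<^sup>2)) / (n * m)"
        by (simp add: sum_divide_distrib[symmetric])
      also have "\<dots> = Q (p k) (q k) / n + (1 - 1 / (real m)\<^sup>2) * (Q (u k) (v k) / (12 * real n ^ 3))"
        using m n by (simp add: field_simps power2_eq_square power3_eq_cube)
      finally show "(\<Sum>i<m. Q (\<alpha> m k i) (\<beta> m k i) / (n * m)) = \<dots>" .
    qed
    finally show ?thesis .
  qed
  have path: "(\<lambda>m. (\<Sum>i<m. (a + b * \<kappa> m i / n) * (f (t m k (Suc i)) - f (t m k i))))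
      \<longlonglongrightarrow> a * (f ((real k + 1) / n) - f (k / n)) + b * bridge_integral n f k"
    if f: "continuous_on {0..1} f" and k: "k < n" for f :: "real \<Rightarrow> real" and k a b
  proof -
    have len: "(real k + 1) / n - k / n = 1 / n" by (simp add: diff_divide_distrib[symmetric])
    have pt: "k / n + 1 / n * (j / m) = t m k j" for j m :: nat
      by (simp add: t_def add_divide_distrib)
    have R: "(\<lambda>m. 1 / n / real m * (\<Sum>j<m. f (t m k j))) \<longlonglongrightarrow> integral {real k / n..(real k + 1) / n} f"
      using riemann_sum_tendsto[OF continuous_on_subset[OF f block_subset[OF k]]]
      unfolding len pt by (simp add: divide_right_mono)
    have "(\<lambda>m. (f ((real k + 1) / n) - f (k / n)) / (2 * real n * real m)) \<longlonglongrightarrow> 0"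
      using n by real_asymp
    from tendsto_add[OF R this] have "(\<lambda>m. a * (f ((real k + 1) / n) - f (k / n)) + b * ((1 / n / real m * (\<Sum>j<m. f (t m k j))
         + (f ((real k + 1) / n) - f (k / n)) / (2 * real n * real m)) - (f (k / n) + f ((real k + 1) / n)) / (2 * real n)))
      \<longlonglongrightarrow> a * (f ((real k + 1) / n) - f (k / n)) + b * bridge_integral n f k"
      unfolding bridge_integral_def by (intro tendsto_intros) auto
    moreover have "\<forall>\<^sub>F m in sequentially. a * (f ((real k + 1) / n) - f (k / n)) + b * ((1 / n / real m * (\<Sum>j<m. f (t m k j))
         + (f ((real k + 1) / n) - f (k / n)) / (2 * real n * real m)) - (f (k / n) + f ((real k + 1) / n)) / (2 * real n))
      = (\<Sum>i<m. (a + b * \<kappa> m i / n) * (f (t m k (Suc i)) - f (t m k i)))"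
    proof (rule eventually_sequentiallyI[of 1])
      fix m :: nat assume m: "1 \<le> m"
      have t0: "t m k 0 = k / n" and tm: "t m k m = (real k + 1) / n" using m by (auto simp: t_def)
      have "(\<Sum>i<m. (a + b * \<kappa> m i / n) * (f (t m k (Suc i)) - f (t m k i)))
        = a * (\<Sum>i<m. f (t m k (Suc i)) - f (t m k i)) + b / n * (\<Sum>i<m. \<kappa> m i * (f (t m k (Suc i)) - f (t m k i)))"
        unfolding sum_distrib_left sum.distrib[symmetric] by (intro sum.cong) (auto simp: algebra_simps)
      also have "\<dots> = a * (f (t m k m) - f (t m k 0)) + b / n * ((\<Sum>j<m. f (t m k j)) / m
          + (f (t m k m) - f (t m k 0)) / (2 * real m) - (f (t m k 0) + f (t m k m)) / 2)"
        unfolding \<kappa>_def summation_by_parts_trapezoid[OF m, of "\<lambda>i. f (t m k i)"]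
        using sum_lessThan_telescope[of "\<lambda>i. f (t m k i)" m] by simp
      finally have eq: "(\<Sum>i<m. (a + b * \<kappa> m i / n) * (f (t m k (Suc i)) - f (t m k i)))
        = a * (f (t m k m) - f (t m k 0)) + b / n * ((\<Sum>j<m. f (t m k j)) / m
          + (f (t m k m) - f (t m k 0)) / (2 * real m) - (f (t m k 0) + f (t m k m)) / 2)" .
      show "a * (f ((real k + 1) / n) - f (k / n)) + b * ((1 / n / real m * (\<Sum>j<m. f (t m k j))
         + (f ((real k + 1) / n) - f (k / n)) / (2 * real n * real m)) - (f (k / n) + f ((real k + 1) / n)) / (2 * real n))
      = (\<Sum>i<m. (a + b * \<kappa> m i / n) * (f (t m k (Suc i)) - f (t m k i)))"
        unfolding eq t0 tm using m n by (simp add: field_simps)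
    qed
    ultimately show ?thesis by (rule Lim_transform_eventually)
  qed
  have Ztends: "(\<lambda>m. Z m \<omega>) \<longlonglongrightarrow> Zlim \<omega>" if "\<omega> \<in> space M" for \<omega>
  proof -
    have "(\<lambda>m. \<Sum>k<n. (\<Sum>i<m. \<alpha> m k i * dX (t m k i) (t m k (Suc i)) \<omega>) + (\<Sum>i<m. \<beta> m k i * dY (t m k i) (t m k (Suc i)) \<omega>))
      \<longlonglongrightarrow> (\<Sum>k<n. (p k * dX (k / n) ((real k + 1) / n) \<omega> + u k * bridge_integral n (X \<omega>) k)
          + (q k * dY (k / n) ((real k + 1) / n) \<omega> + v k * bridge_integral n (Y \<omega>) k))"
      unfolding \<alpha>_def \<beta>_def using contX[OF that] contY[OF that] by (intro tendsto_sum tendsto_add path) auto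
    then show ?thesis
      by (simp add: Z_def Zlim_def sum.cartesian_product[symmetric] sum.distrib add_ac)
  qed
  have [measurable]: "Z m \<in> borel_measurable M" for m using Zmem by (rule measurable_mem)
  have [measurable]: "Zlim \<in> borel_measurable M"
    by (rule borel_measurable_LIMSEQ_real[OF Ztends]) measurable
  have "(\<lambda>m. CLINT \<omega>|M. iexp (Z m \<omega>)) \<longlonglongrightarrow> (CLINT \<omega>|M. iexp (Zlim \<omega>))"
    by (rule integral_dominated_convergence[where w = "\<lambda>_. 1"]) (auto intro!: tendsto_intros Ztends)
  moreover have "(\<lambda>m. CLINT \<omega>|M. iexp (Z m \<omega>)) \<longlonglongrightarrow> exp (- (\<Sum>k<n. Q (p k) (q k) / n + (1 - 0) * (Q (u k) (v k) / (12 * real n ^ 3))) / 2)"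
  proof (rule Lim_transform_eventually)
    show "\<forall>\<^sub>F m in sequentially. complex_of_real (exp (- (\<Sum>k<n. Q (p k) (q k) / n + (1 - 1 / (real m)\<^sup>2) * (Q (u k) (v k) / (12 * real n ^ 3))) / 2))
        = (CLINT \<omega>|M. iexp (Z m \<omega>))"
      by (rule eventually_sequentiallyI[of 1]) (simp add: expectation_iexp_mem[OF Zmem] Zvar)
    have "(\<lambda>m. 1 / (real m)\<^sup>2) \<longlonglongrightarrow> 0" by real_asymp
    then show "(\<lambda>m. complex_of_real (exp (- (\<Sum>k<n. Q (p k) (q k) / n + (1 - 1 / (real m)\<^sup>2) * (Q (u k) (v k) / (12 * real n ^ 3))) / 2)))
      \<longlonglongrightarrow> exp (- (\<Sum>k<n. Q (p k) (q k) / n + (1 - 0) * (Q (u k) (v k) / (12 * real n ^ 3))) / 2)"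
      by (intro tendsto_intros) auto
  qed
  ultimately show ?thesis
    unfolding Zlim_def[symmetric] using LIMSEQ_unique by fastforce
qed

end

section \<open>Convergence in probability\<close>

definition null_in_prob :: "'a measure \<Rightarrow> (nat \<Rightarrow> 'a \<Rightarrow> real) \<Rightarrow> bool"
  where "null_in_prob M X \<longleftrightarrow> (\<forall>n. X n \<in> borel_measurable M) \<and>
    (\<forall>e>0. (\<lambda>n. measure M {\<omega>\<in>space M. e < \<bar>X n \<omega>\<bar>}) \<longlonglongrightarrow> 0)"

definition tight_in_prob :: "'a measure \<Rightarrow> (nat \<Rightarrow> 'a \<Rightarrow> real) \<Rightarrow> bool"
  where "tight_in_prob M X \<longleftrightarrow> (\<forall>n. X n \<in> borel_measurable M) \<and>
    (\<forall>e>0. \<exists>K>0. \<forall>\<^sub>F n in sequentially. measure M {\<omega>\<in>space M. K < \<bar>X n \<omega>\<bar>} \<le> e)"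

context prob_space begin

lemma null_in_probI:
  assumes "\<And>n. X n \<in> borel_measurable M"
    and "\<And>e d. 0 < e \<Longrightarrow> 0 < d \<Longrightarrow> \<forall>\<^sub>F n in sequentially. prob {\<omega>\<in>space M. e < \<bar>X n \<omega>\<bar>} \<le> d"
  shows "null_in_prob M X"
  unfolding null_in_prob_def
proof (intro conjI allI impI assms(1))
  fix e :: real assume "0 < e"
  show "(\<lambda>n. prob {\<omega>\<in>space M. e < \<bar>X n \<omega>\<bar>}) \<longlonglongrightarrow> 0"
    unfolding tendsto_iff
  proof (intro allI impI)
    fix d :: real assume "0 < d"
    then show "\<forall>\<^sub>F n in sequentially. dist (prob {\<omega>\<in>space M. e < \<bar>X n \<omega>\<bar>}) 0 < d"
      using assms(2)[OF \<open>0 < e\<close>, of "d / 2"] by (auto elim!: eventually_mono)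
  qed
qed

lemma null_in_probD:
  assumes "null_in_prob M X" "0 < e" "0 < d"
  shows "\<forall>\<^sub>F n in sequentially. prob {\<omega>\<in>space M. e < \<bar>X n \<omega>\<bar>} \<le> d"
proof -
  have "(\<lambda>n. prob {\<omega>\<in>space M. e < \<bar>X n \<omega>\<bar>}) \<longlonglongrightarrow> 0" using assms by (simp add: null_in_prob_def)
  then have "\<forall>\<^sub>F n in sequentially. prob {\<omega>\<in>space M. e < \<bar>X n \<omega>\<bar>} < d"
    using \<open>0 < d\<close> by (rule order_tendstoD)
  then show ?thesis by (auto elim!: eventually_mono)
qed

lemma null_in_prob_measurable: "null_in_prob M X \<Longrightarrow> X n \<in> borel_measurable M"
  by (simp add: null_in_prob_def)

lemma tight_in_prob_measurable: "tight_in_prob M X \<Longrightarrow> X n \<in> borel_measurable M"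
  by (simp add: tight_in_prob_def)

lemma prob_union_bound:
  assumes "AE \<omega> in M. \<omega> \<in> C \<longrightarrow> \<omega> \<in> S \<or> \<omega> \<in> T" "S \<in> events" "T \<in> events" "prob S \<le> a" "prob T \<le> b"
  shows "prob C \<le> a + b"
proof -
  have "prob C \<le> prob (S \<union> T)"
    using assms(1-3) by (intro finite_measure_mono_AE) auto
  also have "\<dots> \<le> prob S + prob T" using assms(2,3) by (rule measure_Un_le)
  also have "\<dots> \<le> a + b" using assms(4,5) by (rule add_mono)
  finally show ?thesis .
qed

lemma null_in_prob_AE:
  assumes X[measurable]: "\<And>n. X n \<in> borel_measurable M" and lim: "AE \<omega> in M. (\<lambda>n. X n \<omega>) \<longlonglongrightarrow> 0"
  shows "null_in_prob M X"
  unfolding null_in_prob_def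
proof (intro conjI allI impI X)
  fix e :: real assume e: "0 < e"
  have "(\<lambda>n. \<integral>\<omega>. indicator {\<omega>\<in>space M. e < \<bar>X n \<omega>\<bar>} \<omega> \<partial>M) \<longlonglongrightarrow> (\<integral>\<omega>. (0::real) \<partial>M)"
  proof (rule integral_dominated_convergence[where w = "\<lambda>_. 1"])
    show "AE \<omega> in M. (\<lambda>n. indicat_real {\<omega>\<in>space M. e < \<bar>X n \<omega>\<bar>} \<omega>) \<longlonglongrightarrow> 0"
      using lim
    proof eventually_elim
      case (elim \<omega>)
      have "\<forall>\<^sub>F n in sequentially. \<bar>X n \<omega>\<bar> < e"
        using tendstoD[OF elim e] by (simp add: dist_real_def)
      then show ?case
        by (intro tendsto_eventually) (auto elim!: eventually_mono simp: indicator_def)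
    qed
  qed (auto simp: indicator_def)
  then show "(\<lambda>n. prob {\<omega>\<in>space M. e < \<bar>X n \<omega>\<bar>}) \<longlonglongrightarrow> 0" by simp
qed

lemma null_in_prob_L1:
  assumes X[measurable]: "\<And>n. X n \<in> borel_measurable M"
    and b: "\<And>n. n \<ge> 1 \<Longrightarrow> (\<integral>\<^sup>+\<omega>. ennreal \<bar>X n \<omega>\<bar> \<partial>M) \<le> ennreal (b n)" and lim: "b \<longlonglongrightarrow> 0"
  shows "null_in_prob M X"
proof (rule null_in_probI[OF X])
  fix e d :: real assume e: "0 < e" and d: "0 < d"
  have "\<forall>\<^sub>F n in sequentially. b n < d * e" using lim e d by (intro order_tendstoD) auto
  then show "\<forall>\<^sub>F n in sequentially. prob {\<omega>\<in>space M. e < \<bar>X n \<omega>\<bar>} \<le> d"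
    using eventually_ge_at_top[of 1]
  proof eventually_elim
    case (elim n)
    have "emeasure M {\<omega>\<in>space M. e < \<bar>X n \<omega>\<bar>} \<le> emeasure M {\<omega>\<in>space M. 1 \<le> ennreal (1 / e) * ennreal \<bar>X n \<omega>\<bar>}"
      using e by (intro emeasure_mono) (auto simp: ennreal_mult[symmetric] ennreal_1[symmetric] divide_simps simp del: ennreal_1)
    also have "\<dots> \<le> ennreal (1 / e) * (\<integral>\<^sup>+\<omega>. ennreal \<bar>X n \<omega>\<bar> * indicator (space M) \<omega> \<partial>M)"
      by (rule nn_integral_Markov_inequality) auto
    also have "(\<integral>\<^sup>+\<omega>. ennreal \<bar>X n \<omega>\<bar> * indicator (space M) \<omega> \<partial>M) = (\<integral>\<^sup>+\<omega>. ennreal \<bar>X n \<omega>\<bar> \<partial>M)"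
      by (intro nn_integral_cong) (auto simp: indicator_def)
    also have "ennreal (1 / e) * (\<integral>\<^sup>+\<omega>. ennreal \<bar>X n \<omega>\<bar> \<partial>M) \<le> ennreal (1 / e) * ennreal (d * e)"
      using elim b[of n] by (intro mult_left_mono order_trans[OF b]) (auto intro!: ennreal_leI)
    also have "\<dots> = ennreal d" using e d by (simp add: ennreal_mult[symmetric])
    finally show ?case using d by (simp add: emeasure_eq_measure)
  qed
qed

lemma null_in_prob_add:
  assumes X: "null_in_prob M X" and Y: "null_in_prob M Y"
  shows "null_in_prob M (\<lambda>n \<omega>. X n \<omega> + Y n \<omega>)"
proof (rule null_in_probI)
  note [measurable] = null_in_prob_measurable[OF X] null_in_prob_measurable[OF Y]
  show "(\<lambda>\<omega>. X n \<omega> + Y n \<omega>) \<in> borel_measurable M" for n by measurable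
  fix e d :: real assume "0 < e" "0 < d"
  then have "0 < e / 2" "0 < d / 2" by auto
  from null_in_probD[OF X this] null_in_probD[OF Y this]
  show "\<forall>\<^sub>F n in sequentially. prob {\<omega>\<in>space M. e < \<bar>X n \<omega> + Y n \<omega>\<bar>} \<le> d"
  proof eventually_elim
    case (elim n)
    have "prob {\<omega>\<in>space M. e < \<bar>X n \<omega> + Y n \<omega>\<bar>} \<le> d / 2 + d / 2"
      by (rule prob_union_bound[OF _ _ _ elim]) auto
    then show ?case by simp
  qed
qed

lemma tight_in_prob_add:
  assumes X: "tight_in_prob M X" and Y: "tight_in_prob M Y"
  shows "tight_in_prob M (\<lambda>n \<omega>. X n \<omega> + Y n \<omega>)"
  unfolding tight_in_prob_def
proof (intro conjI allI impI)
  note [measurable] = tight_in_prob_measurable[OF X] tight_in_prob_measurable[OF Y]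
  show "(\<lambda>\<omega>. X n \<omega> + Y n \<omega>) \<in> borel_measurable M" for n by measurable
  fix d :: real assume "0 < d"
  then have d: "0 < d / 2" by auto
  obtain K L where K: "K > 0" "\<forall>\<^sub>F n in sequentially. prob {\<omega>\<in>space M. K < \<bar>X n \<omega>\<bar>} \<le> d / 2"
    and L: "L > 0" "\<forall>\<^sub>F n in sequentially. prob {\<omega>\<in>space M. L < \<bar>Y n \<omega>\<bar>} \<le> d / 2"
    using X Y d unfolding tight_in_prob_def by meson
  have "\<forall>\<^sub>F n in sequentially. prob {\<omega>\<in>space M. K + L < \<bar>X n \<omega> + Y n \<omega>\<bar>} \<le> d"
    using K(2) L(2)
  proof eventually_elim
    case (elim n)
    have "prob {\<omega>\<in>space M. K + L < \<bar>X n \<omega> + Y n \<omega>\<bar>} \<le> d / 2 + d / 2"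
      by (rule prob_union_bound[OF _ _ _ elim]) auto
    then show ?case by simp
  qed
  then show "\<exists>K>0. \<forall>\<^sub>F n in sequentially. prob {\<omega>\<in>space M. K < \<bar>X n \<omega> + Y n \<omega>\<bar>} \<le> d"
    using K(1) L(1) by (intro exI[of _ "K + L"]) auto
qed

lemma null_in_prob_mult_tight:
  assumes X: "null_in_prob M X" and Y: "tight_in_prob M Y"
  shows "null_in_prob M (\<lambda>n \<omega>. X n \<omega> * Y n \<omega>)"
proof (rule null_in_probI)
  note [measurable] = null_in_prob_measurable[OF X] tight_in_prob_measurable[OF Y]
  show "(\<lambda>\<omega>. X n \<omega> * Y n \<omega>) \<in> borel_measurable M" for n by measurable
  fix e d :: real assume "0 < e" "0 < d"
  then have d: "0 < d / 2" by auto
  obtain K where K: "K > 0" "\<forall>\<^sub>F n in sequentially. prob {\<omega>\<in>space M. K < \<bar>Y n \<omega>\<bar>} \<le> d / 2"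
    using Y d unfolding tight_in_prob_def by meson
  have "0 < e / K" using K \<open>0 < e\<close> by simp
  from K(2) null_in_probD[OF X this d]
  show "\<forall>\<^sub>F n in sequentially. prob {\<omega>\<in>space M. e < \<bar>X n \<omega> * Y n \<omega>\<bar>} \<le> d"
  proof eventually_elim
    case (elim n)
    have "prob {\<omega>\<in>space M. e < \<bar>X n \<omega> * Y n \<omega>\<bar>} \<le> d / 2 + d / 2"
    proof (rule prob_union_bound[OF _ _ _ elim(2) elim(1)])
      have "\<bar>x\<bar> \<le> e / K \<Longrightarrow> \<bar>y\<bar> \<le> K \<Longrightarrow> \<bar>x * y\<bar> \<le> e" for x y :: real
        using mult_mono[of "\<bar>x\<bar>" "e / K" "\<bar>y\<bar>" K] K by (simp add: abs_mult)
      then show "AE \<omega> in M. \<omega> \<in> {\<omega>\<in>space M. e < \<bar>X n \<omega> * Y n \<omega>\<bar>} \<longrightarrow>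
          \<omega> \<in> {\<omega>\<in>space M. e / K < \<bar>X n \<omega>\<bar>} \<or> \<omega> \<in> {\<omega>\<in>space M. K < \<bar>Y n \<omega>\<bar>}"
        by (force simp: not_less[symmetric])
    qed auto
    then show ?case by simp
  qed
qed

lemma null_in_prob_imp_tight:
  assumes X: "null_in_prob M X" shows "tight_in_prob M X"
  unfolding tight_in_prob_def
proof (intro conjI allI impI null_in_prob_measurable[OF X])
  fix e :: real assume "0 < e"
  then show "\<exists>K>0. \<forall>\<^sub>F n in sequentially. prob {\<omega>\<in>space M. K < \<bar>X n \<omega>\<bar>} \<le> e"
    using null_in_probD[OF X zero_less_one] by (intro exI[of _ 1]) auto
qed

lemma null_in_prob_mono_AE:
  assumes X: "null_in_prob M X" and Y[measurable]: "\<And>n. Y n \<in> borel_measurable M"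
    and le: "\<And>n. n \<ge> 1 \<Longrightarrow> AE \<omega> in M. \<bar>Y n \<omega>\<bar> \<le> \<bar>X n \<omega>\<bar>"
  shows "null_in_prob M Y"
proof (rule null_in_probI[OF Y])
  note [measurable] = null_in_prob_measurable[OF X]
  fix e d :: real assume "0 < e" "0 < d"
  from null_in_probD[OF X this] eventually_ge_at_top[of 1]
  show "\<forall>\<^sub>F n in sequentially. prob {\<omega>\<in>space M. e < \<bar>Y n \<omega>\<bar>} \<le> d"
  proof eventually_elim
    case (elim n)
    have "prob {\<omega>\<in>space M. e < \<bar>Y n \<omega>\<bar>} \<le> prob {\<omega>\<in>space M. e < \<bar>X n \<omega>\<bar>}"
      using le[OF elim(2)] by (intro finite_measure_mono_AE) auto
    then show ?case using elim by simp
  qed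
qed

text \<open>
  One tail function for all \<open>n\<close> suffices, since it vanishes at infinity.
\<close>

lemma tight_in_prob_common_tail:
  assumes X: "\<And>n. X n \<in> borel_measurable M" and N: "prob_space N" and Z: "Z \<in> borel_measurable N"
    and le: "\<And>n K. n \<ge> 1 \<Longrightarrow> prob {\<omega>\<in>space M. K < \<bar>X n \<omega>\<bar>} \<le> measure N {x\<in>space N. K < \<bar>Z x\<bar>}"
  shows "tight_in_prob M X"
  unfolding tight_in_prob_def
proof (intro conjI allI impI X)
  interpret N: prob_space N by fact
  note Z[measurable]
  fix e :: real assume e: "0 < e"
  have "(\<lambda>i. N.prob {x\<in>space N. real i < \<bar>Z x\<bar>}) \<longlonglongrightarrow> N.prob (\<Inter>i. {x\<in>space N. real i < \<bar>Z x\<bar>})"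
    by (rule N.finite_Lim_measure_decseq) (auto simp: decseq_def)
  moreover have "(\<Inter>i. {x\<in>space N. real i < \<bar>Z x\<bar>}) = {}"
  proof -
    have "\<exists>i. \<bar>Z x\<bar> \<le> real i" for x by (rule real_arch_simple)
    then have "\<not> (\<forall>i. real i < \<bar>Z x\<bar>)" for x by (meson not_less)
    then show ?thesis by auto
  qed
  ultimately have "(\<lambda>i. N.prob {x\<in>space N. real i < \<bar>Z x\<bar>}) \<longlonglongrightarrow> 0" by simp
  then have "\<forall>\<^sub>F i in sequentially. N.prob {x\<in>space N. real i < \<bar>Z x\<bar>} < e \<and> i \<ge> 1"
    using e by (intro eventually_conj order_tendstoD eventually_ge_at_top)
  then obtain i :: nat where i: "N.prob {x\<in>space N. real i < \<bar>Z x\<bar>} < e" "i \<ge> 1"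
    using eventually_happens'[OF sequentially_bot] by blast
  then show "\<exists>K>0. \<forall>\<^sub>F n in sequentially. prob {\<omega>\<in>space M. K < \<bar>X n \<omega>\<bar>} \<le> e"
    by (intro exI[of _ "real i"] conjI eventually_sequentiallyI[of 1] order_trans[OF le]) auto
qed

lemma tight_in_prob_const:
  "X \<in> borel_measurable M \<Longrightarrow> tight_in_prob M (\<lambda>n. X)"
  by (rule tight_in_prob_common_tail[of _ M X]) (auto simp: prob_space_axioms)

lemma tight_in_prob_same_law:
  assumes X: "\<And>n. X n \<in> borel_measurable M" and law: "\<And>n. n \<ge> 1 \<Longrightarrow> distr M borel (X n) = L" and L: "prob_space L"
    and sets: "sets L = sets borel"
  shows "tight_in_prob M X"
proof (rule tight_in_prob_common_tail[of _ L "\<lambda>x. x"])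
  note X[measurable]
  show "prob {\<omega> \<in> space M. K < \<bar>X n \<omega>\<bar>} \<le> measure L {x\<in>space L. K < \<bar>x\<bar>}" if "1 \<le> n" for n K
  proof -
    have sp: "space L = UNIV" using sets_eq_imp_space_eq[OF sets] by simp
    have "measure L {x\<in>space L. K < \<bar>x\<bar>} = prob (X n -` {x. K < \<bar>x\<bar>} \<inter> space M)"
      unfolding sp law[OF that, symmetric] by (subst measure_distr) auto
    also have "X n -` {x. K < \<bar>x\<bar>} \<inter> space M = {\<omega> \<in> space M. K < \<bar>X n \<omega>\<bar>}" by auto
    finally show ?thesis by simp
  qed
qed (use assms in \<open>auto cong: measurable_cong_sets\<close>)

end

section \<open>Convergence in distribution on metric spaces\<close>

text \<open>
  The functions \<open>\<psi> k\<close> are the infimal convolutions of \<open>\<phi>\<close> with \<open>k\<close> times the metric. A point \<open>y\<close> at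
  distance at least \<open>d\<close> from \<open>x\<close> cannot lower the infimum below \<open>\<phi> x\<close> once \<open>k d \<ge> 2 C\<close>, and at the points
  closer to \<open>x\<close> the function \<open>\<phi>\<close> is close to \<open>\<phi> x\<close>.
\<close>

lemma bounded_continuous_Lipschitz_approximation:
  fixes \<phi> :: "'b::metric_space \<Rightarrow> real"
  assumes cont: "continuous_on UNIV \<phi>" and bnd: "\<And>x. \<bar>\<phi> x\<bar> \<le> C"
  obtains \<psi> :: "nat \<Rightarrow> 'b \<Rightarrow> real"
  where "\<And>k x. \<psi> k x \<le> \<phi> x" "\<And>k x. \<bar>\<psi> k x\<bar> \<le> C"
    "\<And>k x y. \<bar>\<psi> k x - \<psi> k y\<bar> \<le> real k * dist x y" "\<And>x. (\<lambda>k. \<psi> k x) \<longlonglongrightarrow> \<phi> x"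
proof -
  define \<psi> where "\<psi> k x = (INF y. \<phi> y + real k * dist x y)" for k x
  have C: "-C \<le> \<phi> x" "\<phi> x \<le> C" for x using bnd[of x] by auto
  have bb: "bdd_below (range (\<lambda>y. \<phi> y + real k * dist x y))" for k x
    by (rule bdd_belowI2[of _ "-C"]) (use C in \<open>auto intro: add_increasing2\<close>)
  have le: "\<psi> k x \<le> \<phi> y + real k * dist x y" for k x y
    unfolding \<psi>_def by (rule cINF_lower[OF bb]) simp
  have 1: "\<psi> k x \<le> \<phi> x" for k x using le[of k x x] by simp
  have low: "-C \<le> \<psi> k x" for k x
    unfolding \<psi>_def by (rule cINF_greatest) (use C in \<open>auto intro: add_increasing2\<close>)
  have 2: "\<bar>\<psi> k x\<bar> \<le> C" for k x using 1[of k x] C[of x] low[of k x] by linarith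
  have lip: "\<psi> k x \<le> \<psi> k y + real k * dist x y" for k x y
  proof -
    have "\<psi> k x - real k * dist x y \<le> \<phi> z + real k * dist y z" for z
    proof -
      have "real k * dist x z \<le> real k * (dist x y + dist y z)"
        by (intro mult_left_mono dist_triangle) auto
      then show ?thesis using le[of k x z] by (simp add: distrib_left)
    qed
    then have "\<psi> k x - real k * dist x y \<le> \<psi> k y"
      unfolding \<psi>_def[of k y] by (intro cINF_greatest) auto
    then show ?thesis by simp
  qed
  have 3: "\<bar>\<psi> k x - \<psi> k y\<bar> \<le> real k * dist x y" for k x y
    using lip[of k x y] lip[of k y x] by (simp add: dist_commute abs_le_iff)
  have 4: "(\<lambda>k. \<psi> k x) \<longlonglongrightarrow> \<phi> x" for x
  proof (rule LIMSEQ_I)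
    fix e :: real assume e: "0 < e"
    then have e2: "0 < e / 2" by simp
    have "isCont \<phi> x" using cont by (simp add: continuous_on_eq_continuous_at)
    then obtain d where d: "d > 0" "\<And>y. dist y x < d \<Longrightarrow> dist (\<phi> y) (\<phi> x) < e / 2"
      using e2 unfolding continuous_at_eps_delta by blast
    obtain N where N: "real N > 2 * C / d" using reals_Archimedean2 by blast
    show "\<exists>no. \<forall>k\<ge>no. norm (\<psi> k x - \<phi> x) < e"
    proof (intro exI allI impI)
      fix k assume "k \<ge> N"
      then have "2 * C / d < k" using N by linarith
      then have k: "2 * C \<le> k * d" using d(1) by (simp add: divide_simps)
      have "\<phi> x - e / 2 \<le> \<phi> y + real k * dist x y" for y
      proof (cases "dist y x < d")
        case True
        have "0 \<le> real k * dist x y" by simp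
        then show ?thesis using d(2)[OF True] unfolding dist_real_def by linarith
      next
        case False
        then have "real k * d \<le> real k * dist x y" by (intro mult_left_mono) (auto simp: dist_commute)
        then show ?thesis using k C[of x] C[of y] e by linarith
      qed
      then have "\<phi> x - e / 2 \<le> \<psi> k x" unfolding \<psi>_def by (intro cINF_greatest) auto
      then show "norm (\<psi> k x - \<phi> x) < e" using 1[of k x] e by simp
    qed
  qed
  show ?thesis using that[of \<psi>] 1 2 3 4 by blast
qed

text \<open>
  A version of Slutsky's theorem in which the law of \<open>Xt n\<close> may be realised on another space, where
  it converges almost surely. Two ways of being close are allowed, in probability between \<open>X\<close> and \<open>Xh\<close>
  and almost surely between \<open>Xh\<close> and \<open>Xt\<close>, so that no joint measurability of the last two is needed. For
  Lipschitz test functions the errors are estimated directly; a bounded continuous test function is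
  approximated by Lipschitz ones from below, and so is its negative.
\<close>

theorem converges_in_distribution_transfer:
  fixes X Xh Xt :: "nat \<Rightarrow> 'a \<Rightarrow> 'b::metric_space" and Y :: "nat \<Rightarrow> 'c \<Rightarrow> 'b" and Yl :: "'c \<Rightarrow> 'b"
  assumes M: "prob_space M" and K: "prob_space K"
    and meas[measurable]: "\<And>n. X n \<in> borel_measurable M" "\<And>n. Xh n \<in> borel_measurable M"
      "\<And>n. Xt n \<in> borel_measurable M" "\<And>n. Y n \<in> borel_measurable K" "Yl \<in> borel_measurable K"
    and null: "null_in_prob M \<delta>" and le: "\<And>n \<omega>. \<omega> \<in> space M \<Longrightarrow> dist (X n \<omega>) (Xh n \<omega>) \<le> \<delta> n \<omega>"
    and close: "AE \<omega> in M. (\<lambda>n. dist (Xh n \<omega>) (Xt n \<omega>)) \<longlonglongrightarrow> 0"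
    and law: "\<And>n \<phi>. n \<ge> 1 \<Longrightarrow> continuous_on UNIV \<phi> \<Longrightarrow> bounded (range \<phi>) \<Longrightarrow>
        (\<integral>\<omega>. \<phi> (Xt n \<omega>) \<partial>M) = (\<integral>\<omega>. (\<phi> (Y n \<omega>) :: real) \<partial>K)"
    and lim: "AE \<omega> in K. (\<lambda>n. Y n \<omega>) \<longlonglongrightarrow> Yl \<omega>"
  shows "converges_in_distribution M X K Yl"
proof -
  interpret M: prob_space M by fact
  interpret K: prob_space K by fact
  note [measurable] = M.null_in_prob_measurable[OF null]
  have comp: "(\<lambda>\<omega>. \<phi> (f \<omega>)) \<in> borel_measurable N" if "continuous_on UNIV \<phi>" "f \<in> borel_measurable N"
    for \<phi> :: "'b \<Rightarrow> real" and f and N :: "'d measure"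
    using measurable_compose[OF that(2) borel_measurable_continuous_onI[OF that(1)]] .
  \<comment> \<open>first Lipschitz test functions, for which all errors can be estimated\<close>
  have Lip: "(\<lambda>n. \<integral>\<omega>. \<psi> (X n \<omega>) \<partial>M) \<longlonglongrightarrow> (\<integral>\<omega>. \<psi> (Yl \<omega>) \<partial>K)"
    if bnd: "\<And>x. \<bar>\<psi> x\<bar> \<le> C" and lip: "\<And>x y. \<bar>\<psi> x - \<psi> y\<bar> \<le> L * dist x y" and L: "L \<ge> 0" for \<psi> :: "'b \<Rightarrow> real" and C L
  proof -
    have lc: "L-lipschitz_on UNIV \<psi>"
      by (rule lipschitz_onI) (use lip L in \<open>auto simp: dist_real_def\<close>)
    then have cont: "continuous_on UNIV \<psi>" by (rule lipschitz_on_continuous_on)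
    have C: "0 \<le> C" using bnd[of undefined] by linarith
    have bdd: "bounded (range \<psi>)" using bnd by (auto simp: bounded_iff)
    note [measurable] = comp[OF cont meas(1)] comp[OF cont meas(2)] comp[OF cont meas(3)] comp[OF cont meas(4)] comp[OF cont meas(5)]
    have "(\<lambda>n. \<integral>\<omega>. \<psi> (Y n \<omega>) \<partial>K) \<longlonglongrightarrow> (\<integral>\<omega>. \<psi> (Yl \<omega>) \<partial>K)"
    proof (rule integral_dominated_convergence[where w = "\<lambda>_. C"])
      show "AE \<omega> in K. (\<lambda>n. \<psi> (Y n \<omega>)) \<longlonglongrightarrow> \<psi> (Yl \<omega>)"
        using lim
      proof eventually_elim
        case (elim \<omega>)
        show ?case by (rule continuous_on_tendsto_compose[OF cont elim]) auto
      qed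
    qed (use bnd in auto)
    moreover have "\<forall>\<^sub>F n in sequentially. (\<integral>\<omega>. \<psi> (Y n \<omega>) \<partial>K) = (\<integral>\<omega>. \<psi> (Xt n \<omega>) \<partial>M)"
      by (rule eventually_sequentiallyI[of 1]) (use law[OF _ cont bdd] in auto)
    ultimately have 1: "(\<lambda>n. \<integral>\<omega>. \<psi> (Xt n \<omega>) \<partial>M) \<longlonglongrightarrow> (\<integral>\<omega>. \<psi> (Yl \<omega>) \<partial>K)"
      by (rule Lim_transform_eventually)
    have i: "integrable M (\<lambda>\<omega>. \<psi> (X n \<omega>))" "integrable M (\<lambda>\<omega>. \<psi> (Xh n \<omega>))" "integrable M (\<lambda>\<omega>. \<psi> (Xt n \<omega>))" for n
      using bnd by (auto intro!: M.integrable_const_bound[of _ C])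
    have "(\<lambda>n. \<integral>\<omega>. \<psi> (Xh n \<omega>) - \<psi> (Xt n \<omega>) \<partial>M) \<longlonglongrightarrow> (\<integral>\<omega>. 0 \<partial>M)"
    proof (rule integral_dominated_convergence[where w = "\<lambda>_. 2 * C"])
      show "AE \<omega> in M. (\<lambda>n. \<psi> (Xh n \<omega>) - \<psi> (Xt n \<omega>)) \<longlonglongrightarrow> 0"
        using close
      proof eventually_elim
        case (elim \<omega>)
        show ?case
        proof (rule Lim_null_comparison)
          show "\<forall>\<^sub>F n in sequentially. norm (\<psi> (Xh n \<omega>) - \<psi> (Xt n \<omega>)) \<le> L * dist (Xh n \<omega>) (Xt n \<omega>)"
            using lip by simp
          show "(\<lambda>n. L * dist (Xh n \<omega>) (Xt n \<omega>)) \<longlonglongrightarrow> 0" using tendsto_mult_right_zero[OF elim] by simp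
        qed
      qed
      have "\<bar>\<psi> x - \<psi> y\<bar> \<le> 2 * C" for x y using bnd[of x] bnd[of y] by linarith
      then show "AE \<omega> in M. norm (\<psi> (Xh n \<omega>) - \<psi> (Xt n \<omega>)) \<le> 2 * C" for n by simp
    qed auto
    then have 2: "(\<lambda>n. (\<integral>\<omega>. \<psi> (Xh n \<omega>) \<partial>M) - (\<integral>\<omega>. \<psi> (Xt n \<omega>) \<partial>M)) \<longlonglongrightarrow> 0"
      using i by simp
    have 3: "(\<lambda>n. (\<integral>\<omega>. \<psi> (X n \<omega>) \<partial>M) - (\<integral>\<omega>. \<psi> (Xh n \<omega>) \<partial>M)) \<longlonglongrightarrow> 0"
      unfolding tendsto_iff
    proof (intro allI impI)
      fix e :: real assume e: "0 < e"
      define a where "a = e / (3 * (L + 1))"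
      define d where "d = e / (6 * (C + 1))"
      have ad: "0 < a" "0 < d" using e L C by (auto simp: a_def d_def)
      have "L * a \<le> e / 3" using L e by (simp add: a_def field_simps)
      have "2 * C * d \<le> e / 3" using C e by (simp add: d_def field_simps)
      show "\<forall>\<^sub>F n in sequentially. dist ((\<integral>\<omega>. \<psi> (X n \<omega>) \<partial>M) - (\<integral>\<omega>. \<psi> (Xh n \<omega>) \<partial>M)) 0 < e"
        using M.null_in_probD[OF null ad]
      proof eventually_elim
        case (elim n)
        define B where "B = {\<omega>\<in>space M. a < \<bar>\<delta> n \<omega>\<bar>}"
        have [measurable]: "B \<in> sets M" unfolding B_def by measurable
        have iB': "integrable M (indicat_real B)"
          by (rule integrable_real_indicator) (auto simp: M.emeasure_eq_measure)
        then have iB: "integrable M (\<lambda>\<omega>. L * a + 2 * C * indicat_real B \<omega>)" by simp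
        have "\<bar>(\<integral>\<omega>. \<psi> (X n \<omega>) \<partial>M) - (\<integral>\<omega>. \<psi> (Xh n \<omega>) \<partial>M)\<bar> = \<bar>\<integral>\<omega>. \<psi> (X n \<omega>) - \<psi> (Xh n \<omega>) \<partial>M\<bar>"
          using i by simp
        also have "\<dots> \<le> (\<integral>\<omega>. \<bar>\<psi> (X n \<omega>) - \<psi> (Xh n \<omega>)\<bar> \<partial>M)"
          by (rule integral_abs_bound)
        also have "\<dots> \<le> (\<integral>\<omega>. L * a + 2 * C * indicator B \<omega> \<partial>M)"
        proof (rule integral_mono)
          fix \<omega> assume \<omega>: "\<omega> \<in> space M"
          show "\<bar>\<psi> (X n \<omega>) - \<psi> (Xh n \<omega>)\<bar> \<le> L * a + 2 * C * indicator B \<omega>"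
          proof (cases "\<omega> \<in> B")
            case True
            have "0 \<le> L * a" using L ad by simp
            then show ?thesis using True bnd[of "X n \<omega>"] bnd[of "Xh n \<omega>"] by simp
          next
            case False
            then have "dist (X n \<omega>) (Xh n \<omega>) \<le> a" using le[OF \<omega>, of n] \<omega> by (auto simp: B_def)
            then have "L * dist (X n \<omega>) (Xh n \<omega>) \<le> L * a" using L by (rule mult_left_mono)
            then show ?thesis using False lip[of "X n \<omega>" "Xh n \<omega>"] by simp
          qed
        qed (use i iB in \<open>auto intro!: Bochner_Integration.integrable_diff integrable_abs\<close>)
        also have "\<dots> = L * a + 2 * C * M.prob B" using iB' by (simp add: M.prob_space)
        also have "\<dots> \<le> L * a + 2 * C * d"
          using elim C by (auto simp: B_def intro!: mult_left_mono)
        also have "\<dots> < e" using \<open>L * a \<le> e / 3\<close> \<open>2 * C * d \<le> e / 3\<close> e by linarith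
        finally show ?case by (simp add: dist_real_def)
      qed
    qed
    from tendsto_add[OF tendsto_add[OF 3 2] 1] show ?thesis by simp
  qed
  \<comment> \<open>then lower bounds for bounded continuous test functions, through Lipschitz minorants\<close>
  have low: "\<forall>\<^sub>F n in sequentially. (\<integral>\<omega>. \<phi> (Yl \<omega>) \<partial>K) - e < (\<integral>\<omega>. \<phi> (X n \<omega>) \<partial>M)"
    if cont: "continuous_on UNIV \<phi>" and bnd: "\<And>x. \<bar>\<phi> x\<bar> \<le> C" and e: "0 < e" for \<phi> :: "'b \<Rightarrow> real" and C e
  proof -
    obtain \<psi> :: "nat \<Rightarrow> 'b \<Rightarrow> real" where \<psi>: "\<And>k x. \<psi> k x \<le> \<phi> x" "\<And>k x. \<bar>\<psi> k x\<bar> \<le> C"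
      "\<And>k x y. \<bar>\<psi> k x - \<psi> k y\<bar> \<le> real k * dist x y" "\<And>x. (\<lambda>k. \<psi> k x) \<longlonglongrightarrow> \<phi> x"
      using bounded_continuous_Lipschitz_approximation[OF cont bnd] by metis
    have lc: "(real k)-lipschitz_on UNIV (\<psi> k)" for k
      by (rule lipschitz_onI) (use \<psi>(3) in \<open>auto simp: dist_real_def\<close>)
    then have c: "continuous_on UNIV (\<psi> k)" for k by (rule lipschitz_on_continuous_on)
    note [measurable] = comp[OF cont meas(5)] comp[OF c meas(5)] comp[OF cont meas(1)] comp[OF c meas(1)]
    have "(\<lambda>k. \<integral>\<omega>. \<psi> k (Yl \<omega>) \<partial>K) \<longlonglongrightarrow> (\<integral>\<omega>. \<phi> (Yl \<omega>) \<partial>K)"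
      by (rule integral_dominated_convergence[where w = "\<lambda>_. C"]) (use \<psi> in auto)
    then have "\<forall>\<^sub>F k in sequentially. (\<integral>\<omega>. \<phi> (Yl \<omega>) \<partial>K) - e < (\<integral>\<omega>. \<psi> k (Yl \<omega>) \<partial>K)"
      by (rule order_tendstoD) (use e in auto)
    then obtain k where k: "(\<integral>\<omega>. \<phi> (Yl \<omega>) \<partial>K) - e < (\<integral>\<omega>. \<psi> k (Yl \<omega>) \<partial>K)"
      using eventually_happens'[OF sequentially_bot] by blast
    have "\<forall>\<^sub>F n in sequentially. (\<integral>\<omega>. \<phi> (Yl \<omega>) \<partial>K) - e < (\<integral>\<omega>. \<psi> k (X n \<omega>) \<partial>M)"
      by (rule order_tendstoD(1)[OF Lip[OF \<psi>(2) \<psi>(3) of_nat_0_le_iff] k])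
    then show ?thesis
    proof eventually_elim
      case (elim n)
      also have "(\<integral>\<omega>. \<psi> k (X n \<omega>) \<partial>M) \<le> (\<integral>\<omega>. \<phi> (X n \<omega>) \<partial>M)"
        using \<psi> bnd by (intro integral_mono M.integrable_const_bound[of _ C]) auto
      finally show ?case .
    qed
  qed
  show ?thesis
    unfolding converges_in_distribution_def
  proof (intro conjI allI impI meas, elim conjE)
    fix \<phi> :: "'b \<Rightarrow> real" assume cont: "continuous_on UNIV \<phi>" and "bounded (range \<phi>)"
    then obtain C where bnd: "\<And>x. \<bar>\<phi> x\<bar> \<le> C" by (auto simp: bounded_iff)
    show "(\<lambda>n. \<integral>\<omega>. \<phi> (X n \<omega>) \<partial>M) \<longlonglongrightarrow> (\<integral>\<omega>. \<phi> (Yl \<omega>) \<partial>K)"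
      unfolding tendsto_iff
    proof (intro allI impI)
      fix e :: real assume e: "0 < e"
      have "continuous_on UNIV (\<lambda>x. - \<phi> x)" "\<And>x. \<bar>- \<phi> x\<bar> \<le> C" using cont bnd by (auto intro: continuous_intros)
      from low[OF cont bnd e] low[OF this e]
      show "\<forall>\<^sub>F n in sequentially. dist (\<integral>\<omega>. \<phi> (X n \<omega>) \<partial>M) (\<integral>\<omega>. \<phi> (Yl \<omega>) \<partial>K) < e"
        by eventually_elim (simp add: dist_real_def abs_less_iff)
    qed
  qed
qed

section \<open>Random elements of the space of continuous functions\<close>

definition from_C01 :: "C01 \<Rightarrow> real \<Rightarrow> real"
  where "from_C01 h t = apply_bcontfun h (ui_of_real t)"

lemma real_of_ui_mem: "real_of_ui s \<in> {0..1}"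
  using real_of_ui by blast

lemma from_C01_to_C01:
  assumes "continuous_on {0..1} f" "t \<in> {0..1}"
  shows "from_C01 (to_C01 f) t = f t"
  using assms by (simp add: from_C01_def to_C01_apply ui_of_real_inverse)

lemma continuous_on_from_C01: "continuous_on {0..1} (from_C01 h)"
proof -
  have "continuous_on {0..1} ui_of_real"
    unfolding continuous_on_iff by (auto simp: dist_unit_interval_def ui_of_real_inverse)
  then show ?thesis
    unfolding from_C01_def
    by (rule continuous_on_compose2[where t = UNIV, OF continuous_on_apply_bcontfun]) auto
qed

lemma continuous_on_from_C01_eval: "continuous_on UNIV (\<lambda>h. from_C01 h t)"
  unfolding continuous_on_iff from_C01_def
  by (metis dist_fun_lt_imp_dist_val_lt)

text \<open>
  Bernstein polynomials recover a path from its values at the grid points and depend continuously on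
  finitely many real numbers. They serve as approximation of a path by its skeleton, and they make
  paths measurable as elements of \<open>C([0,1])\<close>.
\<close>

definition bernstein_path :: "nat \<Rightarrow> (nat \<Rightarrow> real) \<Rightarrow> C01"
  where "bernstein_path n y = to_C01 (\<lambda>t. \<Sum>k\<le>n. y k * Bernstein n k t)"

lemma continuous_on_Bernstein_sum: "continuous_on S (\<lambda>t. \<Sum>k\<le>n. y k * Bernstein n k t)"
  unfolding Bernstein_def by (intro continuous_intros)

lemma to_C01_dist_le:
  assumes "continuous_on {0..1} f" "continuous_on {0..1} g" "\<And>t. t \<in> {0..1} \<Longrightarrow> \<bar>f t - g t\<bar> \<le> b"
  shows "dist (to_C01 f) (to_C01 g) \<le> b"
  by (rule dist_bound) (use assms real_of_ui_mem in \<open>auto simp: to_C01_apply dist_real_def\<close>)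

lemma continuous_bernstein_path: "continuous_on UNIV (bernstein_path n)"
  unfolding continuous_on_def
proof
  fix y :: "nat \<Rightarrow> real"
  have Bb: "Bernstein n k t \<le> 1" "0 \<le> Bernstein n k t" if "t \<in> {0..1}" "k \<le> n" for k t
  proof -
    show nn: "0 \<le> Bernstein n k t" for k using that by (simp add: Bernstein_nonneg)
    have "Bernstein n k t \<le> (\<Sum>k\<le>n. Bernstein n k t)" using that nn by (intro member_le_sum) auto
    then show "Bernstein n k t \<le> 1" by simp
  qed
  have "((\<lambda>z. dist (bernstein_path n z) (bernstein_path n y)) \<longlongrightarrow> 0) (at y)"
  proof (rule Lim_null_comparison)
    show "\<forall>\<^sub>F z in at y. norm (dist (bernstein_path n z) (bernstein_path n y)) \<le> (\<Sum>k\<le>n. \<bar>z k - y k\<bar>)"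
    proof (rule always_eventually, rule allI)
      fix z :: "nat \<Rightarrow> real"
      have "dist (bernstein_path n z) (bernstein_path n y) \<le> (\<Sum>k\<le>n. \<bar>z k - y k\<bar>)"
        unfolding bernstein_path_def
      proof (rule to_C01_dist_le[OF continuous_on_Bernstein_sum continuous_on_Bernstein_sum])
        fix t :: real assume t: "t \<in> {0..1}"
        have "\<bar>(\<Sum>k\<le>n. z k * Bernstein n k t) - (\<Sum>k\<le>n. y k * Bernstein n k t)\<bar> = \<bar>\<Sum>k\<le>n. (z k - y k) * Bernstein n k t\<bar>"
          by (simp add: sum_subtractf algebra_simps)
        also have "\<dots> \<le> (\<Sum>k\<le>n. \<bar>(z k - y k) * Bernstein n k t\<bar>)" by (rule sum_abs)
        also have "\<dots> \<le> (\<Sum>k\<le>n. \<bar>z k - y k\<bar>)"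
          using Bb[OF t] by (intro sum_mono) (auto simp: abs_mult intro!: mult_left_le)
        finally show "\<bar>(\<Sum>k\<le>n. z k * Bernstein n k t) - (\<Sum>k\<le>n. y k * Bernstein n k t)\<bar> \<le> (\<Sum>k\<le>n. \<bar>z k - y k\<bar>)" .
      qed
      then show "norm (dist (bernstein_path n z) (bernstein_path n y)) \<le> (\<Sum>k\<le>n. \<bar>z k - y k\<bar>)" by simp
    qed
    have coord: "((\<lambda>z. z k) \<longlongrightarrow> y k) (at y)" for k
    proof -
      have "continuous_on UNIV (\<lambda>z :: nat \<Rightarrow> real. z k)" by (rule continuous_on_product_coordinates)
      then show ?thesis unfolding continuous_on_def by auto
    qed
    have "((\<lambda>z. \<Sum>k\<le>n. \<bar>z k - y k\<bar>) \<longlongrightarrow> (\<Sum>k\<le>n. \<bar>y k - y k\<bar>)) (at y)"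
      by (intro tendsto_intros coord)
    then show "((\<lambda>z. \<Sum>k\<le>n. \<bar>z k - y k\<bar>) \<longlongrightarrow> 0) (at y)" by simp
  qed
  then show "(bernstein_path n \<longlongrightarrow> bernstein_path n y) (at y within UNIV)"
    by (simp add: tendsto_dist_iff[of "bernstein_path n"])
qed

lemma bernstein_path_tendsto:
  assumes f: "continuous_on {0..1} f" and y: "\<And>n k. n \<ge> 1 \<Longrightarrow> k \<le> n \<Longrightarrow> y n k = f (real k / real n)"
  shows "(\<lambda>n. bernstein_path n (y n)) \<longlonglongrightarrow> to_C01 f"
proof (rule metric_LIMSEQ_I)
  fix e :: real assume e: "0 < e"
  then have "0 < e / 2" by simp
  from Bernstein_Weierstrass[OF f this] obtain N where
    N: "\<And>n x. N \<le> n \<Longrightarrow> x \<in> {0..1} \<Longrightarrow> \<bar>f x - (\<Sum>k\<le>n. f (k / n) * Bernstein n k x)\<bar> < e / 2" by blast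
  show "\<exists>no. \<forall>n\<ge>no. dist (bernstein_path n (y n)) (to_C01 f) < e"
  proof (intro exI allI impI)
    fix n assume n: "max 1 N \<le> n"
    have "(\<Sum>k\<le>n. y n k * Bernstein n k t) = (\<Sum>k\<le>n. f (k / n) * Bernstein n k t)" for t
      using n y by (intro sum.cong) auto
    then have "dist (bernstein_path n (y n)) (to_C01 f) \<le> e / 2"
      unfolding bernstein_path_def using n N
      by (intro to_C01_dist_le continuous_on_Bernstein_sum f) (auto simp: abs_minus_commute intro: less_imp_le)
    then show "dist (bernstein_path n (y n)) (to_C01 f) < e" using e by simp
  qed
qed

lemma measurable_pair_bernstein_path:
  fixes V :: "'a \<Rightarrow> 'e::{second_countable_topology, metric_space}"
  assumes V: "V \<in> borel_measurable M" and y: "\<And>k. (\<lambda>\<omega>. y \<omega> k) \<in> borel_measurable M" and z: "\<And>k. (\<lambda>\<omega>. z \<omega> k) \<in> borel_measurable M"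
  shows "(\<lambda>\<omega>. (V \<omega>, bernstein_path n (y \<omega>), bernstein_path n (z \<omega>))) \<in> borel_measurable M"
proof -
  have [measurable]: "y \<in> borel_measurable M" "z \<in> borel_measurable M"
    using y z by (auto intro: measurable_coordinatewise_then_product)
  have m: "(\<lambda>\<omega>. (V \<omega>, y \<omega>, z \<omega>)) \<in> borel_measurable M"
    using V by (intro borel_measurable_Pair) auto
  have "continuous_on UNIV (\<lambda>p :: 'e \<times> (nat \<Rightarrow> real) \<times> (nat \<Rightarrow> real). (fst p, bernstein_path n (fst (snd p)), bernstein_path n (snd (snd p))))"
    by (intro continuous_on_Pair continuous_intros continuous_on_compose2[OF continuous_bernstein_path]) auto
  from measurable_compose[OF m borel_measurable_continuous_onI[OF this]] show ?thesis by simp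
qed

text \<open>
  The triple is a pointwise limit of triples of Bernstein polynomials; these are continuous images of
  random elements of a space with countable base, on which measurability is coordinatewise.
\<close>

lemma measurable_pair_to_C01:
  fixes V :: "'a \<Rightarrow> 'e::{second_countable_topology, metric_space}"
  assumes V: "V \<in> borel_measurable M"
    and X: "\<And>t. t \<in> {0..1} \<Longrightarrow> (\<lambda>\<omega>. X \<omega> t) \<in> borel_measurable M" and cX: "\<And>\<omega>. \<omega> \<in> space M \<Longrightarrow> continuous_on {0..1} (X \<omega>)"
    and Y: "\<And>t. t \<in> {0..1} \<Longrightarrow> (\<lambda>\<omega>. Y \<omega> t) \<in> borel_measurable M" and cY: "\<And>\<omega>. \<omega> \<in> space M \<Longrightarrow> continuous_on {0..1} (Y \<omega>)"
  shows "(\<lambda>\<omega>. (V \<omega>, to_C01 (X \<omega>), to_C01 (Y \<omega>))) \<in> borel_measurable M"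
proof (rule borel_measurable_LIMSEQ_metric)
  define y where "y W n k \<omega> = (if n \<ge> 1 \<and> k \<le> n then W \<omega> (real k / real n) else 0)" for W :: "'a \<Rightarrow> real \<Rightarrow> real" and n k \<omega>
  have k01: "real k / real n \<in> {0..1}" if "k \<le> n" "n \<ge> 1" for k n using that by auto
  show "(\<lambda>\<omega>. (V \<omega>, bernstein_path n (\<lambda>k. y X n k \<omega>), bernstein_path n (\<lambda>k. y Y n k \<omega>))) \<in> borel_measurable M" for n
  proof (rule measurable_pair_bernstein_path[OF V])
    show "y X n k \<in> borel_measurable M" "y Y n k \<in> borel_measurable M" for k
      unfolding y_def using X[OF k01] Y[OF k01] by (cases "n \<ge> 1 \<and> k \<le> n"; auto)+
  qed
  fix \<omega> assume "\<omega> \<in> space M"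
  then show "(\<lambda>n. (V \<omega>, bernstein_path n (\<lambda>k. y X n k \<omega>), bernstein_path n (\<lambda>k. y Y n k \<omega>))) \<longlonglongrightarrow> (V \<omega>, to_C01 (X \<omega>), to_C01 (Y \<omega>))"
    by (intro tendsto_Pair tendsto_const bernstein_path_tendsto cX cY) (auto simp: y_def)
qed

section \<open>Measurability of the functionals\<close>

lemma A_n_left_mean: "A_n n f g = left_mean n (\<lambda>t. f t * g t) - left_mean n f * left_mean n g"
  by (simp add: A_n_def left_mean_def power2_eq_square)

lemma D_n_eq_A_n: "D_n n f = A_n n f f"
  unfolding D_n_def A_n_def by (simp add: power2_eq_square)

lemma D_eq_A: "D f = A f f"
  unfolding D_def A_def by (simp add: power2_eq_square)

lemma A_n_tendsto:
  assumes "continuous_on {0..1} f" "continuous_on {0..1} g"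
  shows "(\<lambda>n. A_n n f g) \<longlonglongrightarrow> A f g"
  unfolding A_n_left_mean A_def
  by (intro tendsto_intros left_mean_tendsto assms continuous_intros)

lemma A_cong:
  assumes "\<And>t. t \<in> {0..1} \<Longrightarrow> f t = f' t" "\<And>t. t \<in> {0..1} \<Longrightarrow> g t = g' t"
  shows "A f g = A f' g'"
proof -
  have "integral {0..1} (\<lambda>t. f t * g t) = integral {0..1} (\<lambda>t. f' t * g' t)" "integral {0..1} f = integral {0..1} f'"
    "integral {0..1} g = integral {0..1} g'"
    using assms by (auto intro!: integral_cong)
  then show ?thesis by (simp add: A_def)
qed

lemma
  assumes X: "\<And>t. t \<in> {0..1} \<Longrightarrow> (\<lambda>\<omega>. X \<omega> t) \<in> borel_measurable M" and cX: "\<And>\<omega>. \<omega> \<in> space M \<Longrightarrow> continuous_on {0..1} (X \<omega>)"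
    and Y: "\<And>t. t \<in> {0..1} \<Longrightarrow> (\<lambda>\<omega>. Y \<omega> t) \<in> borel_measurable M" and cY: "\<And>\<omega>. \<omega> \<in> space M \<Longrightarrow> continuous_on {0..1} (Y \<omega>)"
  shows measurable_A_n: "(\<lambda>\<omega>. A_n n (X \<omega>) (Y \<omega>)) \<in> borel_measurable M"
    and measurable_A_limit: "(\<lambda>\<omega>. A (X \<omega>) (Y \<omega>)) \<in> borel_measurable M"
    and measurable_left_mean: "(\<lambda>\<omega>. left_mean n (X \<omega>)) \<in> borel_measurable M"
    and measurable_integral: "(\<lambda>\<omega>. integral {0..1} (X \<omega>)) \<in> borel_measurable M"
proof -
  have k01: "real k / real n \<in> {0..1}" if "k < n" for k n :: nat using that by auto
  have Xk: "(\<lambda>\<omega>. X \<omega> (real k / real n)) \<in> borel_measurable M" "(\<lambda>\<omega>. Y \<omega> (real k / real n)) \<in> borel_measurable M" if "k \<in> {..<n}" for k n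
    using X Y k01 that by auto
  show An: "(\<lambda>\<omega>. A_n n (X \<omega>) (Y \<omega>)) \<in> borel_measurable M" for n
    unfolding A_n_def by (intro borel_measurable_diff borel_measurable_times borel_measurable_sum borel_measurable_const Xk)
  show "(\<lambda>\<omega>. A (X \<omega>) (Y \<omega>)) \<in> borel_measurable M"
    by (rule borel_measurable_LIMSEQ_real[OF A_n_tendsto An]) (use cX cY in auto)
  show lm: "(\<lambda>\<omega>. left_mean n (X \<omega>)) \<in> borel_measurable M" for n
    unfolding left_mean_def by (intro borel_measurable_divide borel_measurable_sum borel_measurable_const Xk)
  show "(\<lambda>\<omega>. integral {0..1} (X \<omega>)) \<in> borel_measurable M"
    by (rule borel_measurable_LIMSEQ_real[OF left_mean_tendsto lm]) (use cX in auto)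
qed

lemma measurable_bridge_integral:
  assumes X: "\<And>t. t \<in> {0..1} \<Longrightarrow> (\<lambda>\<omega>. X \<omega> t) \<in> borel_measurable M" and cX: "\<And>\<omega>. \<omega> \<in> space M \<Longrightarrow> continuous_on {0..1} (X \<omega>)"
    and k: "k < n"
  shows "(\<lambda>\<omega>. bridge_integral n (X \<omega>) k) \<in> borel_measurable M"
proof -
  have len: "(real k + 1) / n - k / n = 1 / n" by (simp add: diff_divide_distrib[symmetric])
  have pt: "k / n + 1 / n * (real j / real m) \<in> {0..1}" if "j < m" for j m
  proof -
    have "1 / n * (real j / real m) \<le> 1 / n * 1" using that by (intro mult_left_mono) auto
    then have "k / n + 1 / n * (real j / real m) \<le> (real k + 1) / n" by (simp add: add_divide_distrib)
    then show ?thesis using block_mem(2)[OF k] by (auto simp: order_trans)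
  qed
  have "(\<lambda>\<omega>. integral {real k / real n..(real k + 1) / real n} (X \<omega>)) \<in> borel_measurable M"
  proof (rule borel_measurable_LIMSEQ_real[OF riemann_sum_tendsto])
    show "continuous_on {real k / real n..(real k + 1) / real n} (X \<omega>)" if "\<omega> \<in> space M" for \<omega>
      using cX[OF that] block_subset[OF k] by (rule continuous_on_subset)
    show "real k / real n \<le> (real k + 1) / real n" by (simp add: divide_right_mono)
    show "(\<lambda>\<omega>. ((real k + 1) / real n - real k / real n) / real m * (\<Sum>j<m. X \<omega> (real k / real n + ((real k + 1) / real n - real k / real n) * (real j / real m)))) \<in> borel_measurable M" for m
      unfolding len by (intro borel_measurable_times borel_measurable_sum borel_measurable_const X pt) auto
  qed
  then show ?thesis
    unfolding bridge_integral_def using X block_mem[OF k] by (intro borel_measurable_diff borel_measurable_divide borel_measurable_add) auto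
qed

section \<open>The limiting Gaussian noise\<close>

lemma iexp_pair_measure:
  fixes f :: "'a \<Rightarrow> real" and g :: "'b \<Rightarrow> real"
  assumes M: "prob_space M" and N: "prob_space N" and [measurable]: "f \<in> borel_measurable M" "g \<in> borel_measurable N"
  shows "(CLINT z|M \<Otimes>\<^sub>M N. iexp (f (fst z) + g (snd z))) = (CLINT x|M. iexp (f x)) * (CLINT y|N. iexp (g y))"
proof -
  interpret M: prob_space M by fact
  interpret N: prob_space N by fact
  interpret P: pair_prob_space M N ..
  have e: "iexp (f (fst z) + g (snd z)) = iexp (f (fst z)) * iexp (g (snd z))" for z
    by (simp add: distrib_left exp_add)
  have i: "integrable (M \<Otimes>\<^sub>M N) (\<lambda>z. iexp (f (fst z)) * iexp (g (snd z)))"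
    by (rule P.integrable_const_bound[of _ 1]) (auto simp: norm_mult)
  have "(CLINT z|M \<Otimes>\<^sub>M N. iexp (f (fst z) + g (snd z))) = (CLINT x|M. (CLINT y|N. iexp (f x) * iexp (g y)))"
    unfolding e using P.integral_fst'[OF i] by (simp only: fst_conv snd_conv)
  then show ?thesis
    by (simp only: integral_mult_right_zero integral_mult_left_zero)
qed

text \<open>
  Four independent standard normal variables: a pair for the driving noise of the first path and a pair
  for the independent part of the driving noise of the second.
\<close>

definition std_normal4 :: "((real \<times> real) \<times> (real \<times> real)) measure"
  where "std_normal4 = (std_normal_distribution \<Otimes>\<^sub>M std_normal_distribution) \<Otimes>\<^sub>M (std_normal_distribution \<Otimes>\<^sub>M std_normal_distribution)"

definition lin4 :: "real \<Rightarrow> real \<Rightarrow> real \<Rightarrow> real \<Rightarrow> (real \<times> real) \<times> (real \<times> real) \<Rightarrow> real"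
  where "lin4 a b c d x = (a * fst (fst x) + b * snd (fst x)) + (c * fst (snd x) + d * snd (snd x))"

lemma prob_space_std_normal4: "prob_space std_normal4"
proof -
  interpret S: prob_space std_normal_distribution by (rule prob_space_std_normal)
  interpret SS: pair_prob_space std_normal_distribution std_normal_distribution ..
  interpret SSSS: pair_prob_space "std_normal_distribution \<Otimes>\<^sub>M std_normal_distribution" "std_normal_distribution \<Otimes>\<^sub>M std_normal_distribution" ..
  show ?thesis unfolding std_normal4_def by unfold_locales
qed

lemma sets_std_normal4: "sets std_normal4 = sets borel"
proof -
  have 1: "sets (std_normal_distribution \<Otimes>\<^sub>M std_normal_distribution) = sets (borel \<Otimes>\<^sub>M borel)"
    by (intro sets_pair_measure_cong) auto
  have "sets std_normal4 = sets ((borel \<Otimes>\<^sub>M borel) \<Otimes>\<^sub>M (borel \<Otimes>\<^sub>M borel))"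
    unfolding std_normal4_def by (intro sets_pair_measure_cong 1)
  then show ?thesis by (simp only: borel_prod)
qed

lemma measurable_lin4[measurable]: "lin4 a b c d \<in> borel_measurable std_normal4"
proof -
  have "lin4 a b c d \<in> borel_measurable borel"
    unfolding lin4_def by (intro borel_measurable_continuous_onI continuous_intros)
  then show ?thesis by (simp cong: measurable_cong_sets add: sets_std_normal4)
qed

lemma iexp_lin4: "(CLINT x|std_normal4. iexp (lin4 a b c d x)) = exp (- (a\<^sup>2 + b\<^sup>2 + c\<^sup>2 + d\<^sup>2) / 2)"
proof -
  have S: "(CLINT x|std_normal_distribution. iexp (a * x)) = exp (- a\<^sup>2 / 2)" for a
    using char_std_normal_distribution by (simp add: char_def fun_eq_iff)
  have SS: "(CLINT x|std_normal_distribution \<Otimes>\<^sub>M std_normal_distribution. iexp (a * fst x + b * snd x)) = exp (- (a\<^sup>2 + b\<^sup>2) / 2)" for a b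
    using iexp_pair_measure[OF prob_space_std_normal prob_space_std_normal, of "(*) a" "(*) b"]
    by (simp add: S add_divide_distrib exp_add[symmetric] del: of_real_add of_real_mult) (simp flip: of_real_mult exp_add)
  interpret S: prob_space std_normal_distribution by (rule prob_space_std_normal)
  interpret SS: pair_prob_space std_normal_distribution std_normal_distribution ..
  have p: "prob_space (std_normal_distribution \<Otimes>\<^sub>M std_normal_distribution)" by unfold_locales
  have "(CLINT x|std_normal4. iexp (lin4 a b c d x)) = complex_of_real (exp (- (a\<^sup>2 + b\<^sup>2) / 2)) * complex_of_real (exp (- (c\<^sup>2 + d\<^sup>2) / 2))"
    unfolding std_normal4_def lin4_def SS[symmetric]
    by (rule iexp_pair_measure[OF p p, of "\<lambda>x. a * fst x + b * snd x" "\<lambda>x. c * fst x + d * snd x"]) auto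
  also have "\<dots> = complex_of_real (exp (- (a\<^sup>2 + b\<^sup>2) / 2) * exp (- (c\<^sup>2 + d\<^sup>2) / 2))" by simp
  also have "exp (- (a\<^sup>2 + b\<^sup>2) / 2) * exp (- (c\<^sup>2 + d\<^sup>2) / 2) = exp (- (a\<^sup>2 + b\<^sup>2 + c\<^sup>2 + d\<^sup>2) / 2)"
    unfolding exp_add[symmetric] by (simp add: field_simps)
  finally show ?thesis .
qed

lemma distr_lin4: "distr std_normal4 borel (lin4 a b c d) = normal_law 0 (sqrt (a\<^sup>2 + b\<^sup>2 + c\<^sup>2 + d\<^sup>2))"
proof (rule prob_space.distr_eq_normal_lawI[OF prob_space_std_normal4])
  fix t
  have "t * lin4 a b c d x = lin4 (t * a) (t * b) (t * c) (t * d) x" for x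
    by (simp add: lin4_def algebra_simps)
  then have "(CLINT x|std_normal4. iexp (t * lin4 a b c d x)) = exp (- ((t * a)\<^sup>2 + (t * b)\<^sup>2 + (t * c)\<^sup>2 + (t * d)\<^sup>2) / 2)"
    using iexp_lin4[of "t * a" "t * b" "t * c" "t * d"] by simp
  also have "(t * a)\<^sup>2 + (t * b)\<^sup>2 + (t * c)\<^sup>2 + (t * d)\<^sup>2 = (sqrt (a\<^sup>2 + b\<^sup>2 + c\<^sup>2 + d\<^sup>2) * t)\<^sup>2"
    by (simp add: power_mult_distrib algebra_simps)
  finally show "(CLINT x|std_normal4. iexp (t * lin4 a b c d x)) = exp (- (sqrt (a\<^sup>2 + b\<^sup>2 + c\<^sup>2 + d\<^sup>2) * t)\<^sup>2 / 2)" .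
qed auto

text \<open>
  The variance of the projection of the noise to \<open>u\<close>.
\<close>

definition noise_qf :: "real \<Rightarrow> real \<Rightarrow> real \<Rightarrow> real \<Rightarrow> real^3 \<Rightarrow> real"
  where "noise_qf r a d1 d2 u = ((u$1)\<^sup>2 * (d1 + d2 + 2 * r * a) + 4 * (u$2)\<^sup>2 * d1 + 4 * (u$3)\<^sup>2 * d2
     + 4 * u$1 * u$2 * (r * d1 + a) + 4 * u$1 * u$3 * (a + r * d2) + 8 * r * u$2 * u$3 * a) / 12"

text \<open>
  Let \<open>\<beta>\<close> and \<open>\<gamma>\<close> be independent Brownian motions, independent of the centred paths \<open>f\<close> and \<open>g\<close>, and put
  \<open>\<beta>' = r \<beta> + s \<gamma>\<close>. Then \<open>sqrt 12\<close> times the noise is the vector of \<open>\<integral>f d\<beta>' + \<integral>g d\<beta>\<close>, \<open>2\<integral>f d\<beta>\<close> and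
  \<open>2\<integral>g d\<beta>'\<close>. Given the paths, \<open>(\<integral>f d\<beta>, \<integral>g d\<beta>)\<close> is normal with covariance matrix
  \<open>((d1, a), (a, d2))\<close>; it is realised by the Cholesky factor with entries \<open>al\<close>, \<open>be\<close>, \<open>ga\<close>. If \<open>d1 = 0\<close>
  then \<open>a\<^sup>2 \<le> d1 d2\<close> forces \<open>a = 0\<close>, and the convention \<open>x / 0 = 0\<close> gives the correct factor.
\<close>

definition noise :: "real \<Rightarrow> real \<Rightarrow> real \<Rightarrow> real \<Rightarrow> (real \<times> real) \<times> (real \<times> real) \<Rightarrow> real^3"
  where "noise r a d1 d2 x =
    (let al = sqrt d1; be = a / sqrt d1; ga = sqrt (d2 - a\<^sup>2 / d1); s = sqrt (1 - r\<^sup>2) in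
     (1 / sqrt 12) *\<^sub>R vector [r * (al * fst (fst x)) + (be * fst (fst x) + ga * snd (fst x)) + s * (al * fst (snd x)),
       2 * (al * fst (fst x)),
       2 * (r * (be * fst (fst x) + ga * snd (fst x)) + s * (be * fst (snd x) + ga * snd (snd x)))])"

lemma inner_vector3: "(u :: real^3) \<bullet> vector [a, b, c] = u$1 * a + u$2 * b + u$3 * c"
  unfolding inner_vec_def sum_3 by simp

lemma noise_projection:
  fixes u :: "real^3"
  assumes "d1 \<ge> 0" "d2 \<ge> 0" and cs: "a\<^sup>2 \<le> d1 * d2" and r: "-1 < r" "r < 1"
  obtains c1 c2 c3 c4 where "\<And>x. u \<bullet> noise r a d1 d2 x = lin4 c1 c2 c3 c4 x" "c1\<^sup>2 + c2\<^sup>2 + c3\<^sup>2 + c4\<^sup>2 = noise_qf r a d1 d2 u"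
proof -
  define al be ga s where "al = sqrt d1" and "be = a / al" and "ga = sqrt (d2 - a\<^sup>2 / d1)" and "s = sqrt (1 - r\<^sup>2)"
  have al: "al\<^sup>2 = d1" using assms by (simp add: al_def)
  have albe: "al * be = a" using cs assms by (cases "d1 = 0") (auto simp: al_def be_def)
  have "a\<^sup>2 / d1 \<le> d2" using cs assms by (cases "d1 = 0") (auto simp: divide_simps mult.commute)
  then have ga: "ga\<^sup>2 = d2 - a\<^sup>2 / d1" by (simp add: ga_def)
  have be: "be\<^sup>2 = a\<^sup>2 / d1" using assms by (simp add: be_def al_def power_divide)
  have bg: "be\<^sup>2 + ga\<^sup>2 = d2" by (simp add: be ga)
  have "r\<^sup>2 \<le> 1" using r by (simp add: abs_square_le_1)
  then have s: "s\<^sup>2 = 1 - r\<^sup>2" by (simp add: s_def)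
  define k where "k = 1 / sqrt 12"
  have k: "k\<^sup>2 = 1 / 12" by (simp add: k_def power_divide)
  define c1 c2 c3 c4 where "c1 = k * (u$1 * (r * al + be) + 2 * u$2 * al + 2 * u$3 * r * be)"
    and "c2 = k * (u$1 * ga + 2 * u$3 * r * ga)" and "c3 = k * (u$1 * s * al + 2 * u$3 * s * be)" and "c4 = k * (2 * u$3 * s * ga)"
  show ?thesis
  proof
    show "u \<bullet> noise r a d1 d2 x = lin4 c1 c2 c3 c4 x" for x
      unfolding noise_def Let_def al_def[symmetric]
      unfolding be_def[symmetric] ga_def[symmetric] s_def[symmetric] k_def[symmetric]
        inner_scaleR_right inner_vector3 lin4_def c1_def c2_def c3_def c4_def by algebra
    have "c1\<^sup>2 + c2\<^sup>2 + c3\<^sup>2 + c4\<^sup>2 = k\<^sup>2 * ((u$1 * (r * al + be) + 2 * u$2 * al + 2 * u$3 * r * be)\<^sup>2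
        + (u$1 + 2 * u$3 * r)\<^sup>2 * ga\<^sup>2 + s\<^sup>2 * (u$1 * al + 2 * u$3 * be)\<^sup>2 + s\<^sup>2 * (4 * (u$3)\<^sup>2 * ga\<^sup>2))"
      unfolding c1_def c2_def c3_def c4_def by algebra
    also have "\<dots> = k\<^sup>2 * ((u$1)\<^sup>2 * (al\<^sup>2 + (be\<^sup>2 + ga\<^sup>2) + 2 * r * (al * be)) + 4 * (u$2)\<^sup>2 * al\<^sup>2 + 4 * (u$3)\<^sup>2 * (be\<^sup>2 + ga\<^sup>2)
     + 4 * u$1 * u$2 * (r * al\<^sup>2 + al * be) + 4 * u$1 * u$3 * (al * be + r * (be\<^sup>2 + ga\<^sup>2)) + 8 * r * u$2 * u$3 * (al * be))"
      unfolding s by algebra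
    also have "\<dots> = noise_qf r a d1 d2 u"
      unfolding al albe bg k noise_qf_def by simp
    finally show "c1\<^sup>2 + c2\<^sup>2 + c3\<^sup>2 + c4\<^sup>2 = noise_qf r a d1 d2 u" .
  qed
qed

lemma iexp_noise:
  assumes "d1 \<ge> 0" "d2 \<ge> 0" "a\<^sup>2 \<le> d1 * d2" "-1 < r" "r < 1"
  shows "(CLINT x|std_normal4. iexp (u \<bullet> noise r a d1 d2 x)) = exp (- noise_qf r a d1 d2 u / 2)"
proof -
  obtain c1 c2 c3 c4 where c: "\<And>x. u \<bullet> noise r a d1 d2 x = lin4 c1 c2 c3 c4 x" "c1\<^sup>2 + c2\<^sup>2 + c3\<^sup>2 + c4\<^sup>2 = noise_qf r a d1 d2 u"
    by (rule noise_projection[OF assms, where u = u], rule that)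
  show ?thesis unfolding c(1) iexp_lin4 c(2) ..
qed

lemma noise_projection_normal:
  assumes "d1 \<ge> 0" "d2 \<ge> 0" "a\<^sup>2 \<le> d1 * d2" "-1 < r" "r < 1"
  shows "distr std_normal4 borel (\<lambda>x. u \<bullet> noise r a d1 d2 x) = normal_law 0 (sqrt (noise_qf r a d1 d2 u))"
proof -
  obtain c1 c2 c3 c4 where c: "\<And>x. u \<bullet> noise r a d1 d2 x = lin4 c1 c2 c3 c4 x" "c1\<^sup>2 + c2\<^sup>2 + c3\<^sup>2 + c4\<^sup>2 = noise_qf r a d1 d2 u"
    by (rule noise_projection[OF assms, where u = u], rule that)
  show ?thesis unfolding c(1) distr_lin4 c(2) ..
qed

lemma vector3_tendsto:
  fixes a b c :: "nat \<Rightarrow> real"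
  assumes "a \<longlonglongrightarrow> a0" "b \<longlonglongrightarrow> b0" "c \<longlonglongrightarrow> c0"
  shows "(\<lambda>n. vector [a n, b n, c n] :: real^3) \<longlonglongrightarrow> vector [a0, b0, c0]"
proof (rule vec_tendstoI)
  fix i :: 3
  show "(\<lambda>n. (vector [a n, b n, c n] :: real^3) $ i) \<longlonglongrightarrow> (vector [a0, b0, c0] :: real^3) $ i"
    using exhaust_3[of i] assms by auto
qed

lemma noise_tendsto:
  assumes "a \<longlonglongrightarrow> a0" "d1 \<longlonglongrightarrow> d10" "d2 \<longlonglongrightarrow> d20" "d10 > 0"
  shows "(\<lambda>n. noise r (a n) (d1 n) (d2 n) x) \<longlonglongrightarrow> noise r a0 d10 d20 x"
proof -
  show ?thesis
    unfolding noise_def Let_def using assms by (intro tendsto_intros vector3_tendsto) auto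
qed

lemma measurable_vector3:
  assumes [measurable]: "f \<in> borel_measurable M" "g \<in> borel_measurable M" "h \<in> borel_measurable M"
  shows "(\<lambda>\<omega>. vector [f \<omega>, g \<omega>, h \<omega>] :: real^3) \<in> borel_measurable M"
proof -
  have "vector [f \<omega>, g \<omega>, h \<omega>] = f \<omega> *\<^sub>R axis 1 1 + g \<omega> *\<^sub>R axis 2 1 + h \<omega> *\<^sub>R (axis 3 1 :: real^3)" for \<omega>
    by (simp add: vec_eq_iff forall_3 axis_def)
  then show ?thesis by simp
qed

lemma measurable_noise:
  assumes [measurable]: "a \<in> borel_measurable M" "d1 \<in> borel_measurable M" "d2 \<in> borel_measurable M"
    and x[measurable]: "x \<in> M \<rightarrow>\<^sub>M borel"
  shows "(\<lambda>\<omega>. noise r (a \<omega>) (d1 \<omega>) (d2 \<omega>) (x \<omega>)) \<in> borel_measurable M"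
proof -
  have [measurable]: "(\<lambda>\<omega>. fst (fst (x \<omega>))) \<in> borel_measurable M" "(\<lambda>\<omega>. snd (fst (x \<omega>))) \<in> borel_measurable M"
    "(\<lambda>\<omega>. fst (snd (x \<omega>))) \<in> borel_measurable M" "(\<lambda>\<omega>. snd (snd (x \<omega>))) \<in> borel_measurable M"
    by (intro measurable_compose[OF x] borel_measurable_continuous_onI continuous_intros)+
  show ?thesis
    unfolding noise_def Let_def by (intro borel_measurable_scaleR borel_measurable_const measurable_vector3) measurable
qed

section \<open>Law of the leading error term given the skeleton\<close>

text \<open>
  Increments are indexed by the path (\<open>True\<close> for the first one) and the cell; their partial sums are
  the skeleton of a path starting at zero.
\<close>

definition path_of :: "bool \<Rightarrow> (bool \<times> nat \<Rightarrow> real) \<Rightarrow> nat \<Rightarrow> real"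
  where "path_of b g k = (\<Sum>j<k. g (b, j))"

definition smean :: "nat \<Rightarrow> (nat \<Rightarrow> real) \<Rightarrow> real"
  where "smean n a = (\<Sum>k<n. a k) / real n"

definition scov :: "nat \<Rightarrow> (nat \<Rightarrow> real) \<Rightarrow> (nat \<Rightarrow> real) \<Rightarrow> real"
  where "scov n a b = (\<Sum>k<n. (a k - smean n a) * (b k - smean n b)) / real n"

lemma scov_eq:
  assumes "n \<ge> 1"
  shows "scov n a b = smean n (\<lambda>k. a k * b k) - smean n a * smean n b"
proof -
  have "(\<Sum>k<n. (a k - smean n a) * (b k - smean n b))
     = (\<Sum>k<n. a k * b k - smean n b * a k - smean n a * b k + smean n a * smean n b)"
    by (intro sum.cong) (auto simp: algebra_simps)
  also have "\<dots> = (\<Sum>k<n. a k * b k) - smean n b * (\<Sum>k<n. a k) - smean n a * (\<Sum>k<n. b k) + n * (smean n a * smean n b)"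
    by (simp add: sum.distrib sum_subtractf sum_distrib_left)
  finally have e: "(\<Sum>k<n. (a k - smean n a) * (b k - smean n b)) = (\<Sum>k<n. a k * b k) - smean n b * (\<Sum>k<n. a k)
      - smean n a * (\<Sum>k<n. b k) + n * (smean n a * smean n b)" .
  have s: "(\<Sum>k<n. a k) = n * smean n a" "(\<Sum>k<n. b k) = n * smean n b" "(\<Sum>k<n. a k * b k) = n * smean n (\<lambda>k. a k * b k)"
    using assms by (simp_all add: smean_def)
  have *: "(\<Sum>k<n. (a k - smean n a) * (b k - smean n b)) = n * (smean n (\<lambda>k. a k * b k) - smean n a * smean n b)"
    unfolding e s by (simp add: algebra_simps)
  show ?thesis
    unfolding scov_def * using assms by simp
qed

lemma scov_nonneg: "0 \<le> scov n a a"
  unfolding scov_def by (auto intro!: divide_nonneg_nonneg sum_nonneg)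

lemma scov_Cauchy_Schwarz: "(scov n a b)\<^sup>2 \<le> scov n a a * scov n b b"
proof -
  have "(\<Sum>k<n. (a k - smean n a) * (b k - smean n b))\<^sup>2 \<le> (\<Sum>k<n. (a k - smean n a)\<^sup>2) * (\<Sum>k<n. (b k - smean n b)\<^sup>2)"
    by (rule Cauchy_Schwarz_ineq_sum)
  from divide_right_mono[OF this, of "(real n)\<^sup>2"] show ?thesis
    by (simp add: scov_def power2_eq_square)
qed

text \<open>
  The leading error term as a function of the increments \<open>g\<close> and the bridge integrals \<open>\<eta>\<close>.
\<close>

definition main_error :: "nat \<Rightarrow> (bool \<times> nat \<Rightarrow> real) \<Rightarrow> (bool \<times> nat \<Rightarrow> real) \<Rightarrow> real^3"
  where "main_error n g \<eta> = (let x = path_of True g; y = path_of False g in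
    vector [- real n * (\<Sum>k<n. (x k - smean n x) * \<eta> (False, k) + (y k - smean n y) * \<eta> (True, k)),
      - 2 * real n * (\<Sum>k<n. (x k - smean n x) * \<eta> (True, k)),
      - 2 * real n * (\<Sum>k<n. (y k - smean n y) * \<eta> (False, k))])"

definition grid_noise :: "real \<Rightarrow> nat \<Rightarrow> (bool \<times> nat \<Rightarrow> real) \<Rightarrow> (real \<times> real) \<times> (real \<times> real) \<Rightarrow> real^3"
  where "grid_noise r n g = (let x = path_of True g; y = path_of False g in noise r (scov n x y) (scov n x x) (scov n y y))"

lemma measurable_coordinate: "(\<lambda>g :: 'i::countable \<Rightarrow> real. g i) \<in> borel_measurable borel"
  by (intro borel_measurable_continuous_onI continuous_on_product_coordinates)

lemma measurable_main_error:
  assumes g: "\<And>i. (\<lambda>\<omega>. g \<omega> i) \<in> borel_measurable M" and \<eta>: "\<And>i. (\<lambda>\<omega>. \<eta> \<omega> i) \<in> borel_measurable M"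
  shows "(\<lambda>\<omega>. main_error n (g \<omega>) (\<eta> \<omega>)) \<in> borel_measurable M"
proof -
  note [measurable] = g \<eta>
  have p[measurable]: "(\<lambda>\<omega>. path_of b (g \<omega>) k) \<in> borel_measurable M" for b k
    unfolding path_of_def by measurable
  have m[measurable]: "(\<lambda>\<omega>. smean n (path_of b (g \<omega>))) \<in> borel_measurable M" for b
    unfolding smean_def by measurable
  show ?thesis
    unfolding main_error_def Let_def by (intro measurable_vector3) measurable
qed

lemma measurable_scov_path:
  assumes g: "\<And>i. (\<lambda>\<omega>. g \<omega> i) \<in> borel_measurable M"
  shows "(\<lambda>\<omega>. scov n (path_of b (g \<omega>)) (path_of c (g \<omega>))) \<in> borel_measurable M"
proof -
  note [measurable] = g
  have p[measurable]: "(\<lambda>\<omega>. path_of b (g \<omega>) k) \<in> borel_measurable M" for b k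
    unfolding path_of_def by measurable
  have m[measurable]: "(\<lambda>\<omega>. smean n (path_of b (g \<omega>))) \<in> borel_measurable M" for b
    unfolding smean_def by measurable
  show ?thesis
    unfolding scov_def by measurable
qed

lemma measurable_grid_noise:
  assumes g: "\<And>i. (\<lambda>\<omega>. g \<omega> i) \<in> borel_measurable M" and x: "x \<in> M \<rightarrow>\<^sub>M borel"
  shows "(\<lambda>\<omega>. grid_noise r n (g \<omega>) (x \<omega>)) \<in> borel_measurable M"
  unfolding grid_noise_def Let_def by (intro measurable_noise measurable_scov_path g x)

text \<open>
  Brings an arbitrary finite combination of increments (first index \<open>False\<close>) and bridge integrals (first
  index \<open>True\<close>) to the form for which the characteristic function is known.
\<close>

lemma sum_bool_bool_nat:
  fixes Z c :: "bool \<times> bool \<times> nat \<Rightarrow> real"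
  assumes J: "finite J" and Z: "\<And>e b k. n \<le> k \<Longrightarrow> Z (e, b, k) = 0"
  defines "c' \<equiv> \<lambda>j. if j \<in> J then c j else 0"
  shows "(\<Sum>j\<in>J. c j * Z j) = (\<Sum>k<n. c' (False, True, k) * Z (False, True, k) + c' (False, False, k) * Z (False, False, k)
      + c' (True, True, k) * Z (True, True, k) + c' (True, False, k) * Z (True, False, k))"
proof -
  define B where "B = (UNIV :: bool set) \<times> (UNIV :: bool set) \<times> {..<n}"
  have B: "finite B" by (simp add: B_def)
  have "(\<Sum>j\<in>J. c j * Z j) = (\<Sum>j\<in>J \<union> B. c' j * Z j)"
    using J B by (intro sum.mono_neutral_cong_left) (auto simp: c'_def)
  also have "\<dots> = (\<Sum>j\<in>B. c' j * Z j)"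
  proof (rule sum.mono_neutral_right)
    show "\<forall>j\<in>J \<union> B - B. c' j * Z j = 0"
    proof
      fix j assume "j \<in> J \<union> B - B"
      then have "n \<le> snd (snd j)" by (cases j) (auto simp: B_def)
      then show "c' j * Z j = 0" using Z[of "snd (snd j)" "fst j" "fst (snd j)"] by simp
    qed
  qed (use J B in auto)
  also have "\<dots> = (\<Sum>e\<in>UNIV. \<Sum>b\<in>UNIV. \<Sum>k<n. c' (e, b, k) * Z (e, b, k))"
    unfolding B_def by (simp add: sum.cartesian_product)
  finally show ?thesis
    by (simp add: UNIV_bool sum.distrib)
qed

context brownian_pair begin

definition grid_increments :: "nat \<Rightarrow> 'a \<Rightarrow> bool \<times> nat \<Rightarrow> real"
  where "grid_increments n \<omega> i = (if snd i < n then
    (if fst i then dX (real (snd i) / n) ((real (snd i) + 1) / n) \<omega> else dY (real (snd i) / n) ((real (snd i) + 1) / n) \<omega>) else 0)"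

definition grid_bridges :: "nat \<Rightarrow> 'a \<Rightarrow> bool \<times> nat \<Rightarrow> real"
  where "grid_bridges n \<omega> i = (if snd i < n then
    (if fst i then bridge_integral n (X \<omega>) (snd i) else bridge_integral n (Y \<omega>) (snd i)) else 0)"

lemma measurable_X: "t \<in> {0..1} \<Longrightarrow> (\<lambda>\<omega>. X \<omega> t) \<in> borel_measurable M"
  by (intro measurable_mem X_mem)

lemma measurable_Y: "t \<in> {0..1} \<Longrightarrow> (\<lambda>\<omega>. Y \<omega> t) \<in> borel_measurable M"
  by (intro measurable_mem Y_mem)

lemma measurable_grid_increments: "(\<lambda>\<omega>. grid_increments n \<omega> i) \<in> borel_measurable M"
proof (cases "snd i < n")
  case True
  then show ?thesis
    unfolding grid_increments_def using block_mem[OF True]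
    by (cases "fst i") (auto intro!: borel_measurable_diff measurable_X measurable_Y simp del: atLeastAtMost_iff)
qed (simp add: grid_increments_def)

lemma measurable_grid_bridges: "(\<lambda>\<omega>. grid_bridges n \<omega> i) \<in> borel_measurable M"
proof (cases "snd i < n")
  case True
  then show ?thesis
    unfolding grid_bridges_def
    by (cases "fst i") (auto intro!: measurable_bridge_integral measurable_X measurable_Y contX contY)
qed (simp add: grid_bridges_def)

lemma grid_charfun:
  assumes "n \<ge> 1"
  shows "(CLINT \<omega>|M. iexp (\<Sum>k<n. p k * grid_increments n \<omega> (True, k) + q k * grid_increments n \<omega> (False, k)
      + u k * grid_bridges n \<omega> (True, k) + v k * grid_bridges n \<omega> (False, k)))
    = exp (- (\<Sum>k<n. Q (p k) (q k) / n + Q (u k) (v k) / (12 * real n ^ 3)) / 2)"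
proof -
  have "(\<Sum>k<n. p k * grid_increments n \<omega> (True, k) + q k * grid_increments n \<omega> (False, k)
      + u k * grid_bridges n \<omega> (True, k) + v k * grid_bridges n \<omega> (False, k))
    = (\<Sum>k<n. p k * dX (k / n) ((real k + 1) / n) \<omega> + q k * dY (k / n) ((real k + 1) / n) \<omega>
       + u k * bridge_integral n (X \<omega>) k + v k * bridge_integral n (Y \<omega>) k)" for \<omega>
    by (intro sum.cong) (auto simp: grid_increments_def grid_bridges_def)
  then show ?thesis using increments_bridges_charfun[OF assms, of p q u v] by simp
qed

text \<open>
  The joint characteristic function factorises, so the bridge integrals and increments have the same
  joint law as bridge integrals and increments taken at two independent sample points.
\<close>

lemma bridges_independent_of_increments:
  fixes \<psi> :: "(bool \<times> nat \<Rightarrow> real) \<times> (bool \<times> nat \<Rightarrow> real) \<Rightarrow> real"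
  assumes n: "n \<ge> 1" and \<psi>[measurable]: "\<psi> \<in> borel_measurable borel" and bnd: "\<And>z. \<bar>\<psi> z\<bar> \<le> C"
  shows "(\<integral>\<omega>. \<psi> (grid_bridges n \<omega>, grid_increments n \<omega>) \<partial>M)
    = (\<integral>\<omega>. (\<integral>\<omega>'. \<psi> (grid_bridges n \<omega>', grid_increments n \<omega>) \<partial>M) \<partial>M)"
proof -
  interpret P: pair_prob_space M M ..
  note [measurable] = measurable_grid_increments measurable_grid_bridges
  define Z where "Z \<omega> j = (if fst j then grid_bridges n \<omega> (snd j) else grid_increments n \<omega> (snd j))" for \<omega> and j :: "bool \<times> bool \<times> nat"
  define Z' where "Z' z j = (if fst j then grid_bridges n (snd z) (snd j) else grid_increments n (fst z) (snd j))" for z and j :: "bool \<times> bool \<times> nat"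
  have Zm[measurable]: "(\<lambda>\<omega>. Z \<omega> j) \<in> borel_measurable M" for j
    unfolding Z_def by (cases "fst j") auto
  have Zm'[measurable]: "(\<lambda>z. Z' z j) \<in> borel_measurable (M \<Otimes>\<^sub>M M)" for j
    unfolding Z'_def by (cases "fst j") auto
  have law: "distr M borel Z = distr (M \<Otimes>\<^sub>M M) borel Z'"
  proof (rule charfun_determines_law)
    show "prob_space M" "prob_space (M \<Otimes>\<^sub>M M)" by unfold_locales
    fix J :: "(bool \<times> bool \<times> nat) set" and c :: "bool \<times> bool \<times> nat \<Rightarrow> real"
    assume J: "finite J"
    define c' where "c' j = (if j \<in> J then c j else 0)" for j
    have z: "Z \<omega> (e, b, k) = 0" "Z' z (e, b, k) = 0" if "n \<le> k" for \<omega> z e b k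
      using that by (auto simp: Z_def Z'_def grid_bridges_def grid_increments_def)
    have sZ: "(\<Sum>j\<in>J. c j * Z \<omega> j) = (\<Sum>k<n. c' (False, True, k) * Z \<omega> (False, True, k) + c' (False, False, k) * Z \<omega> (False, False, k)
        + c' (True, True, k) * Z \<omega> (True, True, k) + c' (True, False, k) * Z \<omega> (True, False, k))" for \<omega>
      unfolding c'_def using J z(1) by (rule sum_bool_bool_nat)
    have sZ': "(\<Sum>j\<in>J. c j * Z' \<omega> j) = (\<Sum>k<n. c' (False, True, k) * Z' \<omega> (False, True, k) + c' (False, False, k) * Z' \<omega> (False, False, k)
        + c' (True, True, k) * Z' \<omega> (True, True, k) + c' (True, False, k) * Z' \<omega> (True, False, k))" for \<omega>
      unfolding c'_def using J z(2) by (rule sum_bool_bool_nat)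
    have "(CLINT \<omega>|M. iexp (\<Sum>j\<in>J. c j * Z \<omega> j))
      = exp (- (\<Sum>k<n. Q (c' (False, True, k)) (c' (False, False, k)) / n + Q (c' (True, True, k)) (c' (True, False, k)) / (12 * real n ^ 3)) / 2)"
      using grid_charfun[OF n, of "\<lambda>k. c' (False, True, k)" "\<lambda>k. c' (False, False, k)" "\<lambda>k. c' (True, True, k)" "\<lambda>k. c' (True, False, k)"]
      unfolding sZ by (simp add: Z_def)
    moreover have "(CLINT z|M \<Otimes>\<^sub>M M. iexp (\<Sum>j\<in>J. c j * Z' z j))
      = exp (- (\<Sum>k<n. Q (c' (False, True, k)) (c' (False, False, k)) / n + Q (c' (True, True, k)) (c' (True, False, k)) / (12 * real n ^ 3)) / 2)"
    proof -
      define f where "f \<omega> = (\<Sum>k<n. c' (False, True, k) * grid_increments n \<omega> (True, k) + c' (False, False, k) * grid_increments n \<omega> (False, k)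
         + 0 * grid_bridges n \<omega> (True, k) + 0 * grid_bridges n \<omega> (False, k))" for \<omega>
      define g where "g \<omega> = (\<Sum>k<n. 0 * grid_increments n \<omega> (True, k) + 0 * grid_increments n \<omega> (False, k)
         + c' (True, True, k) * grid_bridges n \<omega> (True, k) + c' (True, False, k) * grid_bridges n \<omega> (False, k))" for \<omega>
      have [measurable]: "f \<in> borel_measurable M" "g \<in> borel_measurable M" unfolding f_def g_def by measurable
      have "(\<Sum>j\<in>J. c j * Z' z j) = f (fst z) + g (snd z)" for z
        unfolding sZ' f_def g_def
        by (simp add: Z'_def sum.distrib)
      then have "(CLINT z|M \<Otimes>\<^sub>M M. iexp (\<Sum>j\<in>J. c j * Z' z j)) = (CLINT \<omega>|M. iexp (f \<omega>)) * (CLINT \<omega>|M. iexp (g \<omega>))"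
        using iexp_pair_measure[OF prob_space_axioms prob_space_axioms, of f g] by simp
      also have "\<dots> = complex_of_real (exp (- (\<Sum>k<n. Q (c' (False, True, k)) (c' (False, False, k)) / n + Q 0 0 / (12 * real n ^ 3)) / 2)
          * exp (- (\<Sum>k<n. Q 0 0 / n + Q (c' (True, True, k)) (c' (True, False, k)) / (12 * real n ^ 3)) / 2))"
        unfolding f_def g_def grid_charfun[OF n] of_real_mult ..
      also have "\<dots> = exp (- (\<Sum>k<n. Q (c' (False, True, k)) (c' (False, False, k)) / n + Q (c' (True, True, k)) (c' (True, False, k)) / (12 * real n ^ 3)) / 2)"
        unfolding exp_add[symmetric] by (simp add: Q_def[of 0 0] sum.distrib add_divide_distrib)
      finally show ?thesis .
    qed
    ultimately show "(CLINT \<omega>|M. iexp (\<Sum>j\<in>J. c j * Z \<omega> j)) = (CLINT z|M \<Otimes>\<^sub>M M. iexp (\<Sum>j\<in>J. c j * Z' z j))" by simp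
  qed auto
  have [measurable]: "Z \<in> borel_measurable M" "Z' \<in> borel_measurable (M \<Otimes>\<^sub>M M)"
    by (auto intro: measurable_coordinatewise_then_product)
  define sp where "sp z = ((\<lambda>i. z (True, i)) :: bool \<times> nat \<Rightarrow> real, (\<lambda>i. z (False, i)) :: bool \<times> nat \<Rightarrow> real)" for z :: "bool \<times> bool \<times> nat \<Rightarrow> real"
  have [measurable]: "sp \<in> borel_measurable borel"
    unfolding sp_def by (intro borel_measurable_Pair measurable_coordinatewise_then_product measurable_coordinate)
  have "(\<integral>\<omega>. \<psi> (grid_bridges n \<omega>, grid_increments n \<omega>) \<partial>M) = (\<integral>\<omega>. \<psi> (sp (Z \<omega>)) \<partial>M)"
    by (simp add: sp_def Z_def)
  also have "\<dots> = (\<integral>z. \<psi> (sp z) \<partial>distr M borel Z)"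
    by (subst integral_distr) auto
  also have "\<dots> = (\<integral>z. \<psi> (sp (Z' z)) \<partial>(M \<Otimes>\<^sub>M M))"
    unfolding law by (subst integral_distr) auto
  also have "\<dots> = (\<integral>\<omega>. (\<integral>\<omega>'. \<psi> (sp (Z' (\<omega>, \<omega>'))) \<partial>M) \<partial>M)"
  proof (rule P.integral_fst'[symmetric])
    show "integrable (M \<Otimes>\<^sub>M M) (\<lambda>z. \<psi> (sp (Z' z)))"
      by (rule P.integrable_const_bound[of _ C]) (use bnd in auto)
  qed
  finally show ?thesis by (simp add: sp_def Z'_def)
qed

text \<open>
  For fixed increments the leading term is linear in the bridge integrals.
\<close>

lemma main_error_charfun:
  assumes n: "n \<ge> 1"
  shows "(CLINT \<omega>|M. iexp (u \<bullet> main_error n g (grid_bridges n \<omega>)))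
    = (CLINT x|std_normal4. iexp (u \<bullet> grid_noise r n g x))"
proof -
  define x y where "x = path_of True g" and "y = path_of False g"
  define x' y' where "x' k = x k - smean n x" and "y' k = y k - smean n y" for k
  define p q where "p k = - real n * (u$1 * y' k + 2 * u$2 * x' k)" and "q k = - real n * (u$1 * x' k + 2 * u$3 * y' k)" for k
  have "u \<bullet> main_error n g \<eta> = (\<Sum>k<n. p k * \<eta> (True, k) + q k * \<eta> (False, k))" for \<eta>
    unfolding main_error_def Let_def x_def[symmetric] y_def[symmetric] x'_def[symmetric] y'_def[symmetric] inner_vector3
      p_def q_def sum_distrib_left sum.distrib[symmetric]
    by (intro sum.cong) (auto simp: algebra_simps)
  then have "(CLINT \<omega>|M. iexp (u \<bullet> main_error n g (grid_bridges n \<omega>))) = exp (- (\<Sum>k<n. Q 0 0 / n + Q (p k) (q k) / (12 * real n ^ 3)) / 2)"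
    using grid_charfun[OF n, of "\<lambda>_. 0" "\<lambda>_. 0" p q] by simp
  also have "(\<Sum>k<n. Q 0 0 / n + Q (p k) (q k) / (12 * real n ^ 3)) = noise_qf r (scov n x y) (scov n x x) (scov n y y) u"
  proof -
    have "Q (p k) (q k) = (real n)\<^sup>2 * ((4 * (u$2)\<^sup>2 + (u$1)\<^sup>2 + 4 * r * u$1 * u$2) * (x' k * x' k)
       + ((u$1)\<^sup>2 + 4 * (u$3)\<^sup>2 + 4 * r * u$1 * u$3) * (y' k * y' k)
       + (4 * u$1 * u$2 + 4 * u$1 * u$3 + 2 * r * ((u$1)\<^sup>2 + 4 * u$2 * u$3)) * (x' k * y' k))" for k
      unfolding Q_def p_def q_def by algebra
    then have "(\<Sum>k<n. Q (p k) (q k)) = (real n)\<^sup>2 * ((4 * (u$2)\<^sup>2 + (u$1)\<^sup>2 + 4 * r * u$1 * u$2) * (\<Sum>k<n. x' k * x' k)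
       + ((u$1)\<^sup>2 + 4 * (u$3)\<^sup>2 + 4 * r * u$1 * u$3) * (\<Sum>k<n. y' k * y' k)
       + (4 * u$1 * u$2 + 4 * u$1 * u$3 + 2 * r * ((u$1)\<^sup>2 + 4 * u$2 * u$3)) * (\<Sum>k<n. x' k * y' k))"
      by (simp only: sum_distrib_left[symmetric] sum.distrib)
    moreover have "(\<Sum>k<n. x' k * x' k) = n * scov n x x" "(\<Sum>k<n. y' k * y' k) = n * scov n y y" "(\<Sum>k<n. x' k * y' k) = n * scov n x y"
      using n by (simp_all add: scov_def x'_def y'_def)
    ultimately have S: "(\<Sum>k<n. Q (p k) (q k)) = real n ^ 3 * ((4 * (u$2)\<^sup>2 + (u$1)\<^sup>2 + 4 * r * u$1 * u$2) * scov n x x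
       + ((u$1)\<^sup>2 + 4 * (u$3)\<^sup>2 + 4 * r * u$1 * u$3) * scov n y y
       + (4 * u$1 * u$2 + 4 * u$1 * u$3 + 2 * r * ((u$1)\<^sup>2 + 4 * u$2 * u$3)) * scov n x y)"
      by algebra
    have "Q 0 0 = 0" by (simp add: Q_def)
    then have "(\<Sum>k<n. Q 0 0 / n + Q (p k) (q k) / (12 * real n ^ 3)) = (\<Sum>k<n. Q (p k) (q k)) / (12 * real n ^ 3)"
      by (simp add: sum_divide_distrib)
    also have "\<dots> = ((4 * (u$2)\<^sup>2 + (u$1)\<^sup>2 + 4 * r * u$1 * u$2) * scov n x x
       + ((u$1)\<^sup>2 + 4 * (u$3)\<^sup>2 + 4 * r * u$1 * u$3) * scov n y y
       + (4 * u$1 * u$2 + 4 * u$1 * u$3 + 2 * r * ((u$1)\<^sup>2 + 4 * u$2 * u$3)) * scov n x y) / 12"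
      unfolding S using n by simp
    also have "\<dots> = noise_qf r (scov n x y) (scov n x x) (scov n y y) u"
      unfolding noise_qf_def by (rule arg_cong[where f = "\<lambda>z. z / 12"]) algebra
    finally show ?thesis .
  qed
  also have "complex_of_real (exp (- noise_qf r (scov n x y) (scov n x x) (scov n y y) u / 2)) = (CLINT z|std_normal4. iexp (u \<bullet> grid_noise r n g z))"
    unfolding grid_noise_def Let_def x_def y_def
    by (rule iexp_noise[symmetric]) (use r in \<open>auto intro: scov_nonneg scov_Cauchy_Schwarz\<close>)
  finally show ?thesis .
qed

text \<open>
  Conditionally on the skeleton the leading term is exactly Gaussian for each \<open>n\<close>: by independence the
  increments may be frozen, and for frozen increments the characteristic functions agree.
\<close>

theorem main_error_law:
  fixes \<psi> :: "(real^3) \<times> (bool \<times> nat \<Rightarrow> real) \<Rightarrow> real"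
  assumes n: "n \<ge> 1" and \<psi>[measurable]: "\<psi> \<in> borel_measurable borel" and bnd: "\<And>z. \<bar>\<psi> z\<bar> \<le> C"
  shows "(\<integral>\<omega>. \<psi> (main_error n (grid_increments n \<omega>) (grid_bridges n \<omega>), grid_increments n \<omega>) \<partial>M)
    = (\<integral>z. \<psi> (grid_noise r n (grid_increments n (fst z)) (snd z), grid_increments n (fst z)) \<partial>(M \<Otimes>\<^sub>M std_normal4))"
proof -
  interpret S: prob_space std_normal4 by (rule prob_space_std_normal4)
  interpret P: pair_prob_space M std_normal4 ..
  note [measurable] = measurable_grid_increments measurable_grid_bridges
  have fst_m: "(\<lambda>z. fst z) \<in> borel_measurable (borel :: ((bool \<times> nat \<Rightarrow> real) \<times> (bool \<times> nat \<Rightarrow> real)) measure)"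
    by (intro borel_measurable_continuous_onI continuous_intros)
  have snd_m: "(\<lambda>z. snd z) \<in> borel_measurable (borel :: ((bool \<times> nat \<Rightarrow> real) \<times> (bool \<times> nat \<Rightarrow> real)) measure)"
    by (intro borel_measurable_continuous_onI continuous_intros)
  note coord = measurable_compose[OF fst_m measurable_coordinate] measurable_compose[OF snd_m measurable_coordinate]
  have m1: "(\<lambda>z. \<psi> (main_error n (snd z) (fst z), snd z)) \<in> borel_measurable (borel :: ((bool \<times> nat \<Rightarrow> real) \<times> (bool \<times> nat \<Rightarrow> real)) measure)"
    by (intro measurable_compose[OF _ \<psi>] borel_measurable_Pair measurable_main_error coord snd_m)
  have "(\<integral>\<omega>. \<psi> (main_error n (grid_increments n \<omega>) (grid_bridges n \<omega>), grid_increments n \<omega>) \<partial>M)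
    = (\<integral>\<omega>. (\<integral>\<omega>'. \<psi> (main_error n (grid_increments n \<omega>) (grid_bridges n \<omega>'), grid_increments n \<omega>) \<partial>M) \<partial>M)"
    using bridges_independent_of_increments[OF n m1 bnd] by simp
  also have "\<dots> = (\<integral>\<omega>. (\<integral>x. \<psi> (grid_noise r n (grid_increments n \<omega>) x, grid_increments n \<omega>) \<partial>std_normal4) \<partial>M)"
  proof (rule Bochner_Integration.integral_cong[OF refl])
    fix \<omega>
    define g where "g = grid_increments n \<omega>"
    have [measurable]: "(\<lambda>\<omega>'. main_error n g (grid_bridges n \<omega>')) \<in> borel_measurable M"
      by (intro measurable_main_error) auto
    have [measurable]: "(\<lambda>x. grid_noise r n g x) \<in> borel_measurable std_normal4"
      by (intro measurable_grid_noise) (auto simp: measurable_ident_sets sets_std_normal4)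
    have law: "distr M borel (\<lambda>\<omega>'. main_error n g (grid_bridges n \<omega>')) = distr std_normal4 borel (\<lambda>x. grid_noise r n g x)"
      by (rule charfun_determines_law_vec[OF prob_space_axioms prob_space_std_normal4])
         (auto simp: main_error_charfun[OF n])
    have [measurable]: "(\<lambda>v. \<psi> (v, g)) \<in> borel_measurable borel"
      by (intro measurable_compose[OF _ \<psi>] borel_measurable_Pair) auto
    have "(\<integral>\<omega>'. \<psi> (main_error n g (grid_bridges n \<omega>'), g) \<partial>M) = (\<integral>v. \<psi> (v, g) \<partial>distr M borel (\<lambda>\<omega>'. main_error n g (grid_bridges n \<omega>')))"
      by (subst integral_distr) auto
    also have "\<dots> = (\<integral>x. \<psi> (grid_noise r n g x, g) \<partial>std_normal4)"
      unfolding law by (subst integral_distr) auto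
    finally show "(\<integral>\<omega>'. \<psi> (main_error n g (grid_bridges n \<omega>'), g) \<partial>M) = (\<integral>x. \<psi> (grid_noise r n g x, g) \<partial>std_normal4)" .
  qed
  also have "\<dots> = (\<integral>z. \<psi> (grid_noise r n (grid_increments n (fst z)) (snd z), grid_increments n (fst z)) \<partial>(M \<Otimes>\<^sub>M std_normal4))"
  proof -
    have i: "(\<lambda>z. grid_increments n (fst z) i) \<in> borel_measurable (M \<Otimes>\<^sub>M std_normal4)" for i by measurable
    have s: "snd \<in> (M \<Otimes>\<^sub>M std_normal4) \<rightarrow>\<^sub>M borel"
      using measurable_snd[of M std_normal4] by (simp cong: measurable_cong_sets add: sets_std_normal4)
    have m: "(\<lambda>z. \<psi> (grid_noise r n (grid_increments n (fst z)) (snd z), grid_increments n (fst z))) \<in> borel_measurable (M \<Otimes>\<^sub>M std_normal4)"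
      by (intro measurable_compose[OF _ \<psi>] borel_measurable_Pair measurable_grid_noise measurable_coordinatewise_then_product i s)
    have "integrable (M \<Otimes>\<^sub>M std_normal4) (\<lambda>z. \<psi> (grid_noise r n (grid_increments n (fst z)) (snd z), grid_increments n (fst z)))"
      by (rule P.integrable_const_bound[of _ C]) (use bnd m in auto)
    from P.integral_fst'[OF this] show ?thesis by simp
  qed
  finally show ?thesis .
qed

end

section \<open>Pathwise decomposition of the error\<close>

text \<open>
  What is left of the scaled error besides boundary terms and the leading term; all summands tend to zero
  in probability along Brownian paths.
\<close>

definition discretisation_error :: "nat \<Rightarrow> (real \<Rightarrow> real) \<Rightarrow> (real \<Rightarrow> real) \<Rightarrow> real"
  where "discretisation_error n f g = product_remainder n f g
    + (integral {0..1} f - left_mean n f) * (real n * (\<Sum>k<n. bridge_integral n g k))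
    + f 1 / 2 * (left_mean n g - integral {0..1} g)"

text \<open>
  The product of the two means is expanded as
  \<open>(S\<^sub>f - \<integral>f) S\<^sub>g + \<integral>f (S\<^sub>g - \<integral>g)\<close>, where \<open>S\<^sub>f\<close> and \<open>S\<^sub>g\<close> are the left means, and \<open>left_mean_error\<close> is applied
  to both factors. The first line is a component of \<open>mu_vec\<close>.
\<close>

lemma A_n_decomposition:
  assumes f: "continuous_on {0..1} f" and g: "continuous_on {0..1} g" and f0: "f 0 = 0" and g0: "g 0 = 0" and n: "n \<ge> 1"
  shows "real n * (A_n n f g - A f g) = (f 1 * integral {0..1} g + g 1 * integral {0..1} f - f 1 * g 1) / 2
     - real n * (\<Sum>k<n. (f (real k / n) - left_mean n f) * bridge_integral n g k + (g (real k / n) - left_mean n g) * bridge_integral n f k)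
     + discretisation_error n f g"
proof -
  define Sf Sg If Ig Bf Bg where "Sf = left_mean n f" and "Sg = left_mean n g" and "If = integral {0..1} f" and "Ig = integral {0..1} g"
    and "Bf = (\<Sum>k<n. bridge_integral n f k)" and "Bg = (\<Sum>k<n. bridge_integral n g k)"
  define P where "P = (\<Sum>k<n. f (real k / n) * bridge_integral n g k + g (real k / n) * bridge_integral n f k)"
  have ef: "real n * Sf = real n * If - f 1 / 2 - real n * Bf" and eg: "real n * Sg = real n * Ig - g 1 / 2 - real n * Bg"
    using left_mean_error[OF f n] left_mean_error[OF g n] f0 g0
    by (auto simp: Sf_def Sg_def If_def Ig_def Bf_def Bg_def right_diff_distrib)
  have sp: "(\<Sum>k<n. (f (real k / n) - left_mean n f) * bridge_integral n g k + (g (real k / n) - left_mean n g) * bridge_integral n f k)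
     = P - Sf * Bg - Sg * Bf"
    by (simp add: P_def Sf_def Sg_def Bf_def Bg_def sum_distrib_left sum_subtractf[symmetric] sum.distrib[symmetric] algebra_simps)
  have pr: "real n * (left_mean n (\<lambda>t. f t * g t) - integral {0..1} (\<lambda>t. f t * g t)) = product_remainder n f g - f 1 * g 1 / 2 - real n * P"
    by (simp add: product_remainder_def P_def f0 g0)
  have "real n * (A_n n f g - A f g) = product_remainder n f g - f 1 * g 1 / 2 - real n * P - real n * Sf * Sg + real n * (If * Ig)"
    using pr unfolding A_n_left_mean A_def Sf_def[symmetric] Sg_def[symmetric] If_def[symmetric] Ig_def[symmetric]
    by (simp add: algebra_simps)
  also have "\<dots> = (f 1 * Ig + g 1 * If - f 1 * g 1) / 2 - real n * (P - Sf * Bg - Sg * Bf)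
     + (product_remainder n f g + (If - Sf) * (real n * Bg) + f 1 / 2 * (Sg - Ig))"
  proof -
    define N where "N = real n"
    have ef': "N * Sf = N * If - f 1 / 2 - N * Bf" and eg': "N * Sg = N * Ig - g 1 / 2 - N * Bg"
      using ef eg by (simp_all add: N_def)
    have e1: "f 1 = 2 * (N * If - N * Sf - N * Bf)" and e2: "g 1 = 2 * (N * Ig - N * Sg - N * Bg)" using ef' eg' by auto
    show ?thesis unfolding N_def[symmetric] e1 e2 by (simp add: field_simps)
  qed
  finally show ?thesis
    unfolding sp discretisation_error_def Sf_def Sg_def If_def Ig_def Bf_def Bg_def .
qed

lemma mu_vec_eq: "mu_vec f g = vector [(f 1 * integral {0..1} g + g 1 * integral {0..1} f - f 1 * g 1) / 2,
    (f 1 * integral {0..1} f + f 1 * integral {0..1} f - f 1 * f 1) / 2, (g 1 * integral {0..1} g + g 1 * integral {0..1} g - g 1 * g 1) / 2]"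
  unfolding mu_vec_def Let_def by (simp add: power2_eq_square add_divide_distrib diff_divide_distrib)

lemma A_n_eq_scov:
  assumes "n \<ge> 1"
  shows "A_n n f g = scov n (\<lambda>k. f (real k / n)) (\<lambda>k. g (real k / n))"
  using assms by (simp add: A_n_left_mean scov_eq smean_def left_mean_def)

lemma A_nonneg:
  assumes f: "continuous_on {0..1} f"
  shows "0 \<le> A f f"
  by (rule LIMSEQ_le_const[OF A_n_tendsto[OF f f]]) (auto simp: A_n_eq_scov intro!: exI[of _ 1] scov_nonneg)

lemma A_Cauchy_Schwarz:
  assumes f: "continuous_on {0..1} f" and g: "continuous_on {0..1} g"
  shows "(A f g)\<^sup>2 \<le> A f f * A g g"
  by (rule LIMSEQ_le[OF tendsto_power[OF A_n_tendsto[OF f g]] tendsto_mult[OF A_n_tendsto[OF f f] A_n_tendsto[OF g g]]])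
     (auto simp: A_n_eq_scov intro!: exI[of _ 1] scov_Cauchy_Schwarz)

text \<open>
  The variance is the integral of the nonnegative continuous function \<open>(f - m)\<^sup>2\<close>.
\<close>

lemma A_zero_imp_constant:
  assumes f: "continuous_on {0..1} f" and z: "A f f = 0" and s: "s \<in> {0..1}" and t: "t \<in> {0..1}"
  shows "f s = f t"
proof -
  define m where "m = integral {0..1} f"
  have c: "continuous_on {0..1} (\<lambda>t. (f t - m)\<^sup>2)" using f by (intro continuous_intros)
  have "integral {0..1} (\<lambda>t. (f t - m)\<^sup>2) = integral {0..1} (\<lambda>t. f t * f t - 2 * m * f t + m\<^sup>2)"
    by (intro integral_cong) (simp add: power2_eq_square algebra_simps)
  also have "\<dots> = integral {0..1} (\<lambda>t. f t * f t) - 2 * m * m + m\<^sup>2"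
  proof -
    have i: "(\<lambda>t. f t * f t) integrable_on {0..1}" "f integrable_on {0..1}"
      using f by (auto intro!: integrable_continuous_real continuous_intros)
    have hc: "((\<lambda>t::real. m\<^sup>2) has_integral m\<^sup>2) {0..1}"
      using has_integral_const_real[of "m\<^sup>2" 0 1] by simp
    have hm: "((\<lambda>t. 2 * m * f t) has_integral 2 * m * m) {0..1}"
      unfolding m_def using i(2) by (intro has_integral_mult_right integrable_integral)
    have "((\<lambda>t. f t * f t - 2 * m * f t + m\<^sup>2) has_integral (integral {0..1} (\<lambda>t. f t * f t) - 2 * m * m + m\<^sup>2)) {0..1}"
      using i(1) by (intro has_integral_add has_integral_diff hc hm integrable_integral)
    then show ?thesis by (simp add: integral_unique)
  qed
  also have "\<dots> = A f f" by (simp add: A_def m_def power2_eq_square)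
  finally have "integral {0..1} (\<lambda>t. (f t - m)\<^sup>2) = 0" using z by simp
  then have "\<forall>x\<in>{0..1}. (f x - m)\<^sup>2 = 0"
    using integral_eq_0_iff[OF c] by simp
  then show ?thesis using s t by auto
qed

section \<open>Convergence of the empirical moments and nondegeneracy\<close>

context brownian_pair begin

lemma start_zero: "AE \<omega> in M. X \<omega> 0 = 0 \<and> Y \<omega> 0 = 0"
proof -
  have "AE \<omega> in M. X \<omega> 0 * X \<omega> 0 = 0" "AE \<omega> in M. Y \<omega> 0 * Y \<omega> 0 = 0"
    using covX[of 0 0] covY[of 0 0] integrable_mult_mem[OF X_mem X_mem, of 0 0] integrable_mult_mem[OF Y_mem Y_mem, of 0 0]
    by (auto simp: integral_nonneg_eq_0_iff_AE)
  then show ?thesis by auto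
qed

lemma path_of_grid_increments:
  assumes n: "n \<ge> 1" and k: "k \<le> n"
  shows "path_of True (grid_increments n \<omega>) k = X \<omega> (real k / n) - X \<omega> 0"
    "path_of False (grid_increments n \<omega>) k = Y \<omega> (real k / n) - Y \<omega> 0"
proof -
  have "path_of b (grid_increments n \<omega>) k = (\<Sum>j<k. (if b then X \<omega> else Y \<omega>) (real (Suc j) / n) - (if b then X \<omega> else Y \<omega>) (real j / n))" for b
    unfolding path_of_def using k by (intro sum.cong) (auto simp: grid_increments_def add.commute)
  then have "path_of b (grid_increments n \<omega>) k = (if b then X \<omega> else Y \<omega>) (real k / n) - (if b then X \<omega> else Y \<omega>) 0" for b
    using sum_lessThan_telescope[of "\<lambda>j. (if b then X \<omega> else Y \<omega>) (real j / n)" k] by simp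
  from this[of True] this[of False]
  show "path_of True (grid_increments n \<omega>) k = X \<omega> (real k / n) - X \<omega> 0"
    "path_of False (grid_increments n \<omega>) k = Y \<omega> (real k / n) - Y \<omega> 0" by simp_all
qed

abbreviation sXX :: "nat \<Rightarrow> (bool \<times> nat \<Rightarrow> real) \<Rightarrow> real" where "sXX n g \<equiv> scov n (path_of True g) (path_of True g)"
abbreviation sYY :: "nat \<Rightarrow> (bool \<times> nat \<Rightarrow> real) \<Rightarrow> real" where "sYY n g \<equiv> scov n (path_of False g) (path_of False g)"
abbreviation sXY :: "nat \<Rightarrow> (bool \<times> nat \<Rightarrow> real) \<Rightarrow> real" where "sXY n g \<equiv> scov n (path_of True g) (path_of False g)"

lemma scov_grid:
  assumes n: "n \<ge> 1" and z: "X \<omega> 0 = 0" "Y \<omega> 0 = 0"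
  shows "sXX n (grid_increments n \<omega>) = A_n n (X \<omega>) (X \<omega>)" "sYY n (grid_increments n \<omega>) = A_n n (Y \<omega>) (Y \<omega>)"
    "sXY n (grid_increments n \<omega>) = A_n n (X \<omega>) (Y \<omega>)"
    "smean n (path_of True (grid_increments n \<omega>)) = left_mean n (X \<omega>)" "smean n (path_of False (grid_increments n \<omega>)) = left_mean n (Y \<omega>)"
proof -
  have s: "smean n a = smean n b" if "\<And>k. k < n \<Longrightarrow> a k = b k" for a b
    unfolding smean_def using that by (auto intro!: arg_cong[where f = "\<lambda>x. x / real n"] sum.cong)
  have x: "path_of True (grid_increments n \<omega>) k = X \<omega> (real k / n)" "path_of False (grid_increments n \<omega>) k = Y \<omega> (real k / n)" if "k < n" for k
    using path_of_grid_increments[OF n, of k] that z by simp_all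
  show *: "smean n (path_of True (grid_increments n \<omega>)) = left_mean n (X \<omega>)" "smean n (path_of False (grid_increments n \<omega>)) = left_mean n (Y \<omega>)"
    using s[of "path_of True (grid_increments n \<omega>)" "\<lambda>k. X \<omega> (real k / n)"] s[of "path_of False (grid_increments n \<omega>)" "\<lambda>k. Y \<omega> (real k / n)"] x
    by (auto simp: smean_def left_mean_def)
  show "sXX n (grid_increments n \<omega>) = A_n n (X \<omega>) (X \<omega>)" "sYY n (grid_increments n \<omega>) = A_n n (Y \<omega>) (Y \<omega>)"
    "sXY n (grid_increments n \<omega>) = A_n n (X \<omega>) (Y \<omega>)"
    unfolding scov_eq[OF n] A_n_left_mean * unfolding smean_def left_mean_def using x by (auto intro!: arg_cong[where f = "\<lambda>x. x / real n"] sum.cong)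
qed

lemma AE_limits: "AE \<omega> in M. (\<lambda>n. sXX n (grid_increments n \<omega>)) \<longlonglongrightarrow> A (X \<omega>) (X \<omega>) \<and>
   (\<lambda>n. sYY n (grid_increments n \<omega>)) \<longlonglongrightarrow> A (Y \<omega>) (Y \<omega>) \<and> (\<lambda>n. sXY n (grid_increments n \<omega>)) \<longlonglongrightarrow> A (X \<omega>) (Y \<omega>) \<and>
   (\<lambda>n. bernstein_path n (path_of True (grid_increments n \<omega>))) \<longlonglongrightarrow> to_C01 (X \<omega>) \<and>
   (\<lambda>n. bernstein_path n (path_of False (grid_increments n \<omega>))) \<longlonglongrightarrow> to_C01 (Y \<omega>)"
  using start_zero AE_space
proof eventually_elim
  case (elim \<omega>)
  have ev: "\<forall>\<^sub>F n in sequentially. n \<ge> (1::nat)" by (rule eventually_ge_at_top)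
  note c = contX[OF elim(2)] contY[OF elim(2)]
  show ?case
    apply (intro conjI bernstein_path_tendsto c)
    subgoal by (rule Lim_transform_eventually[OF A_n_tendsto[OF c(1) c(1)]]) (rule eventually_mono[OF ev], use elim in \<open>simp add: scov_grid\<close>)
    subgoal by (rule Lim_transform_eventually[OF A_n_tendsto[OF c(2) c(2)]]) (rule eventually_mono[OF ev], use elim in \<open>simp add: scov_grid\<close>)
    subgoal by (rule Lim_transform_eventually[OF A_n_tendsto[OF c(1) c(2)]]) (rule eventually_mono[OF ev], use elim in \<open>simp add: scov_grid\<close>)
    subgoal using elim by (simp add: path_of_grid_increments)
    subgoal using elim by (simp add: path_of_grid_increments)
    done
qed

lemma brownian_in_combination: "brownian_in (Q a b) (\<lambda>\<omega> t. a * X \<omega> t + b * Y \<omega> t)"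
  unfolding brownian_in_def
proof (intro conjI ballI)
  fix t :: real assume t: "t \<in> {0..1}"
  then show "(\<lambda>\<omega>. a * X \<omega> t + b * Y \<omega> t) \<in> H" by (intro lin_mem X_mem Y_mem)
  fix s :: real assume s: "s \<in> {0..1}"
  have i: "integrable M (\<lambda>\<omega>. X \<omega> t * X \<omega> s)" "integrable M (\<lambda>\<omega>. Y \<omega> t * Y \<omega> s)" "integrable M (\<lambda>\<omega>. X \<omega> t * Y \<omega> s)" "integrable M (\<lambda>\<omega>. Y \<omega> t * X \<omega> s)"
    using s t by (auto intro!: integrable_mult_mem X_mem Y_mem simp del: atLeastAtMost_iff)
  have e: "(a * X \<omega> t + b * Y \<omega> t) * (a * X \<omega> s + b * Y \<omega> s) = a\<^sup>2 * (X \<omega> t * X \<omega> s) + b\<^sup>2 * (Y \<omega> t * Y \<omega> s)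
      + a * b * (X \<omega> t * Y \<omega> s) + a * b * (Y \<omega> t * X \<omega> s)" for \<omega>
    by (simp add: power2_eq_square algebra_simps)
  show "(\<integral>\<omega>. (a * X \<omega> t + b * Y \<omega> t) * (a * X \<omega> s + b * Y \<omega> s) \<partial>M) = Q a b * min t s"
  proof -
    have "(\<integral>\<omega>. (a * X \<omega> t + b * Y \<omega> t) * (a * X \<omega> s + b * Y \<omega> s) \<partial>M) = a\<^sup>2 * (\<integral>\<omega>. X \<omega> t * X \<omega> s \<partial>M)
       + b\<^sup>2 * (\<integral>\<omega>. Y \<omega> t * Y \<omega> s \<partial>M) + a * b * (\<integral>\<omega>. X \<omega> t * Y \<omega> s \<partial>M) + a * b * (\<integral>\<omega>. Y \<omega> t * X \<omega> s \<partial>M)"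
      unfolding e using i by simp
    also have "\<dots> = Q a b * min t s"
      unfolding covX[OF t s] covY[OF t s] covXY[OF t s] covYX[OF t s] Q_def by (simp add: algebra_simps)
    finally show ?thesis .
  qed
qed

definition qv :: "nat \<Rightarrow> real \<Rightarrow> real \<Rightarrow> 'a \<Rightarrow> real"
  where "qv n a b \<omega> = (\<Sum>k<n. (a * dX (real k / n) ((real k + 1) / n) \<omega> + b * dY (real k / n) ((real k + 1) / n) \<omega>)\<^sup>2)"

lemma qv_polarization: "qv n a b \<omega> = a\<^sup>2 * qv n 1 0 \<omega> + b\<^sup>2 * qv n 0 1 \<omega> + a * b * (qv n 1 1 \<omega> - qv n 1 0 \<omega> - qv n 0 1 \<omega>)"
  unfolding qv_def sum_distrib_left sum_subtractf[symmetric] sum.distrib[symmetric]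
  by (intro sum.cong) (auto simp: power2_eq_square algebra_simps)

text \<open>
  A single subsequence and a single null set serve all combinations at once, by polarisation. This matters
  because the combination to which the lemma will be applied is random.
\<close>

lemma quadratic_variation_subsequence:
  obtains \<rho> :: "nat \<Rightarrow> nat" where "AE \<omega> in M. \<forall>a b. (\<lambda>i. qv (Suc (\<rho> i)) a b \<omega>) \<longlonglongrightarrow> Q a b"
proof -
  have Ve: "qv (Suc n) a b \<omega> = (\<Sum>k<Suc n. ((\<lambda>t. a * X \<omega> t + b * Y \<omega> t) ((real k + 1) / Suc n) - (\<lambda>t. a * X \<omega> t + b * Y \<omega> t) (real k / Suc n))\<^sup>2)" for n a b \<omega>
    unfolding qv_def by (intro sum.cong) (auto simp: algebra_simps)
  have i: "integrable M (\<lambda>\<omega>. \<bar>qv (Suc n) a b \<omega> - Q a b\<bar>)" for n a b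
    using brownian_quadratic_variation(1)[OF brownian_in_combination, of "Suc n" 1 a b] unfolding Ve by simp
  have le: "(\<integral>\<omega>. \<bar>qv (Suc n) a b \<omega> - Q a b\<bar> \<partial>M) \<le> Q a b * sqrt (2 / Suc n)" for n a b
    using brownian_quadratic_variation(2)[OF brownian_in_combination, of "Suc n" 1 a b] unfolding Ve by simp
  define u where "u n \<omega> = \<bar>qv (Suc n) 1 0 \<omega> - Q 1 0\<bar> + \<bar>qv (Suc n) 0 1 \<omega> - Q 0 1\<bar> + \<bar>qv (Suc n) 1 1 \<omega> - Q 1 1\<bar>" for n \<omega>
  have ui: "integrable M (u n)" for n unfolding u_def using i by (intro Bochner_Integration.integrable_add)
  have "(\<lambda>n. \<integral>\<omega>. norm (u n \<omega>) \<partial>M) \<longlonglongrightarrow> 0"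
  proof (rule Lim_null_comparison)
    have "(\<integral>\<omega>. norm (u n \<omega>) \<partial>M) \<le> (Q 1 0 + Q 0 1 + Q 1 1) * sqrt (2 / Suc n)" for n
      using le[of n 1 0] le[of n 0 1] le[of n 1 1] i by (simp add: u_def distrib_right)
    then show "\<forall>\<^sub>F n in sequentially. norm (\<integral>\<omega>. norm (u n \<omega>) \<partial>M) \<le> (Q 1 0 + Q 0 1 + Q 1 1) * sqrt (2 / Suc n)"
      by (auto intro!: always_eventually)
    show "(\<lambda>n. (Q 1 0 + Q 0 1 + Q 1 1) * sqrt (2 / real (Suc n))) \<longlonglongrightarrow> 0"
      by real_asymp
  qed
  from tendsto_L1_AE_subseq[OF ui this] obtain \<rho> where \<rho>: "AE \<omega> in M. (\<lambda>i. u (\<rho> i) \<omega>) \<longlonglongrightarrow> 0" by blast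
  have "AE \<omega> in M. \<forall>a b. (\<lambda>i. qv (Suc (\<rho> i)) a b \<omega>) \<longlonglongrightarrow> Q a b"
    using \<rho>
  proof eventually_elim
    case (elim \<omega>)
    have c: "(\<lambda>i. qv (Suc (\<rho> i)) a b \<omega>) \<longlonglongrightarrow> Q a b" if "\<And>n. \<bar>qv (Suc n) a b \<omega> - Q a b\<bar> \<le> u n \<omega>" for a b
    proof -
      have "(\<lambda>i. qv (Suc (\<rho> i)) a b \<omega> - Q a b) \<longlonglongrightarrow> 0"
        by (rule Lim_null_comparison[OF _ elim]) (use that in \<open>auto intro!: always_eventually\<close>)
      then show ?thesis by (rule LIM_zero_cancel)
    qed
    have "(\<lambda>i. qv (Suc (\<rho> i)) 1 0 \<omega>) \<longlonglongrightarrow> Q 1 0" "(\<lambda>i. qv (Suc (\<rho> i)) 0 1 \<omega>) \<longlonglongrightarrow> Q 0 1" "(\<lambda>i. qv (Suc (\<rho> i)) 1 1 \<omega>) \<longlonglongrightarrow> Q 1 1"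
      by (rule c, simp add: u_def)+
    then have "(\<lambda>i. qv (Suc (\<rho> i)) a b \<omega>) \<longlonglongrightarrow> a\<^sup>2 * Q 1 0 + b\<^sup>2 * Q 0 1 + a * b * (Q 1 1 - Q 1 0 - Q 0 1)" for a b
      by (subst qv_polarization) (intro tendsto_intros)
    moreover have "a\<^sup>2 * Q 1 0 + b\<^sup>2 * Q 0 1 + a * b * (Q 1 1 - Q 1 0 - Q 0 1) = Q a b" for a b
      by (simp add: Q_def algebra_simps)
    ultimately show ?case by simp
  qed
  then show ?thesis by (rule that)
qed

lemma Q_eq_0:
  assumes "Q a b = 0" shows "a = 0 \<and> b = 0"
proof -
  have "Q a b = (a + r * b)\<^sup>2 + (1 - r\<^sup>2) * b\<^sup>2" by (simp add: Q_def power2_eq_square algebra_simps)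
  moreover have "r\<^sup>2 < 1" using r by (simp add: abs_square_less_1)
  ultimately have "(a + r * b)\<^sup>2 = 0" "(1 - r\<^sup>2) * b\<^sup>2 = 0"
    using assms by (smt (verit) mult_nonneg_nonneg zero_le_power2)+
  then show ?thesis using \<open>r\<^sup>2 < 1\<close> by auto
qed

text \<open>
  If one of the inequalities failed, some \<open>a X + b Y\<close> with \<open>(a, b) \<noteq> 0\<close> would have vanishing variance, that
  is, be constant; its quadratic variation would be zero instead of \<open>Q a b > 0\<close>.
\<close>

lemma AE_nondegenerate:
  "AE \<omega> in M. 0 < A (X \<omega>) (X \<omega>) \<and> 0 < A (Y \<omega>) (Y \<omega>) \<and> (A (X \<omega>) (Y \<omega>))\<^sup>2 < A (X \<omega>) (X \<omega>) * A (Y \<omega>) (Y \<omega>)"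
proof -
  obtain \<rho> where "AE \<omega> in M. \<forall>a b. (\<lambda>i. qv (Suc (\<rho> i)) a b \<omega>) \<longlonglongrightarrow> Q a b"
    by (rule quadratic_variation_subsequence)
  then show ?thesis
    using AE_space
  proof eventually_elim
    case (elim \<omega>)
    note cX = contX[OF elim(2)] and cY = contY[OF elim(2)]
    have deg: "a = 0 \<and> b = 0" if z: "A (\<lambda>t. a * X \<omega> t + b * Y \<omega> t) (\<lambda>t. a * X \<omega> t + b * Y \<omega> t) = 0" for a b
    proof -
      have c: "continuous_on {0..1} (\<lambda>t. a * X \<omega> t + b * Y \<omega> t)" using cX cY by (intro continuous_intros)
      have "qv n a b \<omega> = 0" for n
        unfolding qv_def
      proof (intro sum.neutral ballI)
        fix k assume "k \<in> {..<n}"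
        then have "a * X \<omega> (real k / n) + b * Y \<omega> (real k / n) = a * X \<omega> ((real k + 1) / n) + b * Y \<omega> ((real k + 1) / n)"
          using A_zero_imp_constant[OF c z, of "real k / n" "(real k + 1) / n"] block_mem by simp
        then show "(a * dX (real k / n) ((real k + 1) / n) \<omega> + b * dY (real k / n) ((real k + 1) / n) \<omega>)\<^sup>2 = 0"
          by (simp add: algebra_simps)
      qed
      then have "Q a b = 0" using elim(1)[rule_format, of a b] by (simp add: tendsto_const_iff)
      then show ?thesis by (rule Q_eq_0)
    qed
    have bil: "A (\<lambda>t. a * X \<omega> t + b * Y \<omega> t) (\<lambda>t. a * X \<omega> t + b * Y \<omega> t)
      = a\<^sup>2 * A (X \<omega>) (X \<omega>) + b\<^sup>2 * A (Y \<omega>) (Y \<omega>) + 2 * a * b * A (X \<omega>) (Y \<omega>)" for a b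
    proof (rule LIMSEQ_unique)
      show "(\<lambda>n. A_n n (\<lambda>t. a * X \<omega> t + b * Y \<omega> t) (\<lambda>t. a * X \<omega> t + b * Y \<omega> t))
        \<longlonglongrightarrow> A (\<lambda>t. a * X \<omega> t + b * Y \<omega> t) (\<lambda>t. a * X \<omega> t + b * Y \<omega> t)"
        by (intro A_n_tendsto continuous_intros cX cY)
      have "A_n n (\<lambda>t. a * X \<omega> t + b * Y \<omega> t) (\<lambda>t. a * X \<omega> t + b * Y \<omega> t)
        = a\<^sup>2 * A_n n (X \<omega>) (X \<omega>) + b\<^sup>2 * A_n n (Y \<omega>) (Y \<omega>) + 2 * a * b * A_n n (X \<omega>) (Y \<omega>)" for n
      proof -
        have l: "left_mean n (\<lambda>t. a * X \<omega> t + b * Y \<omega> t) = a * left_mean n (X \<omega>) + b * left_mean n (Y \<omega>)"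
          by (simp add: left_mean_def sum.distrib sum_distrib_left add_divide_distrib)
        have p: "left_mean n (\<lambda>t. (a * X \<omega> t + b * Y \<omega> t) * (a * X \<omega> t + b * Y \<omega> t)) = a\<^sup>2 * left_mean n (\<lambda>t. X \<omega> t * X \<omega> t)
           + b\<^sup>2 * left_mean n (\<lambda>t. Y \<omega> t * Y \<omega> t) + 2 * a * b * left_mean n (\<lambda>t. X \<omega> t * Y \<omega> t)"
          unfolding left_mean_def sum_divide_distrib sum_distrib_left sum.distrib[symmetric]
          by (intro sum.cong) (auto simp: power2_eq_square add_divide_distrib algebra_simps)
        show ?thesis unfolding A_n_left_mean l p by (simp add: power2_eq_square algebra_simps)
      qed
      then show "(\<lambda>n. A_n n (\<lambda>t. a * X \<omega> t + b * Y \<omega> t) (\<lambda>t. a * X \<omega> t + b * Y \<omega> t))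
        \<longlonglongrightarrow> a\<^sup>2 * A (X \<omega>) (X \<omega>) + b\<^sup>2 * A (Y \<omega>) (Y \<omega>) + 2 * a * b * A (X \<omega>) (Y \<omega>)"
        by (simp only:) (intro tendsto_intros A_n_tendsto cX cY)
    qed
    have p1: "0 < A (X \<omega>) (X \<omega>)"
      using deg[of 1 0] bil[of 1 0] A_nonneg[OF cX] by (cases "A (X \<omega>) (X \<omega>) = 0") auto
    have p2: "0 < A (Y \<omega>) (Y \<omega>)"
      using deg[of 0 1] bil[of 0 1] A_nonneg[OF cY] by (cases "A (Y \<omega>) (Y \<omega>) = 0") auto
    have "(A (X \<omega>) (Y \<omega>))\<^sup>2 \<noteq> A (X \<omega>) (X \<omega>) * A (Y \<omega>) (Y \<omega>)"
    proof
      assume e: "(A (X \<omega>) (Y \<omega>))\<^sup>2 = A (X \<omega>) (X \<omega>) * A (Y \<omega>) (Y \<omega>)"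
      \<comment> \<open>equality in the Cauchy-Schwarz inequality: the residual of the regression of \<open>X\<close> on \<open>Y\<close> has no variance\<close>
      define a where "a = A (Y \<omega>) (Y \<omega>)"
      define b where "b = - A (X \<omega>) (Y \<omega>)"
      have "A (\<lambda>t. a * X \<omega> t + b * Y \<omega> t) (\<lambda>t. a * X \<omega> t + b * Y \<omega> t)
        = A (Y \<omega>) (Y \<omega>) * (A (X \<omega>) (X \<omega>) * A (Y \<omega>) (Y \<omega>) - (A (X \<omega>) (Y \<omega>))\<^sup>2)"
        unfolding bil by (simp add: a_def b_def power2_eq_square algebra_simps)
      then have "a = 0 \<and> b = 0" using e by (intro deg) simp
      then show False using p2 by (simp add: a_def)
    qed
    with A_Cauchy_Schwarz[OF cX cY] p1 p2 show ?case by auto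
  qed
qed

end

section \<open>The remainder tends to zero in probability\<close>

context prob_space begin

lemma null_in_prob_cong:
  assumes X: "null_in_prob M X" and Y: "\<And>n. Y n \<in> borel_measurable M" and e: "\<And>n. n \<ge> 1 \<Longrightarrow> AE \<omega> in M. Y n \<omega> = X n \<omega>"
  shows "null_in_prob M Y"
proof (rule null_in_prob_mono_AE[OF X Y])
  fix n :: nat assume "n \<ge> 1"
  from e[OF this] show "AE \<omega> in M. \<bar>Y n \<omega>\<bar> \<le> \<bar>X n \<omega>\<bar>" by eventually_elim simp
qed

lemma null_in_prob_cmult: "null_in_prob M X \<Longrightarrow> null_in_prob M (\<lambda>n \<omega>. c * X n \<omega>)"
  using null_in_prob_mult_tight[of X "\<lambda>_ _. c"] tight_in_prob_const[of "\<lambda>_. c"] by (simp add: mult.commute)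

lemma null_in_prob_abs: "null_in_prob M X \<Longrightarrow> null_in_prob M (\<lambda>n \<omega>. \<bar>X n \<omega>\<bar>)"
  by (rule null_in_prob_mono_AE) (auto intro: borel_measurable_abs null_in_prob_measurable)

lemma tight_in_prob_AE_convergent:
  assumes X[measurable]: "\<And>n. X n \<in> borel_measurable M" and L[measurable]: "L \<in> borel_measurable M"
    and lim: "AE \<omega> in M. (\<lambda>n. X n \<omega>) \<longlonglongrightarrow> L \<omega>"
  shows "tight_in_prob M X"
proof -
  have "null_in_prob M (\<lambda>n \<omega>. X n \<omega> - L \<omega>)"
    by (rule null_in_prob_AE) (use lim in \<open>auto elim!: eventually_mono intro: LIM_zero\<close>)
  from tight_in_prob_add[OF null_in_prob_imp_tight[OF this] tight_in_prob_const[OF L]] show ?thesis by simp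
qed

end

lemma measurable_square_remainder:
  assumes X: "\<And>t. t \<in> {0..1} \<Longrightarrow> (\<lambda>\<omega>. X \<omega> t) \<in> borel_measurable M" and cX: "\<And>\<omega>. \<omega> \<in> space M \<Longrightarrow> continuous_on {0..1} (X \<omega>)"
  shows "(\<lambda>\<omega>. square_remainder n (X \<omega>)) \<in> borel_measurable M"
proof -
  have k01: "real k / real n \<in> {0..1}" if "k \<in> {..<n}" for k using that by auto
  have 1: "(\<lambda>\<omega>. (X \<omega> t)\<^sup>2) \<in> borel_measurable M" if "t \<in> {0..1}" for t using X[OF that] by measurable
  have 2: "continuous_on {0..1} (\<lambda>t. (X \<omega> t)\<^sup>2)" if "\<omega> \<in> space M" for \<omega> using cX[OF that] by (intro continuous_intros)
  have [measurable]: "(\<lambda>\<omega>. left_mean n (\<lambda>t. (X \<omega> t)\<^sup>2)) \<in> borel_measurable M" "(\<lambda>\<omega>. integral {0..1} (\<lambda>t. (X \<omega> t)\<^sup>2)) \<in> borel_measurable M"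
    using measurable_left_mean[of "\<lambda>\<omega> t. (X \<omega> t)\<^sup>2" M "\<lambda>\<omega> t. (X \<omega> t)\<^sup>2"] measurable_integral[of "\<lambda>\<omega> t. (X \<omega> t)\<^sup>2" M "\<lambda>\<omega> t. (X \<omega> t)\<^sup>2"] 1 2 by auto
  have [measurable]: "(\<lambda>\<omega>. X \<omega> 1) \<in> borel_measurable M" "(\<lambda>\<omega>. X \<omega> 0) \<in> borel_measurable M" using X by auto
  have [measurable]: "(\<lambda>\<omega>. \<Sum>k<n. X \<omega> (real k / real n) * bridge_integral n (X \<omega>) k) \<in> borel_measurable M"
    by (intro borel_measurable_sum borel_measurable_times X k01 measurable_bridge_integral cX) auto
  show ?thesis unfolding square_remainder_def by measurable
qed

context brownian_pair begin

text \<open>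
  Polarisation leads from products of the two paths to squares of their linear combinations.
\<close>

definition comb :: "real \<Rightarrow> real \<Rightarrow> 'a \<Rightarrow> real \<Rightarrow> real"
  where "comb a b \<omega> t = a * X \<omega> t + b * Y \<omega> t"

lemma comb_simps: "comb 1 0 = X" "comb 0 1 = Y"
  by (simp_all add: comb_def fun_eq_iff)

lemma measurable_comb: "t \<in> {0..1} \<Longrightarrow> (\<lambda>\<omega>. comb a b \<omega> t) \<in> borel_measurable M"
  unfolding comb_def by (intro borel_measurable_add borel_measurable_times borel_measurable_const measurable_X measurable_Y)

lemma continuous_comb: "\<omega> \<in> space M \<Longrightarrow> continuous_on {0..1} (comb a b \<omega>)"
  unfolding comb_def by (intro continuous_intros contX contY)

lemma null_square_remainder: "null_in_prob M (\<lambda>n \<omega>. square_remainder n (comb a b \<omega>))"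
proof (rule null_in_prob_L1)
  show "(\<lambda>\<omega>. square_remainder n (comb a b \<omega>)) \<in> borel_measurable M" for n
    by (intro measurable_square_remainder measurable_comb continuous_comb)
  show "(\<integral>\<^sup>+\<omega>. ennreal \<bar>square_remainder n (comb a b \<omega>)\<bar> \<partial>M) \<le> ennreal (2 * Q a b * sqrt (2 / n))" if "1 \<le> n" for n
    using brownian_square_remainder[OF brownian_in_combination _ that, of a b] continuous_comb by (simp add: comb_def[abs_def])
  show "(\<lambda>n. 2 * Q a b * sqrt (2 / real n)) \<longlonglongrightarrow> 0" by real_asymp
qed

lemma measurable_product_remainder: "(\<lambda>\<omega>. product_remainder n (comb a b \<omega>) (comb a' b' \<omega>)) \<in> borel_measurable M"
  and null_product_remainder: "null_in_prob M (\<lambda>n \<omega>. product_remainder n (comb a b \<omega>) (comb a' b' \<omega>))"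
proof -
  have e: "product_remainder n (comb a b \<omega>) (comb a' b' \<omega>)
      = 1 / 4 * square_remainder n (comb (a + a') (b + b') \<omega>) + (- 1 / 4) * square_remainder n (comb (a - a') (b - b') \<omega>)"
    if "\<omega> \<in> space M" for n \<omega>
  proof -
    have 1: "(\<lambda>t. comb a b \<omega> t + comb a' b' \<omega> t) = comb (a + a') (b + b') \<omega>" "(\<lambda>t. comb a b \<omega> t - comb a' b' \<omega> t) = comb (a - a') (b - b') \<omega>"
      by (auto simp: comb_def algebra_simps)
    show ?thesis
      unfolding product_remainder_polarization[OF continuous_comb[OF that] continuous_comb[OF that]] 1 by simp
  qed
  have n: "null_in_prob M (\<lambda>n \<omega>. 1 / 4 * square_remainder n (comb (a + a') (b + b') \<omega>) + (- 1 / 4) * square_remainder n (comb (a - a') (b - b') \<omega>))"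
    by (intro null_in_prob_add null_in_prob_cmult null_square_remainder)
  show m: "(\<lambda>\<omega>. product_remainder n (comb a b \<omega>) (comb a' b' \<omega>)) \<in> borel_measurable M" for n
    using null_in_prob_measurable[OF n, of n] by (subst measurable_cong[OF e])
  show "null_in_prob M (\<lambda>n \<omega>. product_remainder n (comb a b \<omega>) (comb a' b' \<omega>))"
    by (rule null_in_prob_cong[OF n m]) (use e in \<open>auto intro!: AE_I2\<close>)
qed

lemma bridge_integral_comb:
  assumes "\<omega> \<in> space M" "k < n"
  shows "bridge_integral n (comb a b \<omega>) k = a * bridge_integral n (X \<omega>) k + b * bridge_integral n (Y \<omega>) k"
proof -
  have "integral {real k / real n..(real k + 1) / real n} (comb a b \<omega>)
      = a * integral {real k / real n..(real k + 1) / real n} (X \<omega>) + b * integral {real k / real n..(real k + 1) / real n} (Y \<omega>)"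
    unfolding comb_def using block_integrable[OF contX[OF assms(1)] assms(2)] block_integrable[OF contY[OF assms(1)] assms(2)]
    by (subst integral_add) (auto intro: integrable_on_mult_right)
  then show ?thesis
    unfolding bridge_integral_def by (simp add: comb_def add_divide_distrib diff_divide_distrib algebra_simps)
qed

text \<open>
  The sums are centred normal with a variance that is the same for all \<open>n \<ge> 1\<close>.
\<close>

lemma tight_bridge_sum: "tight_in_prob M (\<lambda>n \<omega>. real n * (\<Sum>k<n. bridge_integral n (comb a b \<omega>) k))"
proof (rule tight_in_prob_same_law)
  have Q0: "0 \<le> Q a b"
  proof -
    have "Q a b = (a + r * b)\<^sup>2 + (1 - r\<^sup>2) * b\<^sup>2" by (simp add: Q_def power2_eq_square algebra_simps)
    moreover have "r\<^sup>2 \<le> 1" using r by (simp add: abs_square_le_1)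
    ultimately show ?thesis by simp
  qed
  define s where "s = sqrt (Q a b / 12)"
  have s: "0 \<le> s" "s\<^sup>2 = Q a b / 12" using Q0 by (auto simp: s_def)
  show m: "(\<lambda>\<omega>. real n * (\<Sum>k<n. bridge_integral n (comb a b \<omega>) k)) \<in> borel_measurable M" for n
    by (intro borel_measurable_times borel_measurable_const borel_measurable_sum measurable_bridge_integral measurable_comb continuous_comb) auto
  show "prob_space (normal_law 0 s)" "sets (normal_law 0 s) = sets borel"
    using real_distribution_normal_law[OF s(1)] by (auto simp: real_distribution_def real_distribution_axioms_def)
  show "distr M borel (\<lambda>\<omega>. real n * (\<Sum>k<n. bridge_integral n (comb a b \<omega>) k)) = normal_law 0 s" if n: "1 \<le> n" for n
  proof (rule distr_eq_normal_lawI[OF m s(1)])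
    fix t :: real
    have "t * (real n * (\<Sum>k<n. bridge_integral n (comb a b \<omega>) k)) = (\<Sum>k<n. 0 * dX (real k / n) ((real k + 1) / n) \<omega> + 0 * dY (real k / n) ((real k + 1) / n) \<omega>
       + (t * real n * a) * bridge_integral n (X \<omega>) k + (t * real n * b) * bridge_integral n (Y \<omega>) k)" if "\<omega> \<in> space M" for \<omega>
      unfolding sum_distrib_left using bridge_integral_comb[OF that] by (intro sum.cong) (auto simp: algebra_simps)
    then have "(CLINT \<omega>|M. iexp (t * (real n * (\<Sum>k<n. bridge_integral n (comb a b \<omega>) k))))
      = (CLINT \<omega>|M. iexp (\<Sum>k<n. 0 * dX (real k / n) ((real k + 1) / n) \<omega> + 0 * dY (real k / n) ((real k + 1) / n) \<omega>
       + (t * real n * a) * bridge_integral n (X \<omega>) k + (t * real n * b) * bridge_integral n (Y \<omega>) k))"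
      by (intro Bochner_Integration.integral_cong) auto
    also have "\<dots> = exp (- (\<Sum>k<n. Q 0 0 / n + Q (t * real n * a) (t * real n * b) / (12 * real n ^ 3)) / 2)"
      by (rule increments_bridges_charfun[OF n])
    also have "(\<Sum>k<n. Q 0 0 / n + Q (t * real n * a) (t * real n * b) / (12 * real n ^ 3)) = (s * t)\<^sup>2"
    proof -
      have "Q (t * real n * a) (t * real n * b) = (real n)\<^sup>2 * t\<^sup>2 * Q a b" by (simp add: Q_def power2_eq_square algebra_simps)
      then have "Q (t * real n * a) (t * real n * b) = (real n)\<^sup>2 * t\<^sup>2 * (12 * s\<^sup>2)" using s(2) by simp
      moreover have "Q 0 0 = 0" by (simp add: Q_def)
      ultimately show ?thesis using n by (simp add: field_simps power2_eq_square power3_eq_cube)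
    qed
    finally show "(CLINT \<omega>|M. iexp (t * (real n * (\<Sum>k<n. bridge_integral n (comb a b \<omega>) k)))) = exp (- (s * t)\<^sup>2 / 2)" .
  qed
qed

lemma null_left_mean: "null_in_prob M (\<lambda>n \<omega>. left_mean n (comb a b \<omega>) - integral {0..1} (comb a b \<omega>))"
proof (rule null_in_prob_AE)
  show "(\<lambda>\<omega>. left_mean n (comb a b \<omega>) - integral {0..1} (comb a b \<omega>)) \<in> borel_measurable M" for n
    using measurable_left_mean[of "comb a b" M "comb a b"] measurable_integral[of "comb a b" M "comb a b"] measurable_comb continuous_comb
    by (intro borel_measurable_diff) auto
  show "AE \<omega> in M. (\<lambda>n. left_mean n (comb a b \<omega>) - integral {0..1} (comb a b \<omega>)) \<longlonglongrightarrow> 0"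
    by (rule AE_I2) (intro LIM_zero left_mean_tendsto continuous_comb)
qed

lemma null_discretisation_error: "null_in_prob M (\<lambda>n \<omega>. discretisation_error n (comb a b \<omega>) (comb a' b' \<omega>))"
proof -
  have 1: "null_in_prob M (\<lambda>n \<omega>. ((-1) * (left_mean n (comb a b \<omega>) - integral {0..1} (comb a b \<omega>))) * (real n * (\<Sum>k<n. bridge_integral n (comb a' b' \<omega>) k)))"
    by (intro null_in_prob_mult_tight null_in_prob_cmult null_left_mean tight_bridge_sum)
  have "(\<lambda>\<omega>. comb a b \<omega> 1 / 2) \<in> borel_measurable M" using measurable_comb[of 1 a b] by simp
  then have 2: "null_in_prob M (\<lambda>n \<omega>. (left_mean n (comb a' b' \<omega>) - integral {0..1} (comb a' b' \<omega>)) * (comb a b \<omega> 1 / 2))"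
    by (intro null_in_prob_mult_tight null_left_mean tight_in_prob_const)
  from null_in_prob_add[OF null_in_prob_add[OF null_product_remainder 1] 2]
  show ?thesis unfolding discretisation_error_def by (simp add: mult.commute)
qed

definition fluctuation :: "nat \<Rightarrow> 'a \<Rightarrow> real^3"
  where "fluctuation n \<omega> = real n *\<^sub>R (U_n n (X \<omega>) (Y \<omega>) - U (X \<omega>) (Y \<omega>)) - mu_vec (X \<omega>) (Y \<omega>)"

definition main_term :: "nat \<Rightarrow> 'a \<Rightarrow> real^3"
  where "main_term n \<omega> = main_error n (grid_increments n \<omega>) (grid_bridges n \<omega>)"

lemma fluctuation_minus_main_term:
  assumes n: "n \<ge> 1" and \<omega>: "\<omega> \<in> space M" and z: "X \<omega> 0 = 0" "Y \<omega> 0 = 0"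
  shows "fluctuation n \<omega> - main_term n \<omega> = vector [discretisation_error n (X \<omega>) (Y \<omega>), discretisation_error n (X \<omega>) (X \<omega>), discretisation_error n (Y \<omega>) (Y \<omega>)]"
proof -
  note c = contX[OF \<omega>] contY[OF \<omega>]
  have p: "path_of True (grid_increments n \<omega>) k = X \<omega> (real k / n)" "path_of False (grid_increments n \<omega>) k = Y \<omega> (real k / n)" if "k < n" for k
    using path_of_grid_increments[OF n, of k] that z by simp_all
  have s1: "(\<Sum>k<n. (path_of True (grid_increments n \<omega>) k - smean n (path_of True (grid_increments n \<omega>))) * grid_bridges n \<omega> (False, k) +
            (path_of False (grid_increments n \<omega>) k - smean n (path_of False (grid_increments n \<omega>))) * grid_bridges n \<omega> (True, k))
     = (\<Sum>k<n. (X \<omega> (real k / n) - left_mean n (X \<omega>)) * bridge_integral n (Y \<omega>) k + (Y \<omega> (real k / n) - left_mean n (Y \<omega>)) * bridge_integral n (X \<omega>) k)"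
    unfolding scov_grid[OF n z] by (intro sum.cong) (auto simp: p grid_bridges_def)
  have s2: "2 * (\<Sum>k<n. (path_of True (grid_increments n \<omega>) k - smean n (path_of True (grid_increments n \<omega>))) * grid_bridges n \<omega> (True, k))
     = (\<Sum>k<n. (X \<omega> (real k / n) - left_mean n (X \<omega>)) * bridge_integral n (X \<omega>) k + (X \<omega> (real k / n) - left_mean n (X \<omega>)) * bridge_integral n (X \<omega>) k)"
    unfolding scov_grid[OF n z] sum_distrib_left by (intro sum.cong) (auto simp: p grid_bridges_def)
  have s3: "2 * (\<Sum>k<n. (path_of False (grid_increments n \<omega>) k - smean n (path_of False (grid_increments n \<omega>))) * grid_bridges n \<omega> (False, k))
     = (\<Sum>k<n. (Y \<omega> (real k / n) - left_mean n (Y \<omega>)) * bridge_integral n (Y \<omega>) k + (Y \<omega> (real k / n) - left_mean n (Y \<omega>)) * bridge_integral n (Y \<omega>) k)"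
    unfolding scov_grid[OF n z] sum_distrib_left by (intro sum.cong) (auto simp: p grid_bridges_def)
  have m: "main_term n \<omega> = vector [- (real n * (\<Sum>k<n. (X \<omega> (real k / n) - left_mean n (X \<omega>)) * bridge_integral n (Y \<omega>) k + (Y \<omega> (real k / n) - left_mean n (Y \<omega>)) * bridge_integral n (X \<omega>) k)),
     - (real n * (\<Sum>k<n. (X \<omega> (real k / n) - left_mean n (X \<omega>)) * bridge_integral n (X \<omega>) k + (X \<omega> (real k / n) - left_mean n (X \<omega>)) * bridge_integral n (X \<omega>) k)),
     - (real n * (\<Sum>k<n. (Y \<omega> (real k / n) - left_mean n (Y \<omega>)) * bridge_integral n (Y \<omega>) k + (Y \<omega> (real k / n) - left_mean n (Y \<omega>)) * bridge_integral n (Y \<omega>) k))]"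
    unfolding main_term_def main_error_def Let_def s1 s2[symmetric] s3[symmetric] by (simp add: mult_ac)
  have d: "D_n n f - D f = A_n n f f - A f f" for f by (simp add: D_n_eq_A_n D_eq_A)
  note e = A_n_decomposition[OF c(1) c(2) z(1) z(2) n] A_n_decomposition[OF c(1) c(1) z(1) z(1) n] A_n_decomposition[OF c(2) c(2) z(2) z(2) n]
  show ?thesis
    unfolding fluctuation_def m U_n_def U_def mu_vec_eq
    by (simp add: vec_eq_iff forall_3 d e)
qed

lemma measurable_fluctuation: "fluctuation n \<in> borel_measurable M"
proof -
  note m = measurable_X measurable_Y contX contY
  have [measurable]: "(\<lambda>\<omega>. A_n n (X \<omega>) (Y \<omega>)) \<in> borel_measurable M" "(\<lambda>\<omega>. A_n n (X \<omega>) (X \<omega>)) \<in> borel_measurable M" "(\<lambda>\<omega>. A_n n (Y \<omega>) (Y \<omega>)) \<in> borel_measurable M"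
    by (intro measurable_A_n m; assumption)+
  have [measurable]: "(\<lambda>\<omega>. A (X \<omega>) (Y \<omega>)) \<in> borel_measurable M" "(\<lambda>\<omega>. A (X \<omega>) (X \<omega>)) \<in> borel_measurable M" "(\<lambda>\<omega>. A (Y \<omega>) (Y \<omega>)) \<in> borel_measurable M"
    by (intro measurable_A_limit m; assumption)+
  have [measurable]: "(\<lambda>\<omega>. integral {0..1} (X \<omega>)) \<in> borel_measurable M" "(\<lambda>\<omega>. integral {0..1} (Y \<omega>)) \<in> borel_measurable M"
    using measurable_integral[of X M X] measurable_integral[of Y M Y] m by auto
  have [measurable]: "(\<lambda>\<omega>. X \<omega> 1) \<in> borel_measurable M" "(\<lambda>\<omega>. Y \<omega> 1) \<in> borel_measurable M"
    using measurable_X measurable_Y by auto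
  show ?thesis
    unfolding fluctuation_def U_n_def U_def mu_vec_eq D_n_eq_A_n D_eq_A
    by (intro borel_measurable_diff borel_measurable_scaleR borel_measurable_const measurable_vector3) measurable
qed

lemma measurable_main_term: "main_term n \<in> borel_measurable M"
  unfolding main_term_def by (intro measurable_main_error measurable_grid_increments measurable_grid_bridges)

lemma null_fluctuation: "null_in_prob M (\<lambda>n \<omega>. norm (fluctuation n \<omega> - main_term n \<omega>))"
proof -
  let ?e = "\<lambda>n \<omega>. \<bar>discretisation_error n (comb 1 0 \<omega>) (comb 0 1 \<omega>)\<bar> + \<bar>discretisation_error n (comb 1 0 \<omega>) (comb 1 0 \<omega>)\<bar> + \<bar>discretisation_error n (comb 0 1 \<omega>) (comb 0 1 \<omega>)\<bar>"
  have "null_in_prob M ?e"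
    by (intro null_in_prob_add null_in_prob_abs null_discretisation_error)
  then show ?thesis
  proof (rule null_in_prob_mono_AE)
    show "(\<lambda>\<omega>. norm (fluctuation n \<omega> - main_term n \<omega>)) \<in> borel_measurable M" for n
      using borel_measurable_diff[OF measurable_fluctuation measurable_main_term] by measurable
    fix n :: nat assume n: "n \<ge> 1"
    show "AE \<omega> in M. \<bar>norm (fluctuation n \<omega> - main_term n \<omega>)\<bar> \<le> \<bar>?e n \<omega>\<bar>"
      using start_zero AE_space
    proof eventually_elim
      case (elim \<omega>)
      then have e: "fluctuation n \<omega> - main_term n \<omega> = vector [discretisation_error n (X \<omega>) (Y \<omega>), discretisation_error n (X \<omega>) (X \<omega>), discretisation_error n (Y \<omega>) (Y \<omega>)]"
        using fluctuation_minus_main_term[OF n] by blast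
      show ?case
        using norm_le_l1_cart[of "fluctuation n \<omega> - main_term n \<omega>"] unfolding e by (simp add: sum_3 comb_simps)
    qed
  qed
qed

section \<open>Convergence of the leading term\<close>

definition path_pair :: "'a \<Rightarrow> C01 \<times> C01"
  where "path_pair \<omega> = (to_C01 (X \<omega>), to_C01 (Y \<omega>))"

abbreviation MN :: "('a \<times> (real \<times> real) \<times> (real \<times> real)) measure" where "MN \<equiv> M \<Otimes>\<^sub>M std_normal4"

definition limit_noise :: "'a \<times> (real \<times> real) \<times> (real \<times> real) \<Rightarrow> real^3"
  where "limit_noise z = noise r (A (X (fst z)) (Y (fst z))) (A (X (fst z)) (X (fst z))) (A (Y (fst z)) (Y (fst z))) (snd z)"

lemma prob_space_MN: "prob_space MN"
proof -
  interpret S: prob_space std_normal4 by (rule prob_space_std_normal4)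
  interpret P: pair_prob_space M std_normal4 ..
  show ?thesis by unfold_locales
qed

lemma distr_MN_fst: "distr MN M fst = M"
  by (rule prob_space.distr_pair_fst[OF prob_space_std_normal4])

lemma AE_MN_fst:
  assumes "AE \<omega> in M. P \<omega>" shows "AE z in MN. P (fst z)"
  using assms by (subst (asm) distr_MN_fst[symmetric]) (rule AE_distrD[OF measurable_fst])

lemma measurable_snd_MN: "snd \<in> MN \<rightarrow>\<^sub>M borel"
  using measurable_snd[of M std_normal4] by (simp cong: measurable_cong_sets add: sets_std_normal4)

lemma measurable_A_XY: "(\<lambda>\<omega>. A (X \<omega>) (Y \<omega>)) \<in> borel_measurable M" "(\<lambda>\<omega>. A (X \<omega>) (X \<omega>)) \<in> borel_measurable M" "(\<lambda>\<omega>. A (Y \<omega>) (Y \<omega>)) \<in> borel_measurable M"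
  by (intro measurable_A_limit measurable_X measurable_Y contX contY; assumption)+

lemma measurable_limit_noise: "limit_noise \<in> borel_measurable MN"
  unfolding limit_noise_def
  by (intro measurable_noise measurable_snd_MN measurable_compose[OF measurable_fst] measurable_A_XY)

lemma measurable_grid_noise_MN: "(\<lambda>z. grid_noise r n (grid_increments n (fst z)) (snd z)) \<in> borel_measurable MN"
  by (intro measurable_grid_noise measurable_snd_MN measurable_compose[OF measurable_fst measurable_grid_increments])

lemma grid_noise_tendsto: "AE z in MN. (\<lambda>n. grid_noise r n (grid_increments n (fst z)) (snd z)) \<longlonglongrightarrow> limit_noise z"
  using AE_MN_fst[OF AE_limits] AE_MN_fst[OF AE_nondegenerate]
proof eventually_elim
  case (elim z)
  then show ?case unfolding grid_noise_def Let_def limit_noise_def by (intro noise_tendsto) auto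
qed

text \<open>
  Tightness is inherited from the product space, on which a sequence with the same laws converges almost
  surely.
\<close>

lemma tight_main_term: "tight_in_prob M (\<lambda>n \<omega>. norm (main_term n \<omega>))"
  unfolding tight_in_prob_def
proof (intro conjI allI impI)
  interpret MN: prob_space MN by (rule prob_space_MN)
  note [measurable] = measurable_main_term measurable_grid_noise_MN measurable_limit_noise
  show "(\<lambda>\<omega>. norm (main_term n \<omega>)) \<in> borel_measurable M" for n by measurable
  fix e :: real assume "0 < e"
  have "tight_in_prob MN (\<lambda>n z. norm (grid_noise r n (grid_increments n (fst z)) (snd z)))"
    by (rule MN.tight_in_prob_AE_convergent[where L = "\<lambda>z. norm (limit_noise z)"])
       (use grid_noise_tendsto in \<open>auto elim!: eventually_mono intro: tendsto_norm\<close>)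
  then obtain K where K: "K > 0" "\<forall>\<^sub>F n in sequentially. MN.prob {z\<in>space MN. K < \<bar>norm (grid_noise r n (grid_increments n (fst z)) (snd z))\<bar>} \<le> e"
    using \<open>0 < e\<close> unfolding tight_in_prob_def by blast
  have "\<forall>\<^sub>F n in sequentially. prob {\<omega>\<in>space M. K < \<bar>norm (main_term n \<omega>)\<bar>} \<le> e"
    using K(2) eventually_ge_at_top[of 1]
  proof eventually_elim
    case (elim n)
    define \<psi> :: "(real^3) \<times> (bool \<times> nat \<Rightarrow> real) \<Rightarrow> real" where "\<psi> p = indicator {v. K < norm v} (fst p)" for p
    have "fst \<in> borel_measurable (borel :: ((real^3) \<times> (bool \<times> nat \<Rightarrow> real)) measure)"
      by (intro borel_measurable_continuous_onI continuous_intros)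
    then have \<psi>: "\<psi> \<in> borel_measurable borel" unfolding \<psi>_def by measurable
    have "prob {\<omega>\<in>space M. K < \<bar>norm (main_term n \<omega>)\<bar>} = (\<integral>\<omega>. indicator {\<omega>\<in>space M. K < \<bar>norm (main_term n \<omega>)\<bar>} \<omega> \<partial>M)"
      by simp
    also have "\<dots> = (\<integral>\<omega>. \<psi> (main_term n \<omega>, grid_increments n \<omega>) \<partial>M)"
      by (intro Bochner_Integration.integral_cong) (auto simp: \<psi>_def indicator_def)
    also have "\<dots> = (\<integral>z. \<psi> (grid_noise r n (grid_increments n (fst z)) (snd z), grid_increments n (fst z)) \<partial>MN)"
      unfolding main_term_def by (rule main_error_law[OF elim(2) \<psi>, of 1]) (auto simp: \<psi>_def indicator_def)
    also have "\<dots> = (\<integral>z. indicator {z\<in>space MN. K < \<bar>norm (grid_noise r n (grid_increments n (fst z)) (snd z))\<bar>} z \<partial>MN)"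
      by (intro Bochner_Integration.integral_cong) (auto simp: \<psi>_def indicator_def)
    also have "\<dots> = MN.prob {z\<in>space MN. K < \<bar>norm (grid_noise r n (grid_increments n (fst z)) (snd z))\<bar>}"
      by simp
    finally show ?case using elim(1) by simp
  qed
  then show "\<exists>K>0. \<forall>\<^sub>F n in sequentially. prob {\<omega>\<in>space M. K < \<bar>norm (main_term n \<omega>)\<bar>} \<le> e"
    using K(1) by blast
qed

text \<open>
  The maps \<open>G n\<close> are the identity for the vector of moments, the scalar product with the gradient of \<open>F\<close> for
  the correlation coefficient, and the latter divided by the conditional standard deviation for the
  normalised statement. They depend on the sample point through the increments only, so that \<open>main_error_law\<close> applies to the
  image of the leading term under \<open>G n\<close> together with the Bernstein polynomials of the skeleton.
\<close>

theorem converges_to_transformed_noise: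
  fixes V :: "nat \<Rightarrow> 'a \<Rightarrow> 'e::euclidean_space" and G :: "nat \<Rightarrow> (bool \<times> nat \<Rightarrow> real) \<Rightarrow> real^3 \<Rightarrow> 'e"
  assumes V: "\<And>n. V n \<in> borel_measurable M"
    and G: "\<And>n. (\<lambda>p. G n (snd p) (fst p)) \<in> borel_measurable borel"
    and null: "null_in_prob M (\<lambda>n \<omega>. norm (V n \<omega> - G n (grid_increments n \<omega>) (main_term n \<omega>)))"
    and lim: "AE z in MN. (\<lambda>n. G n (grid_increments n (fst z)) (grid_noise r n (grid_increments n (fst z)) (snd z))) \<longlonglongrightarrow> \<Lambda> z"
    and \<Lambda>: "\<Lambda> \<in> borel_measurable MN"
  shows "converges_in_distribution M (\<lambda>n \<omega>. (V n \<omega>, to_C01 (X \<omega>), to_C01 (Y \<omega>))) MN (\<lambda>z. (\<Lambda> z, to_C01 (X (fst z)), to_C01 (Y (fst z))))"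
proof -
  define b1 where "b1 n \<omega> = bernstein_path n (path_of True (grid_increments n \<omega>))" for n \<omega>
  define b2 where "b2 n \<omega> = bernstein_path n (path_of False (grid_increments n \<omega>))" for n \<omega>
  have inc: "grid_increments n \<in> borel_measurable M" for n
    by (intro measurable_coordinatewise_then_product measurable_grid_increments)
  have inc2: "(\<lambda>z. grid_increments n (fst z)) \<in> borel_measurable MN" for n
    by (rule measurable_compose[OF measurable_fst inc])
  have Gm: "(\<lambda>\<omega>. G n (g \<omega>) (v \<omega>)) \<in> borel_measurable N" if "g \<in> borel_measurable N" "v \<in> borel_measurable N" for g v n and N :: "'x measure"
    using measurable_compose[OF borel_measurable_Pair[OF that(2,1)] G, of n] by simp
  have path: "(\<lambda>\<omega>. path_of b (g \<omega>) k) \<in> borel_measurable N" if "g \<in> borel_measurable N" for g b k and N :: "'x measure"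
    unfolding path_of_def by (intro borel_measurable_sum measurable_compose[OF that measurable_coordinate])
  have path': "(\<lambda>\<omega>. path_of b (grid_increments n \<omega>) k) \<in> borel_measurable M" for b n k
    unfolding path_of_def by (intro borel_measurable_sum measurable_grid_increments)
  have contMN: "continuous_on {0..1} (X (fst z))" "continuous_on {0..1} (Y (fst z))" if "z \<in> space MN" for z
    using that contX contY by (auto simp: space_pair_measure)
  show ?thesis
  proof (rule converges_in_distribution_transfer[OF prob_space_axioms prob_space_MN])
    show "(\<lambda>\<omega>. (V n \<omega>, to_C01 (X \<omega>), to_C01 (Y \<omega>))) \<in> borel_measurable M" for n
      by (intro measurable_pair_to_C01 V measurable_X measurable_Y contX contY)
    show "(\<lambda>\<omega>. (G n (grid_increments n \<omega>) (main_term n \<omega>), to_C01 (X \<omega>), to_C01 (Y \<omega>))) \<in> borel_measurable M" for n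
      by (intro measurable_pair_to_C01 Gm inc measurable_main_term measurable_X measurable_Y contX contY)
    show "(\<lambda>\<omega>. (G n (grid_increments n \<omega>) (main_term n \<omega>), b1 n \<omega>, b2 n \<omega>)) \<in> borel_measurable M" for n
      unfolding b1_def b2_def by (intro measurable_pair_bernstein_path Gm inc measurable_main_term path')
    show "(\<lambda>z. (G n (grid_increments n (fst z)) (grid_noise r n (grid_increments n (fst z)) (snd z)), b1 n (fst z), b2 n (fst z))) \<in> borel_measurable MN" for n
      unfolding b1_def b2_def by (intro measurable_pair_bernstein_path Gm inc2 measurable_grid_noise_MN measurable_compose[OF measurable_fst path'])
    show "(\<lambda>z. (\<Lambda> z, to_C01 (X (fst z)), to_C01 (Y (fst z)))) \<in> borel_measurable MN"
      by (intro measurable_pair_to_C01 \<Lambda> measurable_compose[OF measurable_fst] measurable_X measurable_Y contMN)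
    show "null_in_prob M (\<lambda>n \<omega>. norm (V n \<omega> - G n (grid_increments n \<omega>) (main_term n \<omega>)))" by (rule null)
    show "dist (V n \<omega>, to_C01 (X \<omega>), to_C01 (Y \<omega>)) (G n (grid_increments n \<omega>) (main_term n \<omega>), to_C01 (X \<omega>), to_C01 (Y \<omega>))
        \<le> norm (V n \<omega> - G n (grid_increments n \<omega>) (main_term n \<omega>))" for n \<omega>
      by (simp add: dist_Pair_Pair dist_norm)
    show "AE \<omega> in M. (\<lambda>n. dist (G n (grid_increments n \<omega>) (main_term n \<omega>), to_C01 (X \<omega>), to_C01 (Y \<omega>))
        (G n (grid_increments n \<omega>) (main_term n \<omega>), b1 n \<omega>, b2 n \<omega>)) \<longlonglongrightarrow> 0"
      using AE_limits
    proof eventually_elim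
      case (elim \<omega>)
      have "(\<lambda>n. dist (to_C01 (X \<omega>), to_C01 (Y \<omega>)) (b1 n \<omega>, b2 n \<omega>)) \<longlonglongrightarrow> dist (to_C01 (X \<omega>), to_C01 (Y \<omega>)) (to_C01 (X \<omega>), to_C01 (Y \<omega>))"
        unfolding b1_def b2_def using elim by (intro tendsto_intros) auto
      then show ?case by (simp add: dist_Pair_Pair)
    qed
    show "AE z in MN. (\<lambda>n. (G n (grid_increments n (fst z)) (grid_noise r n (grid_increments n (fst z)) (snd z)), b1 n (fst z), b2 n (fst z)))
        \<longlonglongrightarrow> (\<Lambda> z, to_C01 (X (fst z)), to_C01 (Y (fst z)))"
      using lim AE_MN_fst[OF AE_limits]
    proof eventually_elim
      case (elim z)
      then show ?case unfolding b1_def b2_def by (intro tendsto_Pair) auto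
    qed
    fix n :: nat and \<phi> :: "'e \<times> C01 \<times> C01 \<Rightarrow> real"
    assume n: "1 \<le> n" and cont: "continuous_on UNIV \<phi>" and "bounded (range \<phi>)"
    then obtain C where C: "\<And>x. \<bar>\<phi> x\<bar> \<le> C" by (auto simp: bounded_iff)
    define \<psi> where "\<psi> p = \<phi> (G n (snd p) (fst p), bernstein_path n (path_of True (snd p)), bernstein_path n (path_of False (snd p)))" for p
    have sm: "snd \<in> borel_measurable (borel :: ((real^3) \<times> (bool \<times> nat \<Rightarrow> real)) measure)"
      by (intro borel_measurable_continuous_onI continuous_intros)
    have "\<psi> \<in> borel_measurable borel"
      unfolding \<psi>_def by (intro measurable_compose[OF _ borel_measurable_continuous_onI[OF cont]] measurable_pair_bernstein_path G path sm)
    from main_error_law[OF n this, of C] C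
    show "(\<integral>\<omega>. \<phi> (G n (grid_increments n \<omega>) (main_term n \<omega>), b1 n \<omega>, b2 n \<omega>) \<partial>M)
      = (\<integral>z. \<phi> (G n (grid_increments n (fst z)) (grid_noise r n (grid_increments n (fst z)) (snd z)), b1 n (fst z), b2 n (fst z)) \<partial>MN)"
      by (simp add: \<psi>_def b1_def b2_def main_term_def)
  qed
qed

end

section \<open>The delta method for the correlation coefficient\<close>

text \<open>
  The gradient of \<open>F\<close> at \<open>(a, b, c)\<close> for positive \<open>b\<close> and \<open>c\<close>.
\<close>

definition F_gradient :: "real \<Rightarrow> real \<Rightarrow> real \<Rightarrow> real^3"
  where "F_gradient a b c = vector [1 / sqrt (b * c), - a / (2 * b * sqrt (b * c)), - a / (2 * c * sqrt (b * c))]"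

lemma F_has_gradient:
  fixes v :: "real^3"
  assumes "v $ 2 > 0" "v $ 3 > 0"
  shows "GDERIV F v :> F_gradient (v $ 1) (v $ 2) (v $ 3)"
proof -
  define s where "s = sqrt (v $ 2 * v $ 3)"
  have s: "s > 0" "s * s = v $ 2 * v $ 3" using assms by (auto simp: s_def)
  have nth: "((\<lambda>w :: real^3. w $ i) has_derivative (\<lambda>h. h $ i)) (at v)" for i
    by (rule bounded_linear_imp_has_derivative) (rule bounded_linear_vec_nth)
  have "((\<lambda>w :: real^3. w $ 1 / sqrt (w $ 2 * w $ 3)) has_derivative
      (\<lambda>h. (h $ 1 * s - v $ 1 * ((v $ 2 * h $ 3 + h $ 2 * v $ 3) * (inverse s / 2))) / (s * s))) (at v)"
    using assms s unfolding s_def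
    by (auto intro!: derivative_eq_intros nth simp: divide_simps)
  moreover have "(h $ 1 * s - v $ 1 * ((v $ 2 * h $ 3 + h $ 2 * v $ 3) * (inverse s / 2))) / (s * s) = h \<bullet> F_gradient (v $ 1) (v $ 2) (v $ 3)" for h
  proof -
    have e: "h \<bullet> F_gradient (v $ 1) (v $ 2) (v $ 3) = h$1 / s - h$2 * v$1 / (2 * v$2 * s) - h$3 * v$1 / (2 * v$3 * s)"
      unfolding F_gradient_def inner_vector3 s_def[symmetric] by simp
    have "(h $ 1 * s - v $ 1 * ((v $ 2 * h $ 3 + h $ 2 * v $ 3) * (inverse s / 2))) / (s * s)
      = h$1 / s - v$1 * v$2 * h$3 / (2 * s * (s * s)) - v$1 * h$2 * v$3 / (2 * s * (s * s))"
      using s(1) by (simp add: field_simps)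
    also have "\<dots> = h$1 / s - h$2 * v$1 / (2 * v$2 * s) - h$3 * v$1 / (2 * v$3 * s)"
      unfolding s(2) using assms s(1) by (simp add: field_simps)
    finally show ?thesis unfolding e .
  qed
  ultimately show ?thesis unfolding gderiv_def F_def by simp
qed

text \<open>
  The conditional standard deviation as a function of the moments, see \<open>sigma_r_eq\<close>.
\<close>

definition limit_sd :: "real \<Rightarrow> real \<Rightarrow> real \<Rightarrow> real \<Rightarrow> real"
  where "limit_sd r a d1 d2 = 1 / sqrt 12 * (sqrt ((d1 * d2 - a\<^sup>2) * (d1 + d2 - 2 * r * a)) / (d1 * d2))"

lemma sigma_r_eq: "sigma_r r f g = limit_sd r (A f g) (A f f) (A g g)"
  unfolding sigma_r_def limit_sd_def D_eq_A ..

text \<open>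
  The arithmetic-geometric mean inequality gives \<open>d1 + d2 \<ge> 2 sqrt(d1 d2) > 2 \<bar>a\<bar> \<ge> 2 r a\<close>.
\<close>

lemma limit_variance_factor_pos:
  fixes a d1 d2 r :: real
  assumes "d1 > 0" "d2 > 0" "a\<^sup>2 < d1 * d2" "-1 < r" "r < 1"
  shows "0 < d1 + d2 - 2 * r * a"
proof -
  have 1: "\<bar>a\<bar> < (d1 + d2) / 2"
  proof (rule power2_less_imp_less)
    have "0 \<le> (d1 - d2)\<^sup>2" by simp
    then have "d1 * d2 \<le> ((d1 + d2) / 2)\<^sup>2" by (simp add: power2_eq_square field_simps)
    then show "\<bar>a\<bar>\<^sup>2 < ((d1 + d2) / 2)\<^sup>2" using assms by simp
  qed (use assms in auto)
  have "r * a \<le> \<bar>r\<bar> * \<bar>a\<bar>" by (simp flip: abs_mult)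
  also have "\<dots> \<le> 1 * \<bar>a\<bar>" using assms by (intro mult_right_mono) auto
  finally have "r * a < (d1 + d2) / 2" using 1 by simp
  then show ?thesis by simp
qed

lemma limit_sd_pos:
  assumes "d1 > 0" "d2 > 0" "a\<^sup>2 < d1 * d2" "-1 < r" "r < 1"
  shows "limit_sd r a d1 d2 > 0"
  unfolding limit_sd_def using assms limit_variance_factor_pos[OF assms] by simp

text \<open>
  The factorisation of the conditional variance of the projection of the noise to the gradient, which is
  the square of \<open>sigma_r\<close>.
\<close>

lemma noise_qf_F_gradient:
  assumes "d1 > 0" "d2 > 0"
  shows "noise_qf r a d1 d2 (F_gradient a d1 d2) = (d1 * d2 - a\<^sup>2) * (d1 + d2 - 2 * r * a) / (12 * (d1 * d2)\<^sup>2)"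
proof -
  define s where "s = sqrt (d1 * d2)"
  have s: "s \<noteq> 0" "s\<^sup>2 = d1 * d2" using assms by (auto simp: s_def)
  have "noise_qf r a d1 d2 (F_gradient a d1 d2) = ((d1 + d2 + 2 * r * a) + a\<^sup>2 / d1 + a\<^sup>2 / d2
      - 2 * a * (r * d1 + a) / d1 - 2 * a * (a + r * d2) / d2 + 2 * r * a ^ 3 / (d1 * d2)) / (12 * s\<^sup>2)"
    using assms s(1) unfolding noise_qf_def F_gradient_def s_def[symmetric]
    by (simp add: divide_simps) (simp add: power2_eq_square power3_eq_cube algebra_simps)
  also have "\<dots> = (d1 * d2 - a\<^sup>2) * (d1 + d2 - 2 * r * a) / (12 * (d1 * d2)\<^sup>2)"
    unfolding s(2) using assms by (simp add: divide_simps) (simp add: power2_eq_square power3_eq_cube algebra_simps)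
  finally show ?thesis .
qed

lemma noise_qf_scale: "noise_qf r a d1 d2 (c *\<^sub>R u) = c\<^sup>2 * noise_qf r a d1 d2 u"
  unfolding noise_qf_def by (simp add: power2_eq_square algebra_simps add_divide_distrib diff_divide_distrib)

lemma limit_sd_square:
  assumes "d1 > 0" "d2 > 0" "a\<^sup>2 < d1 * d2" "-1 < r" "r < 1"
  shows "(limit_sd r a d1 d2)\<^sup>2 = noise_qf r a d1 d2 (F_gradient a d1 d2)"
proof -
  have "0 \<le> (d1 * d2 - a\<^sup>2) * (d1 + d2 - 2 * r * a)"
    using assms limit_variance_factor_pos[OF assms] by simp
  then show ?thesis
    unfolding noise_qf_F_gradient[OF assms(1,2)] limit_sd_def by (simp add: power_mult_distrib power_divide)
qed

lemma F_gradient_tendsto: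
  assumes "a \<longlonglongrightarrow> a0" "b \<longlonglongrightarrow> b0" "c \<longlonglongrightarrow> c0" "b0 > 0" "c0 > 0"
  shows "(\<lambda>n. F_gradient (a n) (b n) (c n)) \<longlonglongrightarrow> F_gradient a0 b0 c0"
  unfolding F_gradient_def using assms by (intro vector3_tendsto tendsto_intros) auto

lemma measurable_F_gradient:
  assumes [measurable]: "a \<in> borel_measurable M" "b \<in> borel_measurable M" "c \<in> borel_measurable M"
  shows "(\<lambda>\<omega>. F_gradient (a \<omega>) (b \<omega>) (c \<omega>)) \<in> borel_measurable M"
  unfolding F_gradient_def by (intro measurable_vector3) measurable

lemma measurable_limit_sd:
  assumes [measurable]: "a \<in> borel_measurable M" "b \<in> borel_measurable M" "c \<in> borel_measurable M"
  shows "(\<lambda>\<omega>. limit_sd r (a \<omega>) (b \<omega>) (c \<omega>)) \<in> borel_measurable M"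
  unfolding limit_sd_def by measurable

lemma limit_sd_tendsto:
  assumes "a \<longlonglongrightarrow> a0" "b \<longlonglongrightarrow> b0" "c \<longlonglongrightarrow> c0" "b0 > 0" "c0 > 0"
  shows "(\<lambda>n. limit_sd r (a n) (b n) (c n)) \<longlonglongrightarrow> limit_sd r a0 b0 c0"
  unfolding limit_sd_def using assms by (intro tendsto_intros) auto

lemma gderiv_remainder_tendsto:
  fixes f :: "'e::euclidean_space \<Rightarrow> real"
  assumes f: "GDERIV f u :> v" and lim: "w \<longlonglongrightarrow> u"
  shows "(\<lambda>n. \<bar>f (w n) - f u - v \<bullet> (w n - u)\<bar> / norm (w n - u)) \<longlonglongrightarrow> 0"
proof -
  define q where "q y = \<bar>f y - f u - v \<bullet> (y - u)\<bar> / norm (y - u)" for y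
  have "((\<lambda>y. (f y - f u - (y - u) \<bullet> v) /\<^sub>R norm (y - u)) \<longlongrightarrow> 0) (at u)"
    using f unfolding gderiv_def has_derivative_def by simp
  then have "(q \<longlongrightarrow> 0) (at u)"
    unfolding q_def by (subst (asm) tendsto_norm_zero_iff[symmetric]) (simp add: inner_commute divide_inverse mult.commute abs_mult)
  moreover have "q u = 0" by (simp add: q_def)
  ultimately have "isCont q u" by (simp add: isCont_def)
  then show ?thesis using isCont_tendsto_compose[OF _ lim, of q] \<open>q u = 0\<close> by (simp add: q_def)
qed

context brownian_pair begin

definition gF :: "'a \<Rightarrow> real^3" where "gF \<omega> = F_gradient (A (X \<omega>) (Y \<omega>)) (A (X \<omega>) (X \<omega>)) (A (Y \<omega>) (Y \<omega>))"
definition sd :: "'a \<Rightarrow> real" where "sd \<omega> = limit_sd r (A (X \<omega>) (Y \<omega>)) (A (X \<omega>) (X \<omega>)) (A (Y \<omega>) (Y \<omega>))"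
definition gF_n :: "nat \<Rightarrow> (bool \<times> nat \<Rightarrow> real) \<Rightarrow> real^3" where "gF_n n g = F_gradient (sXY n g) (sXX n g) (sYY n g)"
definition sd_n :: "nat \<Rightarrow> (bool \<times> nat \<Rightarrow> real) \<Rightarrow> real" where "sd_n n g = limit_sd r (sXY n g) (sXX n g) (sYY n g)"

text \<open>
  Defined with the explicit gradient instead of \<open>mu\<close>, whose measurability is evident; the two agree
  where both variances are positive.
\<close>

definition rho_fluctuation :: "nat \<Rightarrow> 'a \<Rightarrow> real"
  where "rho_fluctuation n \<omega> = real n * (rho_n n (X \<omega>) (Y \<omega>) - rho (X \<omega>) (Y \<omega>)) - gF \<omega> \<bullet> mu_vec (X \<omega>) (Y \<omega>)"

lemma measurable_gF: "gF \<in> borel_measurable M" and measurable_sd: "sd \<in> borel_measurable M"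
  unfolding gF_def sd_def by (intro measurable_F_gradient measurable_limit_sd measurable_A_XY)+

lemma measurable_gF_n: "(\<lambda>\<omega>. gF_n n (g \<omega>)) \<in> borel_measurable N" and measurable_sd_n: "(\<lambda>\<omega>. sd_n n (g \<omega>)) \<in> borel_measurable N"
  if "\<And>i. (\<lambda>\<omega>. g \<omega> i) \<in> borel_measurable N" for g :: "'x \<Rightarrow> bool \<times> nat \<Rightarrow> real"
  unfolding gF_n_def sd_n_def using that by (intro measurable_F_gradient measurable_limit_sd measurable_scov_path; assumption)+

lemma measurable_mu_vec: "(\<lambda>\<omega>. mu_vec (X \<omega>) (Y \<omega>)) \<in> borel_measurable M"
proof -
  have [measurable]: "(\<lambda>\<omega>. integral {0..1} (X \<omega>)) \<in> borel_measurable M" "(\<lambda>\<omega>. integral {0..1} (Y \<omega>)) \<in> borel_measurable M"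
    using measurable_integral[of X M X] measurable_integral[of Y M Y] measurable_X measurable_Y contX contY by auto
  have [measurable]: "(\<lambda>\<omega>. X \<omega> 1) \<in> borel_measurable M" "(\<lambda>\<omega>. Y \<omega> 1) \<in> borel_measurable M"
    using measurable_X measurable_Y by auto
  show ?thesis unfolding mu_vec_eq by (intro measurable_vector3) measurable
qed

lemma measurable_A_n_XY: "(\<lambda>\<omega>. A_n n (X \<omega>) (Y \<omega>)) \<in> borel_measurable M" "(\<lambda>\<omega>. A_n n (X \<omega>) (X \<omega>)) \<in> borel_measurable M" "(\<lambda>\<omega>. A_n n (Y \<omega>) (Y \<omega>)) \<in> borel_measurable M"
  by (intro measurable_A_n measurable_X measurable_Y contX contY; assumption)+

lemma measurable_F_U: "(\<lambda>\<omega>. F (U_n n (X \<omega>) (Y \<omega>))) \<in> borel_measurable M" "(\<lambda>\<omega>. F (U (X \<omega>) (Y \<omega>))) \<in> borel_measurable M"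
  "(\<lambda>\<omega>. U_n n (X \<omega>) (Y \<omega>)) \<in> borel_measurable M" "(\<lambda>\<omega>. U (X \<omega>) (Y \<omega>)) \<in> borel_measurable M"
proof -
  note [measurable] = measurable_A_n_XY measurable_A_XY
  show "(\<lambda>\<omega>. F (U_n n (X \<omega>) (Y \<omega>))) \<in> borel_measurable M" "(\<lambda>\<omega>. F (U (X \<omega>) (Y \<omega>))) \<in> borel_measurable M"
    unfolding F_def U_n_def U_def D_n_eq_A_n D_eq_A by simp_all
  show "(\<lambda>\<omega>. U_n n (X \<omega>) (Y \<omega>)) \<in> borel_measurable M" "(\<lambda>\<omega>. U (X \<omega>) (Y \<omega>)) \<in> borel_measurable M"
    unfolding U_n_def U_def D_n_eq_A_n D_eq_A by (intro measurable_vector3; measurable)+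
qed

lemma measurable_rho_fluctuation: "rho_fluctuation n \<in> borel_measurable M"
proof -
  note [measurable] = measurable_F_U measurable_gF measurable_mu_vec
  show ?thesis unfolding rho_fluctuation_def rho_n_def rho_def by measurable
qed

lemma gF_n_tendsto: "AE \<omega> in M. (\<lambda>n. gF_n n (grid_increments n \<omega>)) \<longlonglongrightarrow> gF \<omega>"
  using AE_limits AE_nondegenerate
  by eventually_elim (auto simp: gF_n_def gF_def intro!: F_gradient_tendsto)

lemma sd_n_tendsto: "AE \<omega> in M. (\<lambda>n. sd_n n (grid_increments n \<omega>)) \<longlonglongrightarrow> sd \<omega>"
  using AE_limits AE_nondegenerate
  by eventually_elim (auto simp: sd_n_def sd_def intro!: limit_sd_tendsto)

lemma sd_pos: "AE \<omega> in M. 0 < sd \<omega>"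
  using AE_nondegenerate by eventually_elim (use r in \<open>auto simp: sd_def intro!: limit_sd_pos\<close>)

lemma U_n_tendsto: "\<omega> \<in> space M \<Longrightarrow> (\<lambda>n. U_n n (X \<omega>) (Y \<omega>)) \<longlonglongrightarrow> U (X \<omega>) (Y \<omega>)"
proof (rule vec_tendstoI)
  fix i :: 3 assume \<omega>: "\<omega> \<in> space M"
  note c = contX[OF \<omega>] contY[OF \<omega>]
  note t = A_n_tendsto[OF c] A_n_tendsto[OF c(1) c(1)] A_n_tendsto[OF c(2) c(2)]
  show "(\<lambda>n. U_n n (X \<omega>) (Y \<omega>) $ i) \<longlonglongrightarrow> U (X \<omega>) (Y \<omega>) $ i"
    unfolding U_n_def U_def D_n_eq_A_n D_eq_A using exhaust_3[of i] t by auto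
qed

text \<open>
  The delta method. The error has three parts: the remainder \<open>\<epsilon>\<close> of the linearisation of \<open>F\<close> relative to
  the distance of \<open>U_n\<close> and \<open>U\<close>, times the tight sequence \<open>n \<bar>U_n - U\<bar>\<close>; the gradient at \<open>U\<close> times the
  remainder of the leading term; and the difference of the gradients at the true and the empirical
  moments times the tight leading term.
\<close>

lemma null_rho_fluctuation:
  "null_in_prob M (\<lambda>n \<omega>. norm (rho_fluctuation n \<omega> - gF_n n (grid_increments n \<omega>) \<bullet> main_term n \<omega>))"
proof -
  define \<epsilon> where "\<epsilon> n \<omega> = \<bar>F (U_n n (X \<omega>) (Y \<omega>)) - F (U (X \<omega>) (Y \<omega>)) - gF \<omega> \<bullet> (U_n n (X \<omega>) (Y \<omega>) - U (X \<omega>) (Y \<omega>))\<bar>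
      / norm (U_n n (X \<omega>) (Y \<omega>) - U (X \<omega>) (Y \<omega>))" for n \<omega>
  note [measurable] = measurable_F_U measurable_gF measurable_mu_vec measurable_main_term measurable_fluctuation
    measurable_gF_n[OF measurable_grid_increments] measurable_rho_fluctuation
  have m\<epsilon>: "\<epsilon> n \<in> borel_measurable M" for n unfolding \<epsilon>_def by measurable
  have n\<epsilon>: "null_in_prob M \<epsilon>"
  proof (rule null_in_prob_AE[OF m\<epsilon>])
    show "AE \<omega> in M. (\<lambda>n. \<epsilon> n \<omega>) \<longlonglongrightarrow> 0"
      using AE_nondegenerate AE_space
    proof eventually_elim
      case (elim \<omega>)
      have "GDERIV F (U (X \<omega>) (Y \<omega>)) :> gF \<omega>"
        using F_has_gradient[of "U (X \<omega>) (Y \<omega>)"] elim by (simp add: U_def D_eq_A gF_def)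
      from gderiv_remainder_tendsto[OF this U_n_tendsto[OF elim(2)]] show ?case by (simp add: \<epsilon>_def)
    qed
  qed
  have tm: "tight_in_prob M (\<lambda>n \<omega>. norm (mu_vec (X \<omega>) (Y \<omega>)))" by (rule tight_in_prob_const) measurable
  have tg: "tight_in_prob M (\<lambda>n \<omega>. norm (gF \<omega>))" by (rule tight_in_prob_const) measurable
  have ng: "null_in_prob M (\<lambda>n \<omega>. norm (gF_n n (grid_increments n \<omega>) - gF \<omega>))"
  proof (rule null_in_prob_AE)
    show "AE \<omega> in M. (\<lambda>n. norm (gF_n n (grid_increments n \<omega>) - gF \<omega>)) \<longlonglongrightarrow> 0"
      using gF_n_tendsto by eventually_elim (intro tendsto_norm_zero LIM_zero)
  qed measurable
  have T: "tight_in_prob M (\<lambda>n \<omega>. norm (fluctuation n \<omega> - main_term n \<omega>) + norm (main_term n \<omega>) + norm (mu_vec (X \<omega>) (Y \<omega>)))"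
    by (intro tight_in_prob_add null_in_prob_imp_tight null_fluctuation tight_main_term tm)
  let ?b = "\<lambda>n \<omega>. \<epsilon> n \<omega> * (norm (fluctuation n \<omega> - main_term n \<omega>) + norm (main_term n \<omega>) + norm (mu_vec (X \<omega>) (Y \<omega>)))
      + norm (fluctuation n \<omega> - main_term n \<omega>) * norm (gF \<omega>) + norm (gF_n n (grid_increments n \<omega>) - gF \<omega>) * norm (main_term n \<omega>)"
  have "null_in_prob M ?b"
    by (intro null_in_prob_add null_in_prob_mult_tight n\<epsilon> T null_fluctuation tg ng tight_main_term)
  then show ?thesis
  proof (rule null_in_prob_mono_AE)
    show "(\<lambda>\<omega>. norm (rho_fluctuation n \<omega> - gF_n n (grid_increments n \<omega>) \<bullet> main_term n \<omega>)) \<in> borel_measurable M" for n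
      by measurable
    fix n :: nat
    show "AE \<omega> in M. \<bar>norm (rho_fluctuation n \<omega> - gF_n n (grid_increments n \<omega>) \<bullet> main_term n \<omega>)\<bar> \<le> \<bar>?b n \<omega>\<bar>"
    proof (rule AE_I2)
      fix \<omega>
      define u un where "u = U (X \<omega>) (Y \<omega>)" and "un = U_n n (X \<omega>) (Y \<omega>)"
      define g gn z m \<mu> where "g = gF \<omega>" and "gn = gF_n n (grid_increments n \<omega>)" and "z = fluctuation n \<omega>" and "m = main_term n \<omega>" and "\<mu> = mu_vec (X \<omega>) (Y \<omega>)"
      \<comment> \<open>\<open>n (U_n - U)\<close> is the argument of the linearised map\<close>
      have w: "real n *\<^sub>R (un - u) = z + \<mu>" by (simp add: z_def fluctuation_def \<mu>_def u_def un_def)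
      have 1: "\<bar>real n * (F un - F u) - g \<bullet> (z + \<mu>)\<bar> = \<epsilon> n \<omega> * norm (z + \<mu>)"
      proof -
        have "real n * (F un - F u) - g \<bullet> (z + \<mu>) = real n * (F un - F u - g \<bullet> (un - u))"
          unfolding w[symmetric] by (simp add: algebra_simps)
        then have "\<bar>real n * (F un - F u) - g \<bullet> (z + \<mu>)\<bar> = real n * \<bar>F un - F u - g \<bullet> (un - u)\<bar>" by (simp add: abs_mult)
        also have "\<dots> = \<epsilon> n \<omega> * norm (z + \<mu>)"
          unfolding w[symmetric] \<epsilon>_def u_def[symmetric] un_def[symmetric] g_def[symmetric] by simp
        finally show ?thesis .
      qed
      have "0 \<le> \<epsilon> n \<omega>" by (simp add: \<epsilon>_def)
      moreover have "norm (z + \<mu>) \<le> norm (z - m) + norm m + norm \<mu>"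
        using norm_triangle_ineq[of "z - m" "m"] norm_triangle_ineq[of z \<mu>] by simp
      ultimately have 2: "\<epsilon> n \<omega> * norm (z + \<mu>) \<le> \<epsilon> n \<omega> * (norm (z - m) + norm m + norm \<mu>)" by (rule mult_left_mono[rotated])
      have 3: "\<bar>g \<bullet> (z - m)\<bar> \<le> norm (z - m) * norm g" using Cauchy_Schwarz_ineq2[of g "z - m"] by (simp add: mult.commute)
      have 4: "\<bar>(g - gn) \<bullet> m\<bar> \<le> norm (gn - g) * norm m" using Cauchy_Schwarz_ineq2[of "g - gn" m] by (simp add: norm_minus_commute)
      have "rho_fluctuation n \<omega> - gn \<bullet> m = (real n * (F un - F u) - g \<bullet> (z + \<mu>)) + g \<bullet> (z - m) + (g - gn) \<bullet> m"
        by (simp add: rho_fluctuation_def rho_n_def rho_def u_def un_def g_def \<mu>_def inner_diff_left inner_diff_right inner_add_right)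
      then have "\<bar>rho_fluctuation n \<omega> - gn \<bullet> m\<bar> \<le> \<epsilon> n \<omega> * (norm (z - m) + norm m + norm \<mu>) + norm (z - m) * norm g + norm (gn - g) * norm m"
        using 1 2 3 4 by linarith
      then show "\<bar>norm (rho_fluctuation n \<omega> - gF_n n (grid_increments n \<omega>) \<bullet> main_term n \<omega>)\<bar> \<le> \<bar>?b n \<omega>\<bar>"
        unfolding g_def gn_def z_def m_def \<mu>_def by simp
    qed
  qed
qed

lemma null_normalized_rho_fluctuation:
  "null_in_prob M (\<lambda>n \<omega>. norm (rho_fluctuation n \<omega> / sd \<omega> - gF_n n (grid_increments n \<omega>) \<bullet> main_term n \<omega> / sd_n n (grid_increments n \<omega>)))"
proof -
  note [measurable] = measurable_sd measurable_gF_n[OF measurable_grid_increments] measurable_sd_n[OF measurable_grid_increments]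
    measurable_main_term measurable_rho_fluctuation
  have ts: "tight_in_prob M (\<lambda>n \<omega>. \<bar>1 / sd \<omega>\<bar>)" by (rule tight_in_prob_const) measurable
  have n2: "null_in_prob M (\<lambda>n \<omega>. norm (gF_n n (grid_increments n \<omega>)) * \<bar>1 / sd \<omega> - 1 / sd_n n (grid_increments n \<omega>)\<bar>)"
  proof (rule null_in_prob_AE)
    show "AE \<omega> in M. (\<lambda>n. norm (gF_n n (grid_increments n \<omega>)) * \<bar>1 / sd \<omega> - 1 / sd_n n (grid_increments n \<omega>)\<bar>) \<longlonglongrightarrow> 0"
      using gF_n_tendsto sd_n_tendsto sd_pos
    proof eventually_elim
      case (elim \<omega>)
      have "(\<lambda>n. norm (gF_n n (grid_increments n \<omega>)) * \<bar>1 / sd \<omega> - 1 / sd_n n (grid_increments n \<omega>)\<bar>) \<longlonglongrightarrow> norm (gF \<omega>) * \<bar>1 / sd \<omega> - 1 / sd \<omega>\<bar>"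
        using elim by (intro tendsto_intros) auto
      then show ?case by simp
    qed
  qed measurable
  let ?b = "\<lambda>n \<omega>. norm (rho_fluctuation n \<omega> - gF_n n (grid_increments n \<omega>) \<bullet> main_term n \<omega>) * \<bar>1 / sd \<omega>\<bar>
     + (norm (gF_n n (grid_increments n \<omega>)) * \<bar>1 / sd \<omega> - 1 / sd_n n (grid_increments n \<omega>)\<bar>) * norm (main_term n \<omega>)"
  have "null_in_prob M ?b"
    by (intro null_in_prob_add null_in_prob_mult_tight null_rho_fluctuation ts n2 tight_main_term)
  then show ?thesis
  proof (rule null_in_prob_mono_AE)
    show "(\<lambda>\<omega>. norm (rho_fluctuation n \<omega> / sd \<omega> - gF_n n (grid_increments n \<omega>) \<bullet> main_term n \<omega> / sd_n n (grid_increments n \<omega>))) \<in> borel_measurable M" for n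
      by measurable
    fix n :: nat
    show "AE \<omega> in M. \<bar>norm (rho_fluctuation n \<omega> / sd \<omega> - gF_n n (grid_increments n \<omega>) \<bullet> main_term n \<omega> / sd_n n (grid_increments n \<omega>))\<bar> \<le> \<bar>?b n \<omega>\<bar>"
    proof (rule AE_I2)
      fix \<omega>
      define g m where "g = gF_n n (grid_increments n \<omega>)" and "m = main_term n \<omega>"
      define gm y s sn where "gm = g \<bullet> m" and "y = rho_fluctuation n \<omega>" and "s = 1 / sd \<omega>"
        and "sn = 1 / sd_n n (grid_increments n \<omega>)"
      have "y * s - gm * sn = (y - gm) * s + gm * (s - sn)" by (simp add: algebra_simps)
      then have "\<bar>y * s - gm * sn\<bar> \<le> \<bar>y - gm\<bar> * \<bar>s\<bar> + \<bar>gm\<bar> * \<bar>s - sn\<bar>"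
        using abs_triangle_ineq[of "(y - gm) * s" "gm * (s - sn)"] by (simp add: abs_mult)
      moreover have "\<bar>gm\<bar> * \<bar>s - sn\<bar> \<le> (norm g * norm m) * \<bar>s - sn\<bar>"
        using Cauchy_Schwarz_ineq2[of g m] by (intro mult_right_mono) (auto simp: gm_def)
      ultimately have "\<bar>y * s - gm * sn\<bar> \<le> \<bar>y - gm\<bar> * \<bar>s\<bar> + (norm g * \<bar>s - sn\<bar>) * norm m"
        by (simp add: mult_ac)
      moreover have "y / sd \<omega> = y * s" "gm / sd_n n (grid_increments n \<omega>) = gm * sn" by (simp_all add: s_def sn_def)
      ultimately show "\<bar>norm (rho_fluctuation n \<omega> / sd \<omega> - gF_n n (grid_increments n \<omega>) \<bullet> main_term n \<omega> / sd_n n (grid_increments n \<omega>))\<bar> \<le> \<bar>?b n \<omega>\<bar>"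
        unfolding y_def[symmetric] s_def[symmetric] sn_def[symmetric] g_def[symmetric] m_def[symmetric]
        unfolding gm_def[symmetric] by simp
    qed
  qed
qed

end

section \<open>The three limits\<close>

context brownian_pair begin

lemma path_pair_functionals:
  assumes "\<omega> \<in> space M"
  shows "A (from_C01 (fst (path_pair \<omega>))) (from_C01 (snd (path_pair \<omega>))) = A (X \<omega>) (Y \<omega>)"
    "A (from_C01 (fst (path_pair \<omega>))) (from_C01 (fst (path_pair \<omega>))) = A (X \<omega>) (X \<omega>)"
    "A (from_C01 (snd (path_pair \<omega>))) (from_C01 (snd (path_pair \<omega>))) = A (Y \<omega>) (Y \<omega>)"
  unfolding path_pair_def fst_conv snd_conv
  by (intro A_cong from_C01_to_C01 contX contY assms; assumption)+

lemma measurable_path_pair: "path_pair \<in> borel_measurable M"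
proof -
  have "(\<lambda>\<omega>. (0 :: real, to_C01 (X \<omega>), to_C01 (Y \<omega>))) \<in> borel_measurable M"
    by (intro measurable_pair_to_C01 measurable_X measurable_Y contX contY) auto
  moreover have "snd \<in> borel_measurable (borel :: (real \<times> C01 \<times> C01) measure)"
    by (intro borel_measurable_continuous_onI continuous_intros)
  ultimately show ?thesis
    unfolding path_pair_def by (auto dest: measurable_compose)
qed

text \<open>
  The extension consists of the sample point and, as second coordinate, the value \<open>l h x\<close> at the pair of
  paths \<open>h\<close> and an independent normal vector \<open>x\<close>. The conditional distribution of the second coordinate
  given the paths is the image of the law of \<open>x\<close> under \<open>l h\<close>.
\<close>

theorem realize_limit:
  fixes V :: "nat \<Rightarrow> 'a \<Rightarrow> 'e::euclidean_space" and l :: "C01 \<times> C01 \<Rightarrow> (real \<times> real) \<times> (real \<times> real) \<Rightarrow> 'e"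
  assumes l: "(\<lambda>(h, x). l h x) \<in> borel_measurable (borel \<Otimes>\<^sub>M std_normal4)"
    and conv: "converges_in_distribution M (\<lambda>n \<omega>. (V n \<omega>, to_C01 (X \<omega>), to_C01 (Y \<omega>)))
      MN (\<lambda>z. (l (path_pair (fst z)) (snd z), to_C01 (X (fst z)), to_C01 (Y (fst z))))"
    and normal: "AE \<omega> in M. centered_normal (distr std_normal4 borel (l (path_pair \<omega>)))"
  shows "\<exists>(M' :: ('a \<times> 'e) measure) \<pi> (Z :: 'a \<times> 'e \<Rightarrow> 'e).
      extends_prob_space M' M \<pi> \<and>
      converges_in_distribution M (\<lambda>n \<omega>. (V n \<omega>, to_C01 (X \<omega>), to_C01 (Y \<omega>)))
        M' (\<lambda>\<omega>. (Z \<omega>, to_C01 (X (\<pi> \<omega>)), to_C01 (Y (\<pi> \<omega>)))) \<and>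
      conditionally_centered_normal M' Z (\<lambda>\<omega>. (to_C01 (X (\<pi> \<omega>)), to_C01 (Y (\<pi> \<omega>))))"
proof -
  interpret S: prob_space std_normal4 by (rule prob_space_std_normal4)
  interpret MN: prob_space MN by (rule prob_space_MN)
  interpret P: pair_prob_space M std_normal4 ..
  note [measurable] = measurable_path_pair
  define \<Lambda> where "\<Lambda> z = l (path_pair (fst z)) (snd z)" for z
  have "(\<lambda>z. (path_pair (fst z), snd z)) \<in> MN \<rightarrow>\<^sub>M borel \<Otimes>\<^sub>M std_normal4" by measurable
  from measurable_compose[OF this l] have \<Lambda>[measurable]: "\<Lambda> \<in> borel_measurable MN" by (simp add: \<Lambda>_def[abs_def])
  define T where "T z = (fst z, \<Lambda> z)" for z
  have T[measurable]: "T \<in> MN \<rightarrow>\<^sub>M M \<Otimes>\<^sub>M borel" unfolding T_def by measurable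
  define M' where "M' = distr MN (M \<Otimes>\<^sub>M borel) T"
  have sets_M'[measurable_cong]: "sets M' = sets (M \<Otimes>\<^sub>M borel)" by (simp add: M'_def)
  have space_M': "space M' = space M \<times> UNIV" by (simp add: M'_def space_pair_measure)
  have fst_M': "fst \<in> M' \<rightarrow>\<^sub>M M" and snd_M': "snd \<in> M' \<rightarrow>\<^sub>M borel" by measurable
  have "distr M' M fst = distr MN M (\<lambda>z. fst (T z))"
    unfolding M'_def by (subst distr_distr) (auto simp: comp_def)
  then have ext: "extends_prob_space M' M fst"
    unfolding extends_prob_space_def using fst_M' MN.prob_space_distr[OF T] distr_MN_fst by (simp add: M'_def T_def)
  have triple: "(\<lambda>\<omega>. (snd \<omega>, to_C01 (X (fst \<omega>)), to_C01 (Y (fst \<omega>)))) \<in> borel_measurable M'"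
    by (intro measurable_pair_to_C01 snd_M' measurable_compose[OF fst_M'] measurable_X measurable_Y contX contY)
       (auto simp: space_M')
  have conv': "converges_in_distribution M (\<lambda>n \<omega>. (V n \<omega>, to_C01 (X \<omega>), to_C01 (Y \<omega>)))
        M' (\<lambda>\<omega>. (snd \<omega>, to_C01 (X (fst \<omega>)), to_C01 (Y (fst \<omega>))))"
    unfolding converges_in_distribution_def
  proof (intro conjI allI impI triple)
    show "(\<lambda>\<omega>. (V n \<omega>, to_C01 (X \<omega>), to_C01 (Y \<omega>))) \<in> borel_measurable M" for n
      using conv by (auto simp: converges_in_distribution_def)
    fix \<phi> :: "'e \<times> C01 \<times> C01 \<Rightarrow> real" assume \<phi>: "continuous_on UNIV \<phi> \<and> bounded (range \<phi>)"
    have m: "(\<lambda>\<omega>. \<phi> (snd \<omega>, to_C01 (X (fst \<omega>)), to_C01 (Y (fst \<omega>)))) \<in> borel_measurable (M \<Otimes>\<^sub>M borel)"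
      using measurable_compose[OF triple borel_measurable_continuous_onI[OF conjunct1[OF \<phi>]]]
      by (simp cong: measurable_cong_sets add: sets_M')
    have "(\<integral>\<omega>. \<phi> (snd \<omega>, to_C01 (X (fst \<omega>)), to_C01 (Y (fst \<omega>))) \<partial>M')
      = (\<integral>z. \<phi> (l (path_pair (fst z)) (snd z), to_C01 (X (fst z)), to_C01 (Y (fst z))) \<partial>MN)"
      unfolding M'_def by (subst integral_distr[OF T m]) (simp add: T_def \<Lambda>_def)
    then show "(\<lambda>n. \<integral>\<omega>. \<phi> (V n \<omega>, to_C01 (X \<omega>), to_C01 (Y \<omega>)) \<partial>M)
        \<longlonglongrightarrow> (\<integral>\<omega>. \<phi> (snd \<omega>, to_C01 (X (fst \<omega>)), to_C01 (Y (fst \<omega>))) \<partial>M')"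
      using conv \<phi> by (simp add: converges_in_distribution_def)
  qed
  have cond: "conditionally_centered_normal M' snd (\<lambda>\<omega>. path_pair (fst \<omega>))"
    unfolding conditionally_centered_normal_def
  proof (intro conjI snd_M')
    show mp: "(\<lambda>\<omega>. path_pair (fst \<omega>)) \<in> borel_measurable M'"
      by (rule measurable_compose[OF fst_M' measurable_path_pair])
    define \<kappa> where "\<kappa> h = distr std_normal4 borel (l h)" for h
    have \<kappa>[measurable]: "\<kappa> \<in> measurable borel (prob_algebra borel)"
      unfolding \<kappa>_def
      by (rule measurable_distr_prob_space2[OF _ l]) (auto simp: space_prob_algebra prob_space_std_normal4)
    have lh: "l h \<in> borel_measurable std_normal4" for h
      using measurable_compose[OF measurable_Pair1' l, of h] by simp
    show "\<exists>\<kappa>\<in>borel \<rightarrow>\<^sub>M prob_algebra borel. (\<forall>S\<in>sets borel. \<forall>B\<in>sets borel.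
        Sigma_Algebra.measure M' {\<omega> \<in> space M'. snd \<omega> \<in> S \<and> path_pair (fst \<omega>) \<in> B} =
        (\<integral>\<omega>. indicator B (path_pair (fst \<omega>)) * Sigma_Algebra.measure (\<kappa> (path_pair (fst \<omega>))) S \<partial>M')) \<and>
      (AE \<omega> in M'. centered_normal (\<kappa> (path_pair (fst \<omega>))))"
    proof (intro bexI[OF _ \<kappa>] conjI ballI)
      fix S :: "'e set" and B :: "(C01 \<times> C01) set" assume S[measurable]: "S \<in> sets borel" and B[measurable]: "B \<in> sets borel"
      have [measurable]: "(\<lambda>h. Sigma_Algebra.measure (\<kappa> h) S) \<in> borel_measurable borel"
        using \<kappa> measurable_measure_prob_algebra[OF S] by (rule measurable_compose)
      have mI: "(\<lambda>\<omega>. indicator B (path_pair (fst \<omega>)) * Sigma_Algebra.measure (\<kappa> (path_pair (fst \<omega>))) S) \<in> borel_measurable (M \<Otimes>\<^sub>M (borel :: 'e measure))"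
        by measurable
      define R where "R = {z\<in>space MN. \<Lambda> z \<in> S \<and> path_pair (fst z) \<in> B}"
      have R[measurable]: "R \<in> sets MN" unfolding R_def by measurable
      have "{\<omega> \<in> space M'. snd \<omega> \<in> S \<and> path_pair (fst \<omega>) \<in> B} \<in> sets (M \<Otimes>\<^sub>M borel)"
        unfolding space_M' using mp snd_M' by (auto simp: space_M'[symmetric] sets_M'[symmetric])
      then have "Sigma_Algebra.measure M' {\<omega> \<in> space M'. snd \<omega> \<in> S \<and> path_pair (fst \<omega>) \<in> B}
         = MN.prob (T -` {\<omega> \<in> space M'. snd \<omega> \<in> S \<and> path_pair (fst \<omega>) \<in> B} \<inter> space MN)"
        unfolding M'_def by (subst measure_distr[OF T]) (auto simp: M'_def)
      also have "T -` {\<omega> \<in> space M'. snd \<omega> \<in> S \<and> path_pair (fst \<omega>) \<in> B} \<inter> space MN = R"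
        by (auto simp: T_def R_def space_M' space_pair_measure)
      also have "MN.prob R = (\<integral>z. indicator R z \<partial>MN)" by simp
      also have "\<dots> = (\<integral>\<omega>. (\<integral>x. indicator R (\<omega>, x) \<partial>std_normal4) \<partial>M)"
        by (rule P.integral_fst'[symmetric]) (auto simp: MN.emeasure_eq_measure)
      also have "\<dots> = (\<integral>\<omega>. indicator B (path_pair \<omega>) * Sigma_Algebra.measure (\<kappa> (path_pair \<omega>)) S \<partial>M)"
      proof (rule Bochner_Integration.integral_cong[OF refl])
        fix \<omega> assume \<omega>: "\<omega> \<in> space M"
        have "(\<integral>x. indicat_real R (\<omega>, x) \<partial>std_normal4)
          = (\<integral>x. indicator B (path_pair \<omega>) * indicator (l (path_pair \<omega>) -` S \<inter> space std_normal4) x \<partial>std_normal4)"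
          using \<omega> by (intro Bochner_Integration.integral_cong) (auto simp: R_def \<Lambda>_def space_pair_measure indicator_def)
        also have "\<dots> = indicator B (path_pair \<omega>) * S.prob (l (path_pair \<omega>) -` S \<inter> space std_normal4)"
          by (simp add: Int_absorb1)
        also have "S.prob (l (path_pair \<omega>) -` S \<inter> space std_normal4) = Sigma_Algebra.measure (\<kappa> (path_pair \<omega>)) S"
          unfolding \<kappa>_def by (rule measure_distr[symmetric, OF lh S])
        finally show "(\<integral>x. indicat_real R (\<omega>, x) \<partial>std_normal4) = indicator B (path_pair \<omega>) * Sigma_Algebra.measure (\<kappa> (path_pair \<omega>)) S" .
      qed
      also have "\<dots> = (\<integral>z. indicator B (path_pair (fst z)) * Sigma_Algebra.measure (\<kappa> (path_pair (fst z))) S \<partial>MN)"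
        by (subst distr_MN_fst[symmetric], subst integral_distr) auto
      also have "\<dots> = (\<integral>\<omega>. indicator B (path_pair (fst \<omega>)) * Sigma_Algebra.measure (\<kappa> (path_pair (fst \<omega>))) S \<partial>M')"
        unfolding M'_def by (subst integral_distr[OF T mI]) (simp add: T_def)
      finally show "Sigma_Algebra.measure M' {\<omega> \<in> space M'. snd \<omega> \<in> S \<and> path_pair (fst \<omega>) \<in> B} =
        (\<integral>\<omega>. indicator B (path_pair (fst \<omega>)) * Sigma_Algebra.measure (\<kappa> (path_pair (fst \<omega>))) S \<partial>M')" .
    next
      have d: "distr M' M fst = M" using ext by (simp add: extends_prob_space_def)
      have "AE \<omega> in distr M' M fst. centered_normal (\<kappa> (path_pair \<omega>))"
        unfolding d \<kappa>_def by (rule normal)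
      then show "AE \<omega> in M'. centered_normal (\<kappa> (path_pair (fst \<omega>)))"
        by (rule AE_distrD[OF fst_M'])
    qed
  qed
  show ?thesis
    using ext conv' cond unfolding path_pair_def by blast
qed

lemma measurable_C01_functionals:
  "(\<lambda>h. A (from_C01 (fst h)) (from_C01 (snd h))) \<in> borel_measurable (borel :: (C01 \<times> C01) measure)"
  "(\<lambda>h. A (from_C01 (fst h)) (from_C01 (fst h))) \<in> borel_measurable (borel :: (C01 \<times> C01) measure)"
  "(\<lambda>h. A (from_C01 (snd h)) (from_C01 (snd h))) \<in> borel_measurable (borel :: (C01 \<times> C01) measure)"
proof -
  have 1: "(\<lambda>h :: C01 \<times> C01. from_C01 (fst h) t) \<in> borel_measurable borel" for t
    by (intro borel_measurable_continuous_onI continuous_on_compose2[OF continuous_on_from_C01_eval] continuous_intros) auto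
  have 2: "(\<lambda>h :: C01 \<times> C01. from_C01 (snd h) t) \<in> borel_measurable borel" for t
    by (intro borel_measurable_continuous_onI continuous_on_compose2[OF continuous_on_from_C01_eval] continuous_intros) auto
  show "(\<lambda>h. A (from_C01 (fst h)) (from_C01 (snd h))) \<in> borel_measurable (borel :: (C01 \<times> C01) measure)"
    "(\<lambda>h. A (from_C01 (fst h)) (from_C01 (fst h))) \<in> borel_measurable (borel :: (C01 \<times> C01) measure)"
    "(\<lambda>h. A (from_C01 (snd h)) (from_C01 (snd h))) \<in> borel_measurable (borel :: (C01 \<times> C01) measure)"
    using measurable_A_limit[of "\<lambda>h. from_C01 (fst h)" "borel :: (C01 \<times> C01) measure" "\<lambda>h. from_C01 (snd h)"]
      measurable_A_limit[of "\<lambda>h. from_C01 (fst h)" "borel :: (C01 \<times> C01) measure" "\<lambda>h. from_C01 (fst h)"]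
      measurable_A_limit[of "\<lambda>h. from_C01 (snd h)" "borel :: (C01 \<times> C01) measure" "\<lambda>h. from_C01 (snd h)"]
      1 2 continuous_on_from_C01 by blast+
qed

text \<open>
  The noise as a function on path space; this form is needed for a kernel on \<open>C([0,1])\<^sup>2\<close>.
\<close>

definition noise_kernel :: "C01 \<times> C01 \<Rightarrow> (real \<times> real) \<times> (real \<times> real) \<Rightarrow> real^3"
  where "noise_kernel h = noise r (A (from_C01 (fst h)) (from_C01 (snd h))) (A (from_C01 (fst h)) (from_C01 (fst h))) (A (from_C01 (snd h)) (from_C01 (snd h)))"

definition gradient_kernel :: "C01 \<times> C01 \<Rightarrow> real^3"
  where "gradient_kernel h = F_gradient (A (from_C01 (fst h)) (from_C01 (snd h))) (A (from_C01 (fst h)) (from_C01 (fst h))) (A (from_C01 (snd h)) (from_C01 (snd h)))"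

lemma kernels_path_pair:
  assumes "\<omega> \<in> space M"
  shows "noise_kernel (path_pair \<omega>) x = limit_noise (\<omega>, x)" "gradient_kernel (path_pair \<omega>) = gF \<omega>"
  unfolding noise_kernel_def gradient_kernel_def limit_noise_def gF_def path_pair_functionals[OF assms] by simp_all

lemma measurable_noise_kernel: "(\<lambda>(h, x). noise_kernel h x) \<in> borel_measurable (borel \<Otimes>\<^sub>M std_normal4)"
proof -
  have "snd \<in> ((borel :: (C01 \<times> C01) measure) \<Otimes>\<^sub>M std_normal4) \<rightarrow>\<^sub>M borel"
    using measurable_snd[of "borel :: (C01 \<times> C01) measure" std_normal4] by (simp cong: measurable_cong_sets add: sets_std_normal4)
  then show ?thesis
    unfolding noise_kernel_def split_beta
    by (intro measurable_noise measurable_compose[OF measurable_fst measurable_C01_functionals(1)]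
       measurable_compose[OF measurable_fst measurable_C01_functionals(2)] measurable_compose[OF measurable_fst measurable_C01_functionals(3)])
qed

lemma measurable_gradient_kernel: "(\<lambda>(h, x). gradient_kernel h \<bullet> noise_kernel h x) \<in> borel_measurable (borel \<Otimes>\<^sub>M std_normal4)"
proof -
  have "(\<lambda>p. gradient_kernel (fst p)) \<in> borel_measurable ((borel :: (C01 \<times> C01) measure) \<Otimes>\<^sub>M std_normal4)"
    unfolding gradient_kernel_def
    by (intro measurable_F_gradient measurable_compose[OF measurable_fst measurable_C01_functionals(1)]
       measurable_compose[OF measurable_fst measurable_C01_functionals(2)] measurable_compose[OF measurable_fst measurable_C01_functionals(3)])
  then show ?thesis using measurable_noise_kernel unfolding split_beta by measurable
qed

lemma limit_noise_projection_normal: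
  assumes "\<omega> \<in> space M"
  shows "distr std_normal4 borel (\<lambda>x. u \<bullet> limit_noise (\<omega>, x))
     = normal_law 0 (sqrt (noise_qf r (A (X \<omega>) (Y \<omega>)) (A (X \<omega>) (X \<omega>)) (A (Y \<omega>) (Y \<omega>)) u))"
proof -
  note c = contX[OF assms] contY[OF assms]
  show ?thesis
    unfolding limit_noise_def fst_conv snd_conv
    by (rule noise_projection_normal[OF A_nonneg[OF c(1)] A_nonneg[OF c(2)]
      A_Cauchy_Schwarz[OF c] r])
qed

lemma noise_qf_limit_nonneg:
  assumes "\<omega> \<in> space M"
  shows "0 \<le> noise_qf r (A (X \<omega>) (Y \<omega>)) (A (X \<omega>) (X \<omega>)) (A (Y \<omega>) (Y \<omega>)) u"
proof -
  note c = contX[OF assms] contY[OF assms]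
  obtain c1 c2 c3 c4 where "c1\<^sup>2 + c2\<^sup>2 + c3\<^sup>2 + c4\<^sup>2 = noise_qf r (A (X \<omega>) (Y \<omega>)) (A (X \<omega>) (X \<omega>)) (A (Y \<omega>) (Y \<omega>)) u"
    by (rule noise_projection[OF A_nonneg[OF c(1)] A_nonneg[OF c(2)]
      A_Cauchy_Schwarz[OF c] r, where u = u], rule that)
  then show ?thesis by (metis add_nonneg_nonneg zero_le_power2)
qed

lemma borel_fst_snd: "(\<lambda>p :: (real^3) \<times> (bool \<times> nat \<Rightarrow> real). fst p) \<in> borel_measurable borel"
  "(\<lambda>p :: (real^3) \<times> (bool \<times> nat \<Rightarrow> real). snd p i) \<in> borel_measurable borel"
proof -
  show "(\<lambda>p :: (real^3) \<times> (bool \<times> nat \<Rightarrow> real). fst p) \<in> borel_measurable borel"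
    by (intro borel_measurable_continuous_onI continuous_intros)
  have "(\<lambda>p :: (real^3) \<times> (bool \<times> nat \<Rightarrow> real). snd p) \<in> borel_measurable borel"
    by (intro borel_measurable_continuous_onI continuous_intros)
  from measurable_compose[OF this measurable_coordinate]
  show "(\<lambda>p :: (real^3) \<times> (bool \<times> nat \<Rightarrow> real). snd p i) \<in> borel_measurable borel" .
qed

theorem fluctuation_limit:
  "\<exists>(M' :: ('a \<times> (real^3)) measure) \<pi> (Z :: 'a \<times> (real^3) \<Rightarrow> real^3).
      extends_prob_space M' M \<pi> \<and>
      converges_in_distribution M (\<lambda>n \<omega>. (fluctuation n \<omega>, to_C01 (X \<omega>), to_C01 (Y \<omega>)))
        M' (\<lambda>\<omega>. (Z \<omega>, to_C01 (X (\<pi> \<omega>)), to_C01 (Y (\<pi> \<omega>)))) \<and>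
      conditionally_centered_normal M' Z (\<lambda>\<omega>. (to_C01 (X (\<pi> \<omega>)), to_C01 (Y (\<pi> \<omega>))))"
proof (rule realize_limit[OF measurable_noise_kernel])
  show "converges_in_distribution M (\<lambda>n \<omega>. (fluctuation n \<omega>, to_C01 (X \<omega>), to_C01 (Y \<omega>)))
      MN (\<lambda>z. (noise_kernel (path_pair (fst z)) (snd z), to_C01 (X (fst z)), to_C01 (Y (fst z))))"
  proof (rule converges_to_transformed_noise[where G = "\<lambda>n g z. z"])
    show "AE z in MN. (\<lambda>n. grid_noise r n (grid_increments n (fst z)) (snd z)) \<longlonglongrightarrow> noise_kernel (path_pair (fst z)) (snd z)"
      using grid_noise_tendsto AE_space
      by eventually_elim (auto simp: kernels_path_pair space_pair_measure)
    show "(\<lambda>z. noise_kernel (path_pair (fst z)) (snd z)) \<in> borel_measurable MN"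
      by (subst measurable_cong[of _ _ limit_noise]) (auto simp: kernels_path_pair space_pair_measure measurable_limit_noise)
  qed (use measurable_fluctuation borel_fst_snd null_fluctuation in auto)
  show "AE \<omega> in M. centered_normal (distr std_normal4 borel (noise_kernel (path_pair \<omega>)))"
  proof (rule AE_I2)
    fix \<omega> assume \<omega>: "\<omega> \<in> space M"
    have m[measurable]: "noise_kernel (path_pair \<omega>) \<in> borel_measurable std_normal4"
      using measurable_compose[OF measurable_Pair1' measurable_noise_kernel, of "path_pair \<omega>"] by simp
    show "centered_normal (distr std_normal4 borel (noise_kernel (path_pair \<omega>)))"
      unfolding centered_normal_def
    proof (intro conjI allI)
      fix u
      have "distr (distr std_normal4 borel (noise_kernel (path_pair \<omega>))) borel (\<lambda>x. x \<bullet> u) = distr std_normal4 borel (\<lambda>x. u \<bullet> limit_noise (\<omega>, x))"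
        by (subst distr_distr) (auto simp: comp_def kernels_path_pair[OF \<omega>] inner_commute)
      then show "\<exists>s\<ge>0. distr (distr std_normal4 borel (noise_kernel (path_pair \<omega>))) borel (\<lambda>x. x \<bullet> u) = normal_law 0 s"
        using limit_noise_projection_normal[OF \<omega>] noise_qf_limit_nonneg[OF \<omega>] by (metis real_sqrt_ge_0_iff)
    qed simp
  qed
qed

theorem rho_fluctuation_limit:
  "\<exists>(M' :: ('a \<times> real) measure) \<pi> (Z :: 'a \<times> real \<Rightarrow> real).
      extends_prob_space M' M \<pi> \<and>
      converges_in_distribution M (\<lambda>n \<omega>. (rho_fluctuation n \<omega>, to_C01 (X \<omega>), to_C01 (Y \<omega>)))
        M' (\<lambda>\<omega>. (Z \<omega>, to_C01 (X (\<pi> \<omega>)), to_C01 (Y (\<pi> \<omega>)))) \<and>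
      conditionally_centered_normal M' Z (\<lambda>\<omega>. (to_C01 (X (\<pi> \<omega>)), to_C01 (Y (\<pi> \<omega>))))"
proof (rule realize_limit[OF measurable_gradient_kernel])
  show "converges_in_distribution M (\<lambda>n \<omega>. (rho_fluctuation n \<omega>, to_C01 (X \<omega>), to_C01 (Y \<omega>)))
      MN (\<lambda>z. (gradient_kernel (path_pair (fst z)) \<bullet> noise_kernel (path_pair (fst z)) (snd z), to_C01 (X (fst z)), to_C01 (Y (fst z))))"
  proof (rule converges_to_transformed_noise[where G = "\<lambda>n g z. gF_n n g \<bullet> z"])
    show "AE z in MN. (\<lambda>n. gF_n n (grid_increments n (fst z)) \<bullet> grid_noise r n (grid_increments n (fst z)) (snd z))
        \<longlonglongrightarrow> gradient_kernel (path_pair (fst z)) \<bullet> noise_kernel (path_pair (fst z)) (snd z)"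
      using grid_noise_tendsto AE_MN_fst[OF gF_n_tendsto] AE_space
      by eventually_elim (auto simp: kernels_path_pair space_pair_measure intro!: tendsto_inner)
    show "(\<lambda>z. gradient_kernel (path_pair (fst z)) \<bullet> noise_kernel (path_pair (fst z)) (snd z)) \<in> borel_measurable MN"
    proof (subst measurable_cong)
      show "(\<lambda>z. gF (fst z) \<bullet> limit_noise z) \<in> borel_measurable MN"
        by (intro borel_measurable_inner measurable_limit_noise measurable_compose[OF measurable_fst measurable_gF])
    qed (auto simp: kernels_path_pair space_pair_measure)
    show "(\<lambda>p. gF_n n (snd p) \<bullet> fst p) \<in> borel_measurable borel" for n
      by (intro borel_measurable_inner measurable_gF_n borel_fst_snd)
  qed (use measurable_rho_fluctuation null_rho_fluctuation in auto)
  show "AE \<omega> in M. centered_normal (distr std_normal4 borel (\<lambda>x. gradient_kernel (path_pair \<omega>) \<bullet> noise_kernel (path_pair \<omega>) x))"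
  proof (rule AE_I2)
    fix \<omega> assume \<omega>: "\<omega> \<in> space M"
    have m[measurable]: "noise_kernel (path_pair \<omega>) \<in> borel_measurable std_normal4"
      using measurable_compose[OF measurable_Pair1' measurable_noise_kernel, of "path_pair \<omega>"] by simp
    have "noise_kernel (path_pair \<omega>) = (\<lambda>x. limit_noise (\<omega>, x))" using kernels_path_pair(1)[OF \<omega>] by (simp add: fun_eq_iff)
    with m have [measurable]: "(\<lambda>x. limit_noise (\<omega>, x)) \<in> borel_measurable std_normal4" by simp
    show "centered_normal (distr std_normal4 borel (\<lambda>x. gradient_kernel (path_pair \<omega>) \<bullet> noise_kernel (path_pair \<omega>) x))"
      unfolding centered_normal_def
    proof (intro conjI allI)
      fix u :: real
      have "distr (distr std_normal4 borel (\<lambda>x. gradient_kernel (path_pair \<omega>) \<bullet> noise_kernel (path_pair \<omega>) x)) borel (\<lambda>x. x \<bullet> u)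
         = distr std_normal4 borel (\<lambda>x. (u *\<^sub>R gF \<omega>) \<bullet> limit_noise (\<omega>, x))"
        by (subst distr_distr) (auto simp: comp_def kernels_path_pair[OF \<omega>] mult.commute)
      then show "\<exists>s\<ge>0. distr (distr std_normal4 borel (\<lambda>x. gradient_kernel (path_pair \<omega>) \<bullet> noise_kernel (path_pair \<omega>) x)) borel (\<lambda>x. x \<bullet> u) = normal_law 0 s"
        using limit_noise_projection_normal[OF \<omega>] noise_qf_limit_nonneg[OF \<omega>] by (metis real_sqrt_ge_0_iff)
    qed simp
  qed
qed

text \<open>
  Given almost any pair of paths, the limit variable is normal with variance one; as this law does not
  depend on the paths, the unconditional law is standard normal.
\<close>

theorem normalized_rho_fluctuation_limit:
  "weak_conv_m (\<lambda>n. distr M borel (\<lambda>\<omega>. rho_fluctuation n \<omega> / sd \<omega>)) std_normal_distribution"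
proof -
  interpret S: prob_space std_normal4 by (rule prob_space_std_normal4)
  interpret P: pair_prob_space M std_normal4 ..
  note [measurable] = measurable_rho_fluctuation measurable_sd measurable_limit_noise measurable_gF
  define \<Lambda> where "\<Lambda> z = gF (fst z) \<bullet> limit_noise z / sd (fst z)" for z
  have \<Lambda>[measurable]: "\<Lambda> \<in> borel_measurable MN" unfolding \<Lambda>_def by measurable
  have conv: "converges_in_distribution M (\<lambda>n \<omega>. (rho_fluctuation n \<omega> / sd \<omega>, to_C01 (X \<omega>), to_C01 (Y \<omega>)))
      MN (\<lambda>z. (\<Lambda> z, to_C01 (X (fst z)), to_C01 (Y (fst z))))"
  proof (rule converges_to_transformed_noise[where G = "\<lambda>n g z. gF_n n g \<bullet> z / sd_n n g"])
    show "AE z in MN. (\<lambda>n. gF_n n (grid_increments n (fst z)) \<bullet> grid_noise r n (grid_increments n (fst z)) (snd z) / sd_n n (grid_increments n (fst z)))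
        \<longlonglongrightarrow> \<Lambda> z"
      using grid_noise_tendsto AE_MN_fst[OF gF_n_tendsto] AE_MN_fst[OF sd_n_tendsto] AE_MN_fst[OF sd_pos]
      unfolding \<Lambda>_def by eventually_elim (auto intro!: tendsto_intros)
    show "(\<lambda>p. gF_n n (snd p) \<bullet> fst p / sd_n n (snd p)) \<in> borel_measurable borel" for n
      by (intro borel_measurable_divide borel_measurable_inner measurable_gF_n measurable_sd_n borel_fst_snd)
  qed (use null_normalized_rho_fluctuation \<Lambda> in auto)
  show ?thesis
  proof (rule integral_bdd_continuous_conv_imp_weak_conv)
    show "real_distribution (distr M borel (\<lambda>\<omega>. rho_fluctuation n \<omega> / sd \<omega>))" for n
      by (rule real_distribution_distr) measurable
    show "real_distribution std_normal_distribution" by (rule real_dist_normal_dist)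
    fix f :: "real \<Rightarrow> real" assume c: "\<And>x. isCont f x" and b: "\<And>x. \<bar>f x\<bar> \<le> 1"
    have fc: "continuous_on UNIV f" using c by (simp add: continuous_at_imp_continuous_on)
    then have [measurable]: "f \<in> borel_measurable borel" by (rule borel_measurable_continuous_onI)
    have "continuous_on UNIV (\<lambda>p :: real \<times> C01 \<times> C01. f (fst p))"
      by (intro continuous_on_compose2[OF fc] continuous_intros) auto
    moreover have "bounded (range (\<lambda>p :: real \<times> C01 \<times> C01. f (fst p)))"
      using b by (auto simp: bounded_iff)
    ultimately have "(\<lambda>n. \<integral>\<omega>. f (fst (rho_fluctuation n \<omega> / sd \<omega>, to_C01 (X \<omega>), to_C01 (Y \<omega>))) \<partial>M)
       \<longlonglongrightarrow> (\<integral>z. f (fst (\<Lambda> z, to_C01 (X (fst z)), to_C01 (Y (fst z)))) \<partial>MN)"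
      using conv unfolding converges_in_distribution_def by blast
    then have "(\<lambda>n. \<integral>\<omega>. f (rho_fluctuation n \<omega> / sd \<omega>) \<partial>M) \<longlonglongrightarrow> (\<integral>z. f (\<Lambda> z) \<partial>MN)" by simp
    also have "(\<integral>z. f (\<Lambda> z) \<partial>MN) = (\<integral>\<omega>. (\<integral>x. f (\<Lambda> (\<omega>, x)) \<partial>std_normal4) \<partial>M)"
      by (rule P.integral_fst'[symmetric]) (rule P.integrable_const_bound[of _ 1], use b in auto)
    also have "\<dots> = (\<integral>\<omega>. integral\<^sup>L std_normal_distribution f \<partial>M)"
    proof (rule integral_cong_AE)
      show "AE \<omega> in M. (\<integral>x. f (\<Lambda> (\<omega>, x)) \<partial>std_normal4) = integral\<^sup>L std_normal_distribution f"
        using sd_pos AE_nondegenerate AE_space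
      proof eventually_elim
        case (elim \<omega>)
        have [measurable]: "(\<lambda>x. \<Lambda> (\<omega>, x)) \<in> borel_measurable std_normal4"
          using measurable_compose[OF measurable_Pair1'[OF elim(3)] \<Lambda>] .
        have \<Lambda>_eq: "(\<lambda>x. \<Lambda> (\<omega>, x)) = (\<lambda>x. ((1 / sd \<omega>) *\<^sub>R gF \<omega>) \<bullet> limit_noise (\<omega>, x))" by (simp add: \<Lambda>_def fun_eq_iff)
        have "distr std_normal4 borel (\<lambda>x. \<Lambda> (\<omega>, x)) = normal_law 0 (sqrt ((1 / sd \<omega>)\<^sup>2 *
            noise_qf r (A (X \<omega>) (Y \<omega>)) (A (X \<omega>) (X \<omega>)) (A (Y \<omega>) (Y \<omega>)) (gF \<omega>)))"
          unfolding \<Lambda>_eq noise_qf_scale[symmetric] by (rule limit_noise_projection_normal[OF elim(3)])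
        also have "noise_qf r (A (X \<omega>) (Y \<omega>)) (A (X \<omega>) (X \<omega>)) (A (Y \<omega>) (Y \<omega>)) (gF \<omega>) = (sd \<omega>)\<^sup>2"
          unfolding gF_def sd_def using elim r by (intro limit_sd_square[symmetric]) auto
        also have "sqrt ((1 / sd \<omega>)\<^sup>2 * (sd \<omega>)\<^sup>2) = 1" using elim by (simp add: power_divide)
        finally have "distr std_normal4 borel (\<lambda>x. \<Lambda> (\<omega>, x)) = std_normal_distribution" by (simp add: normal_law_def)
        then have "integral\<^sup>L std_normal_distribution f = integral\<^sup>L (distr std_normal4 borel (\<lambda>x. \<Lambda> (\<omega>, x))) f" by simp
        also have "\<dots> = (\<integral>x. f (\<Lambda> (\<omega>, x)) \<partial>std_normal4)" by (subst integral_distr) auto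
        finally show ?case ..
      qed
    qed measurable
    also have "\<dots> = integral\<^sup>L std_normal_distribution f" by (simp add: prob_space)
    finally have lim: "(\<lambda>n. \<integral>\<omega>. f (rho_fluctuation n \<omega> / sd \<omega>) \<partial>M) \<longlonglongrightarrow> integral\<^sup>L std_normal_distribution f" .
    have "integral\<^sup>L (distr M borel (\<lambda>\<omega>. rho_fluctuation n \<omega> / sd \<omega>)) f = (\<integral>\<omega>. f (rho_fluctuation n \<omega> / sd \<omega>) \<partial>M)" for n
      by (subst integral_distr) auto
    then show "(\<lambda>n. integral\<^sup>L (distr M borel (\<lambda>\<omega>. rho_fluctuation n \<omega> / sd \<omega>)) f) \<longlonglongrightarrow> integral\<^sup>L std_normal_distribution f"
      using lim by simp
  qed
qed

lemma mu_eq: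
  assumes "0 < A (X \<omega>) (X \<omega>)" "0 < A (Y \<omega>) (Y \<omega>)"
  shows "mu (X \<omega>) (Y \<omega>) = gF \<omega> \<bullet> mu_vec (X \<omega>) (Y \<omega>)"
proof -
  have "gradient F (U (X \<omega>) (Y \<omega>)) = gF \<omega>"
    by (rule gradient_eqI) (use F_has_gradient[of "U (X \<omega>) (Y \<omega>)"] assms in \<open>simp add: U_def D_eq_A gF_def\<close>)
  then show ?thesis by (simp add: mu_def)
qed

text \<open>
  Where one of the variances vanishes, \<open>sigma_r\<close> is a quotient by zero, hence zero, and so are both sides;
  so the identity holds at every sample point and yields the same law.
\<close>

lemma normalized_rho_fluctuation_eq:
  assumes \<omega>: "\<omega> \<in> space M"
  shows "(real n * (rho_n n (X \<omega>) (Y \<omega>) - rho (X \<omega>) (Y \<omega>)) - mu (X \<omega>) (Y \<omega>)) / sigma_r r (X \<omega>) (Y \<omega>) = rho_fluctuation n \<omega> / sd \<omega>"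
proof (cases "A (X \<omega>) (X \<omega>) * A (Y \<omega>) (Y \<omega>) = 0")
  case True
  then show ?thesis by (simp add: sigma_r_eq sd_def limit_sd_def)
next
  case False
  then have "0 < A (X \<omega>) (X \<omega>)" "0 < A (Y \<omega>) (Y \<omega>)"
    using A_nonneg[OF contX[OF \<omega>]] A_nonneg[OF contY[OF \<omega>]] by auto
  then show ?thesis by (simp add: mu_eq rho_fluctuation_def sigma_r_eq sd_def)
qed

end

section \<open>Correlated Brownian motions as members of a Gaussian space\<close>

lemma gaussian_space_span:
  assumes M: "prob_space M" and Z: "centered_gaussian_process M T Z"
  shows "gaussian_space M {\<lambda>\<omega>. \<Sum>i\<in>S. c i * Z i \<omega> | S c. finite S \<and> S \<subseteq> T}"
proof -
  interpret prob_space M by fact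
  have m: "(\<lambda>\<omega>. \<Sum>i\<in>S. c i * Z i \<omega>) \<in> borel_measurable M" if "S \<subseteq> T" for S c
    using Z that by (intro borel_measurable_sum borel_measurable_times) (auto simp: centered_gaussian_process_def)
  show ?thesis
  proof
    show "(\<lambda>_. 0) \<in> {\<lambda>\<omega>. \<Sum>i\<in>S. c i * Z i \<omega> | S c. finite S \<and> S \<subseteq> T}"
      by (intro CollectI exI[of _ "{}"]) auto
    fix P assume "P \<in> {\<lambda>\<omega>. \<Sum>i\<in>S. c i * Z i \<omega> | S c. finite S \<and> S \<subseteq> T}"
    then obtain S c where P: "P = (\<lambda>\<omega>. \<Sum>i\<in>S. c i * Z i \<omega>)" "finite S" "S \<subseteq> T" by auto
    show "P \<in> borel_measurable M" unfolding P(1) by (rule m[OF P(3)])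
    show "\<exists>s\<ge>0. distr M borel P = normal_law 0 s"
      using Z P unfolding centered_gaussian_process_def by auto
    fix P' a b assume "P' \<in> {\<lambda>\<omega>. \<Sum>i\<in>S. c i * Z i \<omega> | S c. finite S \<and> S \<subseteq> T}"
    then obtain S' c' where P': "P' = (\<lambda>\<omega>. \<Sum>i\<in>S'. c' i * Z i \<omega>)" "finite S'" "S' \<subseteq> T" by auto
    have ext: "(\<Sum>i\<in>R. d i * Z i \<omega>) = (\<Sum>i\<in>S \<union> S'. (if i \<in> R then d i else 0) * Z i \<omega>)" if "R \<subseteq> S \<union> S'" for R d \<omega>
      using P P' that by (intro sum.mono_neutral_cong_left) auto
    have "a * P \<omega> + b * P' \<omega> = (\<Sum>i\<in>S \<union> S'. (a * (if i \<in> S then c i else 0) + b * (if i \<in> S' then c' i else 0)) * Z i \<omega>)" for \<omega>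
      unfolding P(1) P'(1) ext[of S, OF Un_upper1] ext[of S', OF Un_upper2] by (simp add: sum_distrib_left sum.distrib distrib_right mult.assoc)
    then show "(\<lambda>\<omega>. a * P \<omega> + b * P' \<omega>) \<in> {\<lambda>\<omega>. \<Sum>i\<in>S. c i * Z i \<omega> | S c. finite S \<and> S \<subseteq> T}"
      using P P' by (intro CollectI exI[of _ "S \<union> S'"]) (auto intro!: exI)
  qed
qed

text \<open>
  From the variances of the increments:
  \<open>2 E(W\<^sub>s W\<^sub>t) = E W\<^sub>s\<^sup>2 + E W\<^sub>t\<^sup>2 - E(W\<^sub>t - W\<^sub>s)\<^sup>2\<close>.
\<close>

lemma (in gaussian_space) standard_brownian_motion_covariance:
  assumes W: "standard_brownian_motion M W" and mem: "\<And>t. t \<in> {0..1} \<Longrightarrow> (\<lambda>\<omega>. W \<omega> t) \<in> H"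
    and "s \<in> {0..1}" "t \<in> {0..1}"
  shows "(\<integral>\<omega>. W \<omega> s * W \<omega> t \<partial>M) = min s t"
proof -
  have incr: "(\<integral>\<omega>. (W \<omega> t - W \<omega> s)\<^sup>2 \<partial>M) = t - s" if "0 \<le> s" "s < t" "t \<le> 1" for s t
  proof -
    have "distributed M lborel (\<lambda>\<omega>. W \<omega> t - W \<omega> s) (normal_density 0 (sqrt (t - s)))"
      using W that by (auto simp: standard_brownian_motion_def)
    then have "distr M lborel (\<lambda>\<omega>. W \<omega> t - W \<omega> s) = density lborel (normal_density 0 (sqrt (t - s)))"
      by (simp add: distributed_def)
    moreover have "distr M lborel (\<lambda>\<omega>. W \<omega> t - W \<omega> s) = distr M borel (\<lambda>\<omega>. W \<omega> t - W \<omega> s)"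
      by (rule distr_cong) auto
    ultimately have law: "distr M borel (\<lambda>\<omega>. W \<omega> t - W \<omega> s) = normal_law 0 (sqrt (t - s))"
      using that by (simp add: normal_law_def)
    have "(\<lambda>\<omega>. W \<omega> t - W \<omega> s) \<in> borel_measurable M"
      using that by (intro measurable_mem diff_mem mem) auto
    from normal_law_second_moment[OF this _ law] show ?thesis using that by simp
  qed
  have zero: "AE \<omega> in M. W \<omega> 0 = 0" using W by (auto simp: standard_brownian_motion_def)
  have var: "(\<integral>\<omega>. (W \<omega> t)\<^sup>2 \<partial>M) = t" if "t \<in> {0..1}" for t
  proof (cases "t = 0")
    case True
    have "(\<integral>\<omega>. (W \<omega> 0)\<^sup>2 \<partial>M) = 0"
      using zero by (intro integral_eq_zero_AE) auto
    then show ?thesis using True by simp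
  next
    case False
    have [measurable]: "(\<lambda>\<omega>. W \<omega> t) \<in> borel_measurable M" "(\<lambda>\<omega>. W \<omega> 0) \<in> borel_measurable M"
      using that by (auto intro!: measurable_mem mem)
    have "(\<integral>\<omega>. (W \<omega> t)\<^sup>2 \<partial>M) = (\<integral>\<omega>. (W \<omega> t - W \<omega> 0)\<^sup>2 \<partial>M)"
      using zero by (intro integral_cong_AE) auto
    then show ?thesis using incr[of 0 t] False that by simp
  qed
  have lt: "(\<integral>\<omega>. W \<omega> s * W \<omega> t \<partial>M) = s" if "s \<in> {0..1}" "t \<in> {0..1}" "s < t" for s t
  proof -
    have "(\<integral>\<omega>. (1 * W \<omega> t + (-1) * W \<omega> s)\<^sup>2 \<partial>M) = t - 2 * (\<integral>\<omega>. W \<omega> t * W \<omega> s \<partial>M) + s"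
      unfolding expectation_square_lin[OF mem[OF that(2)] mem[OF that(1)]] var[OF that(1)] var[OF that(2)] by simp
    then show ?thesis using incr[of s t] that by (simp add: mult.commute)
  qed
  show ?thesis
    using lt[of s t] lt[of t s] var[of s] assms(3,4)
    by (cases s t rule: linorder_cases) (auto simp: mult.commute power2_eq_square)
qed

lemma brownian_pair_of_correlated_brownian_motions:
  assumes M: "prob_space M" and r: "-1 < r" "r < 1" and W: "correlated_brownian_motions M r W1 W2"
  shows "\<exists>H. brownian_pair M H r W1 W2"
proof -
  define Z where "Z = (\<lambda>i \<omega>. case i of Inl t \<Rightarrow> W1 \<omega> t | Inr t \<Rightarrow> W2 \<omega> t)"
  define T where "T = {0..1::real} <+> {0..1::real}"
  define H where "H = {\<lambda>\<omega>. \<Sum>i\<in>S. c i * Z i \<omega> | S c. finite S \<and> S \<subseteq> T}"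
  have "centered_gaussian_process M T Z" using W by (simp add: correlated_brownian_motions_def T_def Z_def)
  from gaussian_space_span[OF M this] interpret gaussian_space M H unfolding H_def .
  have mem: "Z i \<in> H" if "i \<in> T" for i
    unfolding H_def using that by (intro CollectI exI[of _ "{i}"] exI[of _ "\<lambda>_. 1"]) auto
  have m1: "(\<lambda>\<omega>. W1 \<omega> t) \<in> H" if "t \<in> {0..1}" for t using mem[of "Inl t", unfolded T_def, OF InlI[OF that]] by (simp add: Z_def)
  have m2: "(\<lambda>\<omega>. W2 \<omega> t) \<in> H" if "t \<in> {0..1}" for t using mem[of "Inr t", unfolded T_def, OF InrI[OF that]] by (simp add: Z_def)
  have B: "standard_brownian_motion M W1" "standard_brownian_motion M W2" using W by (auto simp: correlated_brownian_motions_def)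
  have "brownian_pair M H r W1 W2"
  proof
    show "(\<integral>\<omega>. W1 \<omega> s * W1 \<omega> t \<partial>M) = min s t" "(\<integral>\<omega>. W2 \<omega> s * W2 \<omega> t \<partial>M) = min s t" if "s \<in> {0..1}" "t \<in> {0..1}" for s t
      using standard_brownian_motion_covariance[OF B(1) m1 that] standard_brownian_motion_covariance[OF B(2) m2 that] by auto
    show "(\<integral>\<omega>. W1 \<omega> s * W2 \<omega> t \<partial>M) = r * min s t" if "s \<in> {0..1}" "t \<in> {0..1}" for s t
      using W that by (auto simp: correlated_brownian_motions_def)
    show "continuous_on {0..1} (W1 \<omega>)" "continuous_on {0..1} (W2 \<omega>)" if "\<omega> \<in> space M" for \<omega>
      using B that by (auto simp: standard_brownian_motion_def)
  qed (use r m1 m2 in auto)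
  then show ?thesis by blast
qed

theorem theorem1p1:
  fixes M :: "'a measure" and W1 W2 :: "'a \<Rightarrow> real \<Rightarrow> real" and r :: real
  assumes "prob_space M"
    and "-1 < r" and "r < 1"
    and "correlated_brownian_motions M r W1 W2"
  shows
    "(\<exists>Z_n :: nat \<Rightarrow> 'a \<Rightarrow> real^3.
        (\<forall>n\<ge>1. \<forall>\<omega>\<in>space M.
          real n *\<^sub>R (U_n n (W1 \<omega>) (W2 \<omega>) - U (W1 \<omega>) (W2 \<omega>)) = mu_vec (W1 \<omega>) (W2 \<omega>) + Z_n n \<omega>) \<and>
        (\<exists>(M' :: ('a \<times> (real^3)) measure) \<pi> (Z :: 'a \<times> (real^3) \<Rightarrow> real^3).
          extends_prob_space M' M \<pi> \<and>
          converges_in_distribution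
            M (\<lambda>n \<omega>. (Z_n n \<omega>, to_C01 (W1 \<omega>), to_C01 (W2 \<omega>)))
            M' (\<lambda>\<omega>. (Z \<omega>, to_C01 (W1 (\<pi> \<omega>)), to_C01 (W2 (\<pi> \<omega>)))) \<and>
          conditionally_centered_normal M' Z
            (\<lambda>\<omega>. (to_C01 (W1 (\<pi> \<omega>)), to_C01 (W2 (\<pi> \<omega>)))))) \<and>
     (\<exists>Y_n :: nat \<Rightarrow> 'a \<Rightarrow> real.
        (\<forall>n\<ge>2. AE \<omega> in M.
          real n * (rho_n n (W1 \<omega>) (W2 \<omega>) - rho (W1 \<omega>) (W2 \<omega>)) = mu (W1 \<omega>) (W2 \<omega>) + Y_n n \<omega>) \<and>
        (\<exists>(M' :: ('a \<times> real) measure) \<pi> (Y :: 'a \<times> real \<Rightarrow> real).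
          extends_prob_space M' M \<pi> \<and>
          converges_in_distribution
            M (\<lambda>n \<omega>. (Y_n n \<omega>, to_C01 (W1 \<omega>), to_C01 (W2 \<omega>)))
            M' (\<lambda>\<omega>. (Y \<omega>, to_C01 (W1 (\<pi> \<omega>)), to_C01 (W2 (\<pi> \<omega>)))) \<and>
          conditionally_centered_normal M' Y
            (\<lambda>\<omega>. (to_C01 (W1 (\<pi> \<omega>)), to_C01 (W2 (\<pi> \<omega>)))))) \<and>
     weak_conv_m
       (\<lambda>n. distr M borel (\<lambda>\<omega>.
          (real n * (rho_n n (W1 \<omega>) (W2 \<omega>) - rho (W1 \<omega>) (W2 \<omega>)) - mu (W1 \<omega>) (W2 \<omega>))
            / sigma_r r (W1 \<omega>) (W2 \<omega>)))
       std_normal_distribution"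
proof -
  obtain H where "brownian_pair M H r W1 W2"
    using brownian_pair_of_correlated_brownian_motions[OF assms] by blast
  then interpret brownian_pair M H r W1 W2 .
  have "\<forall>n\<ge>1. \<forall>\<omega>\<in>space M. real n *\<^sub>R (U_n n (W1 \<omega>) (W2 \<omega>) - U (W1 \<omega>) (W2 \<omega>)) = mu_vec (W1 \<omega>) (W2 \<omega>) + fluctuation n \<omega>"
    by (simp add: fluctuation_def)
  moreover have "\<forall>n\<ge>2. AE \<omega> in M. real n * (rho_n n (W1 \<omega>) (W2 \<omega>) - rho (W1 \<omega>) (W2 \<omega>)) = mu (W1 \<omega>) (W2 \<omega>) + rho_fluctuation n \<omega>"
  proof (intro allI impI)
    fix n :: nat
    show "AE \<omega> in M. real n * (rho_n n (W1 \<omega>) (W2 \<omega>) - rho (W1 \<omega>) (W2 \<omega>)) = mu (W1 \<omega>) (W2 \<omega>) + rho_fluctuation n \<omega>"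
      using AE_nondegenerate by eventually_elim (simp add: mu_eq rho_fluctuation_def)
  qed
  moreover have "distr M borel (\<lambda>\<omega>. (real n * (rho_n n (W1 \<omega>) (W2 \<omega>) - rho (W1 \<omega>) (W2 \<omega>)) - mu (W1 \<omega>) (W2 \<omega>)) / sigma_r r (W1 \<omega>) (W2 \<omega>))
      = distr M borel (\<lambda>\<omega>. rho_fluctuation n \<omega> / sd \<omega>)" for n
    by (rule distr_cong) (auto simp: normalized_rho_fluctuation_eq)
  ultimately show ?thesis
    using fluctuation_limit rho_fluctuation_limit normalized_rho_fluctuation_limit by auto
qed

end
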